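(* Let $k$ be a field, let $G$ be a finite group and let $\mathcal{C}\to\mathcal{B}$ be a Galois covering of $k$-categories with group $G$. Let $\mathcal{B}\# k^G\to(\mathcal{B}\# k^G)\# kG$ be the associated smash extension. Then $\mathcal{B}\# k^G$ is Morita equivalent to $\mathcal{C}$, and $(\mathcal{B}\# k^G)\# kG$ is Morita equivalent to $\mathcal{B}$.
   Context: A $k$-category is a category whose objects form a set, whose morphism sets ${}_y\mathcal{C}_x$ (from $x$ to $y$) are $k$-vector spaces, and whose composition is $k$-bilinear. Functors and equivalences between $k$-linear categories are understood to be $k$-linear. A left $\mathcal{C}$-module is a $k$-linear covariant functor from $\mathcal{C}$ to $k$-vector spaces, with natural transformations as morphisms; two $k$-categories are Morita equivalent if their categories of left modules are equivalent. A $G$-$k$-category is a $k$-category $\mathcal{C}$ with an action of $G$ on its set of objects and $k$-linear maps $s:{}_y\mathcal{C}_x\to{}_{sy}\mathcal{C}_{sx}$ for $s\in G$ such that $s(gf)=s(g)s(f)$, $t(sf)=(ts)f$ and $1f=f$. It is free if $sx=x$ for an object $x$ implies $s=1$. For a free $G$-$k$-category $\mathcal{C}$, the quotient category $\mathcal{C}/G$ has as objects the $G$-orbits of objects, with morphisms ${}_\beta(\mathcal{C}/G)_\alpha=\left(\bigoplus_{b\in\beta,a\in\alpha}{}_b\mathcal{C}_a\right)/G$, where $X/G$ denotes the coinvariants of a $kG$-module $X$. For $g\in{}_d\mathcal{C}_c$ and $f\in{}_b\mathcal{C}_a$ with $c=sb$ ($s\in G$), composition is $[g][f]=[g\,(sf)]$.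 A Galois covering with group $G$ is the projection functor $\mathcal{C}\to\mathcal{B}=\mathcal{C}/G$, where $\mathcal{C}$ is a free $G$-$k$-category. Associated grading: choose an object $x_\alpha$ in each orbit $\alpha$. Then ${}_\beta\mathcal{B}_\alpha\cong\bigoplus_{g\in G}{}_{x_\beta}\mathcal{C}_{gx_\alpha}$, and $\mathcal{B}$ is $G$-graded by letting the degree $g$ component ${}_\beta\mathcal{B}_\alpha^g$ be the image of ${}_{x_\beta}\mathcal{C}_{gx_\alpha}$. Smash categories: if $H$ is a Hopf algebra and $\mathcal{D}$ is an $H$-module category (each morphism space is an $H$-module, composition maps are $H$-module maps for the diagonal action, and $h\,1_x=\epsilon(h)1_x$ for each object $x$), then $\mathcal{D}\# H$ has the same objects as $\mathcal{D}$, morphisms ${}_y(\mathcal{D}\# H)_x={}_y\mathcal{D}_x\otimes_k H$, and composition $(\varphi\otimes h)(\psi\otimes h')=\sum\varphi\,(h_1\psi)\otimes h_2h'$. The smash extension is the functor $\mathcal{D}\to\mathcal{D}\# H$ that is the identity on objects and $f\mapsto f\otimes 1$ on morphisms. The $G$-graded category $\mathcal{B}$ is a $k^G$-module category, where $k^G=(kG)^*$ has basis $(\delta_s)_{s\in G}$ dual to $G$ and $\delta_s$ acts as projection onto the degree $s$ component; this defines $\mathcal{B}\# k^G$. In turn $\mathcal{B}\# k^G$ is a $kG$-module category via $t(f\otimes\delta_s)=f\otimes\delta_{st^{-1}}$ for $s,t\in G$; this defines $(\mathcal{B}\# k^G)\# kG$. *)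

theory Defs
  imports "HOL-Algebra.Module" "HOL-Algebra.Group_Action" "HOL-Algebra.AbelCoset"
begin

text \<open>
  Over a field \<open>K\<close>, a vector space is a record \<open>V\<close> with \<open>module K V\<close>. Such records inherit the
  fields \<open>mult\<close> and \<open>one\<close> from rings; the locale \<open>module\<close> ignores them and they are left
  unspecified in the constructions below.
\<close>

definition linear_maps ::
    "('k, 'r) ring_scheme \<Rightarrow> ('k, 'v) module \<Rightarrow> ('k, 'w) module \<Rightarrow> ('v \<Rightarrow> 'w) set" where
  "linear_maps K V W = {f \<in> carrier V \<rightarrow> carrier W.
     (\<forall>u\<in>carrier V. \<forall>v\<in>carrier V. f (u \<oplus>\<^bsub>V\<^esub> v) = f u \<oplus>\<^bsub>W\<^esub> f v) \<and>
     (\<forall>c\<in>carrier K. \<forall>v\<in>carrier V. f (c \<odot>\<^bsub>V\<^esub> v) = c \<odot>\<^bsub>W\<^esub> f v)}"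

definition direct_sum :: "'i set \<Rightarrow> ('i \<Rightarrow> ('k, 'v) module) \<Rightarrow> ('k, 'i \<Rightarrow> 'v) module" where
  "direct_sum I V =
     \<lparr>carrier = {f \<in> (\<Pi>\<^sub>E i\<in>I. carrier (V i)). finite {i \<in> I. f i \<noteq> \<zero>\<^bsub>V i\<^esub>}},
      mult = undefined, one = undefined,
      zero = (\<lambda>i\<in>I. \<zero>\<^bsub>V i\<^esub>),
      add = (\<lambda>f g. \<lambda>i\<in>I. f i \<oplus>\<^bsub>V i\<^esub> g i),
      smult = (\<lambda>c f. \<lambda>i\<in>I. c \<odot>\<^bsub>V i\<^esub> f i)\<rparr>"

definition direct_sum_incl ::
    "'i set \<Rightarrow> ('i \<Rightarrow> ('k, 'v) module) \<Rightarrow> 'i \<Rightarrow> 'v \<Rightarrow> 'i \<Rightarrow> 'v" where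
  "direct_sum_incl I V i v = (\<lambda>j\<in>I. if j = i then v else \<zero>\<^bsub>V j\<^esub>)"

definition spanned_submodule ::
    "('k, 'r) ring_scheme \<Rightarrow> ('k, 'v) module \<Rightarrow> 'v set \<Rightarrow> 'v set" where
  "spanned_submodule K V S = \<Inter>{N. submodule N K V \<and> S \<subseteq> N}"

definition quotient_module :: "('k, 'v) module \<Rightarrow> 'v set \<Rightarrow> ('k, 'v set) module" where
  "quotient_module V N =
     \<lparr>carrier = a_rcosets\<^bsub>V\<^esub> N,
      mult = undefined, one = undefined,
      zero = N,
      add = set_add V,
      smult = (\<lambda>c A. \<Union>a\<in>A. N +>\<^bsub>V\<^esub> (c \<odot>\<^bsub>V\<^esub> a))\<rparr>"

definition coinvariant_relations ::
    "('k, 'r) ring_scheme \<Rightarrow> ('g, 'q) monoid_scheme \<Rightarrow> ('k, 'v) module \<Rightarrow> ('g \<Rightarrow> 'v \<Rightarrow> 'v) \<Rightarrow> 'v set"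
  where
  "coinvariant_relations K G V act =
     spanned_submodule K V {act s v \<ominus>\<^bsub>V\<^esub> v | s v. s \<in> carrier G \<and> v \<in> carrier V}"

definition coinvariants ::
    "('k, 'r) ring_scheme \<Rightarrow> ('g, 'q) monoid_scheme \<Rightarrow> ('k, 'v) module \<Rightarrow> ('g \<Rightarrow> 'v \<Rightarrow> 'v)
      \<Rightarrow> ('k, 'v set) module" where
  "coinvariants K G V act = quotient_module V (coinvariant_relations K G V act)"

text \<open>
  \<open>Mor C y x\<close> is the space of morphisms from \<open>x\<close> to \<open>y\<close>, and \<open>Cmp C z y x g f\<close> is the composite
  of \<open>f\<close> from \<open>x\<close> to \<open>y\<close> with \<open>g\<close> from \<open>y\<close> to \<open>z\<close>. Different morphism spaces may overlap as sets,
  which is why composition is indexed by the objects.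
\<close>

record ('k, 'o, 'm) kcat =
  Obj :: "'o set"
  Mor :: "'o \<Rightarrow> 'o \<Rightarrow> ('k, 'm) module"
  Cmp :: "'o \<Rightarrow> 'o \<Rightarrow> 'o \<Rightarrow> 'm \<Rightarrow> 'm \<Rightarrow> 'm"
  Idt :: "'o \<Rightarrow> 'm"

locale k_category = field K
  for K :: "('k, 'r) ring_scheme" and C :: "('k, 'o, 'm) kcat" +
  assumes Mor_module: "\<lbrakk>x \<in> Obj C; y \<in> Obj C\<rbrakk> \<Longrightarrow> module K (Mor C y x)"
    and Cmp_linear_right: "\<lbrakk>x \<in> Obj C; y \<in> Obj C; z \<in> Obj C; g \<in> carrier (Mor C z y)\<rbrakk>
      \<Longrightarrow> (\<lambda>f. Cmp C z y x g f) \<in> linear_maps K (Mor C y x) (Mor C z x)"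
    and Cmp_linear_left: "\<lbrakk>x \<in> Obj C; y \<in> Obj C; z \<in> Obj C; f \<in> carrier (Mor C y x)\<rbrakk>
      \<Longrightarrow> (\<lambda>g. Cmp C z y x g f) \<in> linear_maps K (Mor C z y) (Mor C z x)"
    and Cmp_assoc: "\<lbrakk>w \<in> Obj C; x \<in> Obj C; y \<in> Obj C; z \<in> Obj C; h \<in> carrier (Mor C z y);
        g \<in> carrier (Mor C y x); f \<in> carrier (Mor C x w)\<rbrakk>
      \<Longrightarrow> Cmp C z x w (Cmp C z y x h g) f = Cmp C z y w h (Cmp C y x w g f)"
    and Idt_closed: "x \<in> Obj C \<Longrightarrow> Idt C x \<in> carrier (Mor C x x)"
    and Idt_left: "\<lbrakk>x \<in> Obj C; y \<in> Obj C; f \<in> carrier (Mor C y x)\<rbrakk>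
      \<Longrightarrow> Cmp C y y x (Idt C y) f = f"
    and Idt_right: "\<lbrakk>x \<in> Obj C; y \<in> Obj C; f \<in> carrier (Mor C y x)\<rbrakk>
      \<Longrightarrow> Cmp C y x x f (Idt C x) = f"

record ('o, 'm, 'p, 'n) kfun =
  FObj :: "'o \<Rightarrow> 'p"
  FMor :: "'o \<Rightarrow> 'o \<Rightarrow> 'm \<Rightarrow> 'n"

definition k_functor ::
    "('k, 'r) ring_scheme \<Rightarrow> ('k, 'o, 'm) kcat \<Rightarrow> ('k, 'p, 'n) kcat \<Rightarrow> ('o, 'm, 'p, 'n) kfun \<Rightarrow> bool"
  where
  "k_functor K C D F \<longleftrightarrow>
     (\<forall>x\<in>Obj C. FObj F x \<in> Obj D) \<and>
     (\<forall>x\<in>Obj C. \<forall>y\<in>Obj C.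
        FMor F y x \<in> linear_maps K (Mor C y x) (Mor D (FObj F y) (FObj F x))) \<and>
     (\<forall>x\<in>Obj C. FMor F x x (Idt C x) = Idt D (FObj F x)) \<and>
     (\<forall>x\<in>Obj C. \<forall>y\<in>Obj C. \<forall>z\<in>Obj C. \<forall>g\<in>carrier (Mor C z y). \<forall>f\<in>carrier (Mor C y x).
        FMor F z x (Cmp C z y x g f) =
        Cmp D (FObj F z) (FObj F y) (FObj F x) (FMor F z y g) (FMor F y x f))"

definition id_functor :: "('o, 'm, 'o, 'm) kfun" where
  "id_functor = \<lparr>FObj = (\<lambda>x. x), FMor = (\<lambda>y x f. f)\<rparr>"

definition comp_functor ::
    "('p, 'n, 'q, 'l) kfun \<Rightarrow> ('o, 'm, 'p, 'n) kfun \<Rightarrow> ('o, 'm, 'q, 'l) kfun" where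
  "comp_functor E F =
     \<lparr>FObj = (\<lambda>x. FObj E (FObj F x)),
      FMor = (\<lambda>y x f. FMor E (FObj F y) (FObj F x) (FMor F y x f))\<rparr>"

definition natural_transformations ::
    "('k, 'o, 'm) kcat \<Rightarrow> ('k, 'p, 'n) kcat \<Rightarrow> ('o, 'm, 'p, 'n) kfun \<Rightarrow> ('o, 'm, 'p, 'n) kfun
      \<Rightarrow> ('o \<Rightarrow> 'n) set" where
  "natural_transformations C D F E =
     {\<tau> \<in> (\<Pi>\<^sub>E x\<in>Obj C. carrier (Mor D (FObj E x) (FObj F x))).
        \<forall>x\<in>Obj C. \<forall>y\<in>Obj C. \<forall>f\<in>carrier (Mor C y x).
          Cmp D (FObj E y) (FObj F y) (FObj F x) (\<tau> y) (FMor F y x f) =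
          Cmp D (FObj E y) (FObj E x) (FObj F x) (FMor E y x f) (\<tau> x)}"

definition functor_category ::
    "('k, 'r) ring_scheme \<Rightarrow> ('k, 'o, 'm) kcat \<Rightarrow> ('k, 'p, 'n) kcat
      \<Rightarrow> ('k, ('o, 'm, 'p, 'n) kfun, 'o \<Rightarrow> 'n) kcat" where
  "functor_category K C D =
     \<lparr>Obj = {F. k_functor K C D F},
      Mor = (\<lambda>E F.
        \<lparr>carrier = natural_transformations C D F E,
         mult = undefined, one = undefined,
         zero = (\<lambda>x\<in>Obj C. \<zero>\<^bsub>Mor D (FObj E x) (FObj F x)\<^esub>),
         add = (\<lambda>\<sigma> \<tau>. \<lambda>x\<in>Obj C. \<sigma> x \<oplus>\<^bsub>Mor D (FObj E x) (FObj F x)\<^esub> \<tau> x),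
         smult = (\<lambda>c \<tau>. \<lambda>x\<in>Obj C. c \<odot>\<^bsub>Mor D (FObj E x) (FObj F x)\<^esub> \<tau> x)\<rparr>),
      Cmp = (\<lambda>H E F \<sigma> \<tau>. \<lambda>x\<in>Obj C. Cmp D (FObj H x) (FObj E x) (FObj F x) (\<sigma> x) (\<tau> x)),
      Idt = (\<lambda>F. \<lambda>x\<in>Obj C. Idt D (FObj F x))\<rparr>"

definition isomorphic_in :: "('k, 'o, 'm) kcat \<Rightarrow> 'o \<Rightarrow> 'o \<Rightarrow> bool" where
  "isomorphic_in C x y \<longleftrightarrow> x \<in> Obj C \<and> y \<in> Obj C \<and>
     (\<exists>f\<in>carrier (Mor C y x). \<exists>g\<in>carrier (Mor C x y).
        Cmp C x y x g f = Idt C x \<and> Cmp C y x y f g = Idt C y)"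

definition k_equivalent ::
    "('k, 'r) ring_scheme \<Rightarrow> ('k, 'o, 'm) kcat \<Rightarrow> ('k, 'p, 'n) kcat \<Rightarrow> bool" where
  "k_equivalent K C D \<longleftrightarrow> (\<exists>F E. k_functor K C D F \<and> k_functor K D C E \<and>
     isomorphic_in (functor_category K C C) (comp_functor E F) id_functor \<and>
     isomorphic_in (functor_category K D D) (comp_functor F E) id_functor)"

text \<open>
  The type \<open>'v\<close> plays the role of a universe: the objects of \<open>vector_spaces K\<close> are the vector
  spaces whose underlying set is a set of elements of \<open>'v\<close>.
\<close>

definition vector_spaces ::
    "('k, 'r) ring_scheme \<Rightarrow> ('k, ('k, 'v) module, 'v \<Rightarrow> 'v) kcat" where
  "vector_spaces K =
     \<lparr>Obj = {V. module K V},
      Mor = (\<lambda>W V.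
        \<lparr>carrier = linear_maps K V W \<inter> extensional (carrier V),
         mult = undefined, one = undefined,
         zero = (\<lambda>v\<in>carrier V. \<zero>\<^bsub>W\<^esub>),
         add = (\<lambda>f g. \<lambda>v\<in>carrier V. f v \<oplus>\<^bsub>W\<^esub> g v),
         smult = (\<lambda>c f. \<lambda>v\<in>carrier V. c \<odot>\<^bsub>W\<^esub> f v)\<rparr>),
      Cmp = (\<lambda>W V U g f. compose (carrier U) g f),
      Idt = (\<lambda>V. \<lambda>v\<in>carrier V. v)\<rparr>"

definition left_modules ::
    "('k, 'r) ring_scheme \<Rightarrow> ('k, 'o, 'm) kcat
      \<Rightarrow> ('k, ('o, 'm, ('k, 'v) module, 'v \<Rightarrow> 'v) kfun, 'o \<Rightarrow> 'v \<Rightarrow> 'v) kcat" where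
  "left_modules K C = functor_category K C (vector_spaces K)"

definition morita_equivalent ::
    "'v itself \<Rightarrow> ('k, 'r) ring_scheme \<Rightarrow> ('k, 'o, 'm) kcat \<Rightarrow> ('k, 'p, 'n) kcat \<Rightarrow> bool" where
  "morita_equivalent _ K C D \<longleftrightarrow> k_category K C \<and> k_category K D \<and>
     k_equivalent K
       (left_modules K C :: ('k, ('o, 'm, ('k, 'v) module, 'v \<Rightarrow> 'v) kfun, 'o \<Rightarrow> 'v \<Rightarrow> 'v) kcat)
       (left_modules K D :: ('k, ('p, 'n, ('k, 'v) module, 'v \<Rightarrow> 'v) kfun, 'p \<Rightarrow> 'v \<Rightarrow> 'v) kcat)"

text \<open>
  \<open>\<phi> s x\<close> is the object \<open>s x\<close>, and \<open>\<psi> s y x f\<close> is the morphism \<open>s f\<close> from \<open>s x\<close> to \<open>s y\<close>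
  for \<open>f\<close> from \<open>x\<close> to \<open>y\<close>.
\<close>

locale G_k_category = k_category K C + group_action G "Obj C" \<phi>
  for K :: "('k, 'r) ring_scheme" and G :: "('g, 'q) monoid_scheme"
    and C :: "('k, 'o, 'm) kcat" and \<phi> :: "'g \<Rightarrow> 'o \<Rightarrow> 'o"
    and \<psi> :: "'g \<Rightarrow> 'o \<Rightarrow> 'o \<Rightarrow> 'm \<Rightarrow> 'm" +
  assumes act_linear: "\<lbrakk>s \<in> carrier G; x \<in> Obj C; y \<in> Obj C\<rbrakk>
      \<Longrightarrow> \<psi> s y x \<in> linear_maps K (Mor C y x) (Mor C (\<phi> s y) (\<phi> s x))"
    and act_Cmp: "\<lbrakk>s \<in> carrier G; x \<in> Obj C; y \<in> Obj C; z \<in> Obj C;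
        g \<in> carrier (Mor C z y); f \<in> carrier (Mor C y x)\<rbrakk>
      \<Longrightarrow> \<psi> s z x (Cmp C z y x g f) = Cmp C (\<phi> s z) (\<phi> s y) (\<phi> s x) (\<psi> s z y g) (\<psi> s y x f)"
    and act_mult: "\<lbrakk>s \<in> carrier G; t \<in> carrier G; x \<in> Obj C; y \<in> Obj C; f \<in> carrier (Mor C y x)\<rbrakk>
      \<Longrightarrow> \<psi> t (\<phi> s y) (\<phi> s x) (\<psi> s y x f) = \<psi> (t \<otimes>\<^bsub>G\<^esub> s) y x f"
    and act_one: "\<lbrakk>x \<in> Obj C; y \<in> Obj C; f \<in> carrier (Mor C y x)\<rbrakk> \<Longrightarrow> \<psi> \<one>\<^bsub>G\<^esub> y x f = f"

locale free_G_k_category = G_k_category +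
  assumes free: "\<lbrakk>s \<in> carrier G; x \<in> Obj C; \<phi> s x = x\<rbrakk> \<Longrightarrow> s = \<one>\<^bsub>G\<^esub>"

definition orbit_sum :: "('k, 'o, 'm) kcat \<Rightarrow> 'o set \<Rightarrow> 'o set \<Rightarrow> ('k, 'o \<times> 'o \<Rightarrow> 'm) module" where
  "orbit_sum C \<beta> \<alpha> = direct_sum (\<beta> \<times> \<alpha>) (\<lambda>(b, a). Mor C b a)"

definition orbit_incl ::
    "('k, 'o, 'm) kcat \<Rightarrow> 'o set \<Rightarrow> 'o set \<Rightarrow> 'o \<Rightarrow> 'o \<Rightarrow> 'm \<Rightarrow> 'o \<times> 'o \<Rightarrow> 'm" where
  "orbit_incl C \<beta> \<alpha> b a f = direct_sum_incl (\<beta> \<times> \<alpha>) (\<lambda>(b, a). Mor C b a) (b, a) f"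

text \<open>The component of \<open>s F\<close> at \<open>(b, a)\<close> is \<open>s\<close> applied to that of \<open>F\<close> at \<open>(s\<inverse> b, s\<inverse> a)\<close>.\<close>

definition orbit_sum_act ::
    "('g, 'q) monoid_scheme \<Rightarrow> ('g \<Rightarrow> 'o \<Rightarrow> 'o) \<Rightarrow> ('g \<Rightarrow> 'o \<Rightarrow> 'o \<Rightarrow> 'm \<Rightarrow> 'm) \<Rightarrow> 'o set \<Rightarrow> 'o set
      \<Rightarrow> 'g \<Rightarrow> ('o \<times> 'o \<Rightarrow> 'm) \<Rightarrow> 'o \<times> 'o \<Rightarrow> 'm" where
  "orbit_sum_act G \<phi> \<psi> \<beta> \<alpha> s F =
     (\<lambda>(b, a)\<in>\<beta> \<times> \<alpha>. \<psi> s (\<phi> (inv\<^bsub>G\<^esub> s) b) (\<phi> (inv\<^bsub>G\<^esub> s) a) (F (\<phi> (inv\<^bsub>G\<^esub> s) b, \<phi> (inv\<^bsub>G\<^esub> s) a)))"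

definition orbit_class ::
    "('k, 'r) ring_scheme \<Rightarrow> ('g, 'q) monoid_scheme \<Rightarrow> ('k, 'o, 'm) kcat \<Rightarrow> ('g \<Rightarrow> 'o \<Rightarrow> 'o)
      \<Rightarrow> ('g \<Rightarrow> 'o \<Rightarrow> 'o \<Rightarrow> 'm \<Rightarrow> 'm) \<Rightarrow> 'o set \<Rightarrow> 'o set \<Rightarrow> ('o \<times> 'o \<Rightarrow> 'm) \<Rightarrow> ('o \<times> 'o \<Rightarrow> 'm) set"
  where
  "orbit_class K G C \<phi> \<psi> \<beta> \<alpha> F =
     coinvariant_relations K G (orbit_sum C \<beta> \<alpha>) (orbit_sum_act G \<phi> \<psi> \<beta> \<alpha>) +>\<^bsub>orbit_sum C \<beta> \<alpha>\<^esub> F"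

text \<open>
  Bilinear extension of the rule \<open>[g][f] = [g (s f)]\<close> for \<open>g\<close> from \<open>c\<close> to \<open>d\<close> and \<open>f\<close> from \<open>a\<close>
  to \<open>b\<close> with \<open>c = s b\<close>: the product \<open>g (s f)\<close> is a morphism from \<open>a' = s a\<close> to \<open>d\<close>. As the action
  is free, the pairs \<open>(c, b)\<close> are parametrised by the pairs \<open>(c, s)\<close> via \<open>b = s\<inverse> c\<close>. The sum is
  meaningful for finite \<open>G\<close> only.
\<close>

definition orbit_sum_Cmp ::
    "('g, 'q) monoid_scheme \<Rightarrow> ('k, 'o, 'm) kcat \<Rightarrow> ('g \<Rightarrow> 'o \<Rightarrow> 'o) \<Rightarrow> ('g \<Rightarrow> 'o \<Rightarrow> 'o \<Rightarrow> 'm \<Rightarrow> 'm)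
      \<Rightarrow> 'o set \<Rightarrow> 'o set \<Rightarrow> 'o set \<Rightarrow> ('o \<times> 'o \<Rightarrow> 'm) \<Rightarrow> ('o \<times> 'o \<Rightarrow> 'm) \<Rightarrow> 'o \<times> 'o \<Rightarrow> 'm" where
  "orbit_sum_Cmp G C \<phi> \<psi> \<gamma> \<beta> \<alpha> g f =
     (\<lambda>(d, a')\<in>\<gamma> \<times> \<alpha>. \<Oplus>\<^bsub>Mor C d a'\<^esub>c\<in>\<beta>. \<Oplus>\<^bsub>Mor C d a'\<^esub>s\<in>carrier G.
        Cmp C d c a' (g (d, c))
          (\<psi> s (\<phi> (inv\<^bsub>G\<^esub> s) c) (\<phi> (inv\<^bsub>G\<^esub> s) a') (f (\<phi> (inv\<^bsub>G\<^esub> s) c, \<phi> (inv\<^bsub>G\<^esub> s) a'))))"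

definition quotient_category ::
    "('k, 'r) ring_scheme \<Rightarrow> ('g, 'q) monoid_scheme \<Rightarrow> ('k, 'o, 'm) kcat \<Rightarrow> ('g \<Rightarrow> 'o \<Rightarrow> 'o)
      \<Rightarrow> ('g \<Rightarrow> 'o \<Rightarrow> 'o \<Rightarrow> 'm \<Rightarrow> 'm) \<Rightarrow> ('k, 'o set, ('o \<times> 'o \<Rightarrow> 'm) set) kcat" where
  "quotient_category K G C \<phi> \<psi> =
     \<lparr>Obj = orbits G (Obj C) \<phi>,
      Mor = (\<lambda>\<beta> \<alpha>. coinvariants K G (orbit_sum C \<beta> \<alpha>) (orbit_sum_act G \<phi> \<psi> \<beta> \<alpha>)),
      Cmp = (\<lambda>\<gamma> \<beta> \<alpha> A B. \<Union>g\<in>A. \<Union>f\<in>B.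
        orbit_class K G C \<phi> \<psi> \<gamma> \<alpha> (orbit_sum_Cmp G C \<phi> \<psi> \<gamma> \<beta> \<alpha> g f)),
      Idt = (\<lambda>\<alpha>. \<Union>a\<in>\<alpha>. orbit_class K G C \<phi> \<psi> \<alpha> \<alpha> (orbit_incl C \<alpha> \<alpha> a a (Idt C a)))\<rparr>"

definition projection_functor ::
    "('k, 'r) ring_scheme \<Rightarrow> ('g, 'q) monoid_scheme \<Rightarrow> ('k, 'o, 'm) kcat \<Rightarrow> ('g \<Rightarrow> 'o \<Rightarrow> 'o)
      \<Rightarrow> ('g \<Rightarrow> 'o \<Rightarrow> 'o \<Rightarrow> 'm \<Rightarrow> 'm) \<Rightarrow> ('o, 'm, 'o set, ('o \<times> 'o \<Rightarrow> 'm) set) kfun" where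
  "projection_functor K G C \<phi> \<psi> =
     \<lparr>FObj = orbit G \<phi>,
      FMor = (\<lambda>y x f. orbit_class K G C \<phi> \<psi> (orbit G \<phi> y) (orbit G \<phi> x)
        (orbit_incl C (orbit G \<phi> y) (orbit G \<phi> x) y x f))\<rparr>"

definition galois_covering ::
    "('k, 'r) ring_scheme \<Rightarrow> ('g, 'q) monoid_scheme \<Rightarrow> ('k, 'o, 'm) kcat \<Rightarrow> ('g \<Rightarrow> 'o \<Rightarrow> 'o)
      \<Rightarrow> ('g \<Rightarrow> 'o \<Rightarrow> 'o \<Rightarrow> 'm \<Rightarrow> 'm) \<Rightarrow> ('k, 'o set, ('o \<times> 'o \<Rightarrow> 'm) set) kcat
      \<Rightarrow> ('o, 'm, 'o set, ('o \<times> 'o \<Rightarrow> 'm) set) kfun \<Rightarrow> bool" where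
  "galois_covering K G C \<phi> \<psi> B P \<longleftrightarrow> free_G_k_category K G C \<phi> \<psi> \<and>
     B = quotient_category K G C \<phi> \<psi> \<and> P = projection_functor K G C \<phi> \<psi>"

text \<open>\<open>x \<alpha>\<close> is the chosen object of the orbit \<open>\<alpha>\<close>.\<close>

definition degree_component ::
    "('k, 'r) ring_scheme \<Rightarrow> ('g, 'q) monoid_scheme \<Rightarrow> ('k, 'o, 'm) kcat \<Rightarrow> ('g \<Rightarrow> 'o \<Rightarrow> 'o)
      \<Rightarrow> ('g \<Rightarrow> 'o \<Rightarrow> 'o \<Rightarrow> 'm \<Rightarrow> 'm) \<Rightarrow> ('o set \<Rightarrow> 'o) \<Rightarrow> 'o set \<Rightarrow> 'o set \<Rightarrow> 'g
      \<Rightarrow> ('o \<times> 'o \<Rightarrow> 'm) set set" where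
  "degree_component K G C \<phi> \<psi> x \<beta> \<alpha> s =
     (\<lambda>f. orbit_class K G C \<phi> \<psi> \<beta> \<alpha> (orbit_incl C \<beta> \<alpha> (x \<beta>) (\<phi> s (x \<alpha>)) f)) `
       carrier (Mor C (x \<beta>) (\<phi> s (x \<alpha>)))"

definition homogeneous_part ::
    "('g, 'q) monoid_scheme \<Rightarrow> ('k, 'v) module \<Rightarrow> ('g \<Rightarrow> 'v set) \<Rightarrow> 'g \<Rightarrow> 'v \<Rightarrow> 'v" where
  "homogeneous_part G V V' s v =
     (THE u. u \<in> (\<Pi>\<^sub>E t\<in>carrier G. V' t) \<and> v = (\<Oplus>\<^bsub>V\<^esub>t\<in>carrier G. u t)) s"

definition grading_act ::
    "('k, 'r) ring_scheme \<Rightarrow> ('g, 'q) monoid_scheme \<Rightarrow> ('k, 'o, 'm) kcat \<Rightarrow> ('g \<Rightarrow> 'o \<Rightarrow> 'o)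
      \<Rightarrow> ('g \<Rightarrow> 'o \<Rightarrow> 'o \<Rightarrow> 'm \<Rightarrow> 'm) \<Rightarrow> ('o set \<Rightarrow> 'o)
      \<Rightarrow> 'g \<Rightarrow> 'o set \<Rightarrow> 'o set \<Rightarrow> ('o \<times> 'o \<Rightarrow> 'm) set \<Rightarrow> ('o \<times> 'o \<Rightarrow> 'm) set" where
  "grading_act K G C \<phi> \<psi> x s \<beta> \<alpha> =
     homogeneous_part G (Mor (quotient_category K G C \<phi> \<psi>) \<beta> \<alpha>) (degree_component K G C \<phi> \<psi> x \<beta> \<alpha>) s"

text \<open>
  A Hopf algebra \<open>H\<close> with a finite basis \<open>(e a)\<close>, \<open>a \<in> hbasis H\<close>, is given by structure constants:
  \<open>hmult H a b d\<close> is the coefficient of \<open>e d\<close> in \<open>e a e b\<close>, \<open>hunit H d\<close> that of \<open>e d\<close> in \<open>1\<close>, and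
  \<open>hcomult H b a a'\<close> that of \<open>e a \<otimes> e a'\<close> in \<open>\<Delta> (e b)\<close>. The counit and the antipode do not enter
  the construction of a smash category and are not recorded.

  The space \<open>V \<otimes> H\<close> is the direct sum of copies of \<open>V\<close> indexed by the basis: \<open>F\<close> stands for the
  sum of the \<open>F b \<otimes> e b\<close>. An action of \<open>H\<close> is given on basis elements.
\<close>

record ('k, 'h) hopf_data =
  hbasis :: "'h set"
  hmult :: "'h \<Rightarrow> 'h \<Rightarrow> 'h \<Rightarrow> 'k"
  hunit :: "'h \<Rightarrow> 'k"
  hcomult :: "'h \<Rightarrow> 'h \<Rightarrow> 'h \<Rightarrow> 'k"

definition pure_tensor ::
    "('k, 'h) hopf_data \<Rightarrow> ('k, 'v) module \<Rightarrow> 'v \<Rightarrow> ('h \<Rightarrow> 'k) \<Rightarrow> 'h \<Rightarrow> 'v" where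
  "pure_tensor H V v h = (\<lambda>b\<in>hbasis H. h b \<odot>\<^bsub>V\<^esub> v)"

definition smash_category ::
    "('k, 'r) ring_scheme \<Rightarrow> ('k, 'h) hopf_data \<Rightarrow> ('h \<Rightarrow> 'o \<Rightarrow> 'o \<Rightarrow> 'm \<Rightarrow> 'm)
      \<Rightarrow> ('k, 'o, 'm) kcat \<Rightarrow> ('k, 'o, 'h \<Rightarrow> 'm) kcat" where
  "smash_category K H act D =
     \<lparr>Obj = Obj D,
      Mor = (\<lambda>y x. direct_sum (hbasis H) (\<lambda>_. Mor D y x)),
      Cmp = (\<lambda>z y x F E. \<lambda>d\<in>hbasis H.
        \<Oplus>\<^bsub>Mor D z x\<^esub>b\<in>hbasis H. \<Oplus>\<^bsub>Mor D z x\<^esub>c\<in>hbasis H.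
        \<Oplus>\<^bsub>Mor D z x\<^esub>a\<in>hbasis H. \<Oplus>\<^bsub>Mor D z x\<^esub>a'\<in>hbasis H.
          (hcomult H b a a' \<otimes>\<^bsub>K\<^esub> hmult H a' c d) \<odot>\<^bsub>Mor D z x\<^esub> Cmp D z y x (F b) (act a y x (E c))),
      Idt = (\<lambda>x. pure_tensor H (Mor D x x) (Idt D x) (hunit H))\<rparr>"

definition smash_extension ::
    "('k, 'r) ring_scheme \<Rightarrow> ('k, 'h) hopf_data \<Rightarrow> ('h \<Rightarrow> 'o \<Rightarrow> 'o \<Rightarrow> 'm \<Rightarrow> 'm)
      \<Rightarrow> ('k, 'o, 'm) kcat \<Rightarrow> ('k, 'o, 'h \<Rightarrow> 'm) kcat \<Rightarrow> ('o, 'm, 'o, 'h \<Rightarrow> 'm) kfun \<Rightarrow> bool" where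
  "smash_extension K H act D S E \<longleftrightarrow> S = smash_category K H act D \<and>
     E = \<lparr>FObj = (\<lambda>x. x), FMor = (\<lambda>y x f. pure_tensor H (Mor D y x) f (hunit H))\<rparr>"

definition group_algebra ::
    "('k, 'r) ring_scheme \<Rightarrow> ('g, 'q) monoid_scheme \<Rightarrow> ('k, 'g) hopf_data" where
  "group_algebra K G =
     \<lparr>hbasis = carrier G,
      hmult = (\<lambda>s t d. if s \<otimes>\<^bsub>G\<^esub> t = d then \<one>\<^bsub>K\<^esub> else \<zero>\<^bsub>K\<^esub>),
      hunit = (\<lambda>d. if d = \<one>\<^bsub>G\<^esub> then \<one>\<^bsub>K\<^esub> else \<zero>\<^bsub>K\<^esub>),
      hcomult = (\<lambda>s u v. if u = s \<and> v = s then \<one>\<^bsub>K\<^esub> else \<zero>\<^bsub>K\<^esub>)\<rparr>"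

text \<open>Here the basis element indexed by \<open>s\<close> is \<open>\<delta> s\<close>; \<open>\<Delta> (\<delta> s)\<close> is the sum of the
  \<open>\<delta> u \<otimes> \<delta> v\<close> with \<open>u v = s\<close>.\<close>

definition dual_group_algebra ::
    "('k, 'r) ring_scheme \<Rightarrow> ('g, 'q) monoid_scheme \<Rightarrow> ('k, 'g) hopf_data" where
  "dual_group_algebra K G =
     \<lparr>hbasis = carrier G,
      hmult = (\<lambda>s t d. if s = t \<and> d = s then \<one>\<^bsub>K\<^esub> else \<zero>\<^bsub>K\<^esub>),
      hunit = (\<lambda>d. \<one>\<^bsub>K\<^esub>),
      hcomult = (\<lambda>s u v. if u \<otimes>\<^bsub>G\<^esub> v = s then \<one>\<^bsub>K\<^esub> else \<zero>\<^bsub>K\<^esub>)\<rparr>"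

text \<open>
  Since \<open>t (f \<otimes> \<delta> s) = f \<otimes> \<delta> (s t\<inverse>)\<close>, the coefficient of \<open>t F\<close> at \<open>\<delta> u\<close> is that of \<open>F\<close> at
  \<open>\<delta> (u t)\<close>.
\<close>

definition translation_act ::
    "('g, 'q) monoid_scheme \<Rightarrow> 'g \<Rightarrow> 'p \<Rightarrow> 'p \<Rightarrow> ('g \<Rightarrow> 'n) \<Rightarrow> 'g \<Rightarrow> 'n" where
  "translation_act G t y x F = (\<lambda>u\<in>carrier G. F (u \<otimes>\<^bsub>G\<^esub> t))"

end

theory Submission
  imports Defs "HOL-Algebra.Free_Abelian_Groups"
begin

text \<open>
  A category \<open>D\<close> is presented by matrices over \<open>C\<close> if every object \<open>X\<close> of \<open>D\<close> comes with a finite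
  family of objects \<open>ob X i\<close> of \<open>C\<close> such that the morphisms from \<open>X\<close> to \<open>Y\<close> are the matrices of
  morphisms from \<open>ob X i\<close> to \<open>ob Y j\<close>, composed by the matrix product. If every object of \<open>C\<close>
  occurs among the \<open>ob X i\<close>, then \<open>C\<close> is a full corner of \<open>D\<close>, cut out by diagonal matrix units,
  and the two categories are Morita equivalent: a \<open>D\<close>-module restricts to the images of these
  idempotents, and a \<open>C\<close>-module \<open>N\<close> induces the \<open>D\<close>-module whose value at \<open>X\<close> is the sum of
  the \<open>N (ob X i)\<close>.

  Both claims are instances of this. Since a free action permutes the rows of a matrix indexed by
  orbits simply transitively, Higman's criterion applies: the norm \<open>F \<mapsto> \<Sum>s. s F\<close> identifies the
  coinvariants that form the morphism spaces of \<open>B = C/G\<close> with the \<open>G\<close>-invariant matrices of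
  morphisms of \<open>C\<close>, and composition in \<open>B\<close> with the matrix product. An invariant matrix is
  determined by any of its columns, and every column occurs; so the column at \<open>s\<inverse> x\<^sub>\<alpha>\<close> of the
  coefficient of \<open>\<delta> s\<close>, for all \<open>s\<close>, presents \<open>B # k\<^sup>G\<close> by matrices over \<open>C\<close>. The second claim holds
  for every \<open>G\<close>-graded category \<open>B\<close>: by Cohen-Montgomery duality \<open>(B # k\<^sup>G) # kG\<close> is presented by
  matrices over \<open>B\<close> with rows and columns in \<open>G\<close>.
\<close>

section \<open>Finite sums and linear maps\<close>

context group
begin

lemma
  assumes "x \<in> carrier G" "y \<in> carrier G"
  shows mult_inv_cancel: "x \<otimes> (inv x \<otimes> y) = y" and inv_mult_cancel: "inv x \<otimes> (x \<otimes> y) = y"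
  using assms by (simp_all add: m_assoc[symmetric])

lemmas word_simps = m_assoc inv_mult_group mult_inv_cancel inv_mult_cancel

lemma inv_mult_eq_one_iff:
  assumes "x \<in> carrier G" "y \<in> carrier G"
  shows "inv x \<otimes> y = \<one> \<longleftrightarrow> y = x"
  using inv_solve_left'[of "\<one>" x y] assms by auto

lemma
  assumes "s \<in> carrier G"
  shows bij_betw_mult_left: "bij_betw (\<lambda>r. s \<otimes> r) (carrier G) (carrier G)"
    and bij_betw_mult_right: "bij_betw (\<lambda>r. r \<otimes> s) (carrier G) (carrier G)"
proof -
  show "bij_betw (\<lambda>r. s \<otimes> r) (carrier G) (carrier G)"
    by (rule bij_betwI[where g = "\<lambda>r. inv s \<otimes> r"]) (use assms in \<open>auto simp: word_simps\<close>)
  show "bij_betw (\<lambda>r. r \<otimes> s) (carrier G) (carrier G)"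
    by (rule bij_betwI[where g = "\<lambda>r. r \<otimes> inv s"]) (use assms in \<open>auto simp: word_simps\<close>)
qed

end

context abelian_monoid
begin

lemma finsum_eq_single:
  assumes "finite A" "i \<in> A" "f i \<in> carrier G" "\<And>j. \<lbrakk>j \<in> A; j \<noteq> i\<rbrakk> \<Longrightarrow> f j = \<zero>"
  shows "(\<Oplus>j\<in>A. f j) = f i"
proof -
  have "f \<in> A \<rightarrow> carrier G"
    using assms(3,4) by (metis Pi_I zero_closed)
  then show ?thesis
    using add.finprod_mono_neutral_cong_right[of A "{i}" f f] assms by simp
qed

lemma finsum_eq_single3:
  assumes fin: "finite A" "finite B" "finite C" and mem: "p \<in> A" "q \<in> B" "r \<in> C"
    and closed: "f p q r \<in> carrier G"
    and zero: "\<And>a b c. \<lbrakk>a \<in> A; b \<in> B; c \<in> C; (a, b, c) \<noteq> (p, q, r)\<rbrakk> \<Longrightarrow> f a b c = \<zero>"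
  shows "(\<Oplus>a\<in>A. \<Oplus>b\<in>B. \<Oplus>c\<in>C. f a b c) = f p q r"
proof -
  have inner: "(\<Oplus>c\<in>C. f p q c) = f p q r"
    by (rule finsum_eq_single) (use fin mem closed zero in auto)
  have middle: "(\<Oplus>b\<in>B. \<Oplus>c\<in>C. f p b c) = (\<Oplus>c\<in>C. f p q c)"
    by (rule finsum_eq_single) (use fin mem closed zero inner in \<open>auto intro!: add.finprod_one_eqI\<close>)
  have "(\<Oplus>a\<in>A. \<Oplus>b\<in>B. \<Oplus>c\<in>C. f a b c) = (\<Oplus>b\<in>B. \<Oplus>c\<in>C. f p b c)"
    by (rule finsum_eq_single)
      (use fin mem closed zero inner middle in \<open>auto intro!: add.finprod_one_eqI\<close>)
  then show ?thesis
    by (simp only: inner middle)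
qed

lemma finsum_swap:
  assumes "finite A" "finite B" "\<And>i j. \<lbrakk>i \<in> A; j \<in> B\<rbrakk> \<Longrightarrow> f i j \<in> carrier G"
  shows "(\<Oplus>i\<in>A. \<Oplus>j\<in>B. f i j) = (\<Oplus>j\<in>B. \<Oplus>i\<in>A. f i j)"
  using assms(1,3)
proof (induction A rule: finite_induct)
  case empty
  then show ?case by simp
next
  case (insert a A)
  then have "(\<Oplus>i\<in>insert a A. \<Oplus>j\<in>B. f i j) = (\<Oplus>j\<in>B. f a j) \<oplus> (\<Oplus>j\<in>B. \<Oplus>i\<in>A. f i j)"
    by (subst finsum_insert) (auto intro!: finsum_closed)
  also have "\<dots> = (\<Oplus>j\<in>B. f a j \<oplus> (\<Oplus>i\<in>A. f i j))"
    using insert by (subst finsum_addf) (auto intro!: finsum_closed)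
  also have "\<dots> = (\<Oplus>j\<in>B. \<Oplus>i\<in>insert a A. f i j)"
    using insert by (intro finsum_cong') (auto intro!: finsum_closed a_closed simp: Pi_def)
  finally show ?case .
qed

lemma finsum_bij_betw:
  assumes "bij_betw h A B" "\<And>b. b \<in> B \<Longrightarrow> f b \<in> carrier G"
  shows "(\<Oplus>a\<in>A. f (h a)) = (\<Oplus>b\<in>B. f b)"
  using assms finsum_reindex[of f h A] by (auto simp: bij_betw_def)

end

lemma (in group) finsum_shear:
  assumes M: "abelian_monoid M" and fin: "finite (carrier G)" and c: "c \<in> carrier G"
    and closed: "\<And>w b. \<lbrakk>w \<in> carrier G; b \<in> carrier G\<rbrakk> \<Longrightarrow> f w b \<in> carrier M"
  shows "(\<Oplus>\<^bsub>M\<^esub>w\<in>carrier G. \<Oplus>\<^bsub>M\<^esub>b\<in>carrier G. f w b) =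
    (\<Oplus>\<^bsub>M\<^esub>j\<in>carrier G. \<Oplus>\<^bsub>M\<^esub>z\<in>carrier G. f (z \<otimes> inv (c \<otimes> j)) (c \<otimes> j))"
proof -
  interpret M: abelian_monoid M by (rule M)
  have "(\<Oplus>\<^bsub>M\<^esub>w\<in>carrier G. \<Oplus>\<^bsub>M\<^esub>b\<in>carrier G. f w b) =
      (\<Oplus>\<^bsub>M\<^esub>b\<in>carrier G. \<Oplus>\<^bsub>M\<^esub>w\<in>carrier G. f w b)"
    by (rule M.finsum_swap[OF fin fin closed])
  also have "\<dots> = (\<Oplus>\<^bsub>M\<^esub>j\<in>carrier G. \<Oplus>\<^bsub>M\<^esub>w\<in>carrier G. f w (c \<otimes> j))"
    by (rule M.finsum_bij_betw[OF bij_betw_mult_left[OF c], symmetric])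
      (auto intro!: M.finsum_closed closed)
  also have "\<dots> = (\<Oplus>\<^bsub>M\<^esub>j\<in>carrier G. \<Oplus>\<^bsub>M\<^esub>z\<in>carrier G. f (z \<otimes> inv (c \<otimes> j)) (c \<otimes> j))"
    by (rule M.finsum_cong'[OF refl], use c closed in \<open>force intro!: M.finsum_closed\<close>,
        rule M.finsum_bij_betw[OF bij_betw_mult_right, symmetric]) (use c closed in simp_all)
  finally show ?thesis .
qed

lemma module_abelian_group: "module K V \<Longrightarrow> abelian_group V"
  by (simp add: module_def)

lemma module_abelian_monoid: "module K V \<Longrightarrow> abelian_monoid V"
  by (simp add: module_def abelian_group_def)

lemma module_finsum_cong:
  assumes "module K V" "\<And>i. i \<in> A \<Longrightarrow> f i = g i" "\<And>i. i \<in> A \<Longrightarrow> g i \<in> carrier V"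
  shows "(\<Oplus>\<^bsub>V\<^esub>i\<in>A. f i) = (\<Oplus>\<^bsub>V\<^esub>i\<in>A. g i)"
  using assms(2,3) by (intro abelian_monoid.finsum_cong'[OF module_abelian_monoid[OF assms(1)]])
      auto

lemma module_finsum_closed:
  assumes "module K V" "\<And>i. i \<in> A \<Longrightarrow> f i \<in> carrier V"
  shows "(\<Oplus>\<^bsub>V\<^esub>i\<in>A. f i) \<in> carrier V"
  using assms(2) by (intro abelian_monoid.finsum_closed[OF module_abelian_monoid[OF assms(1)]]) auto

lemma linear_mapsI:
  assumes "\<And>v. v \<in> carrier V \<Longrightarrow> f v \<in> carrier W"
    and "\<And>u v. \<lbrakk>u \<in> carrier V; v \<in> carrier V\<rbrakk> \<Longrightarrow> f (u \<oplus>\<^bsub>V\<^esub> v) = f u \<oplus>\<^bsub>W\<^esub> f v"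
    and "\<And>c v. \<lbrakk>c \<in> carrier K; v \<in> carrier V\<rbrakk> \<Longrightarrow> f (c \<odot>\<^bsub>V\<^esub> v) = c \<odot>\<^bsub>W\<^esub> f v"
  shows "f \<in> linear_maps K V W"
  using assms by (auto simp: linear_maps_def)

lemma
  assumes "f \<in> linear_maps K V W"
  shows linear_maps_closed: "v \<in> carrier V \<Longrightarrow> f v \<in> carrier W"
    and linear_maps_add: "\<lbrakk>u \<in> carrier V; v \<in> carrier V\<rbrakk> \<Longrightarrow> f (u \<oplus>\<^bsub>V\<^esub> v) = f u \<oplus>\<^bsub>W\<^esub> f v"
    and linear_maps_smult: "\<lbrakk>c \<in> carrier K; v \<in> carrier V\<rbrakk> \<Longrightarrow> f (c \<odot>\<^bsub>V\<^esub> v) = c \<odot>\<^bsub>W\<^esub> f v"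
  using assms by (auto simp: linear_maps_def)

lemma linear_maps_abelian_group_hom:
  assumes "f \<in> linear_maps K V W" "module K V" "module K W"
  shows "abelian_group_hom V W f"
  using assms
  by (intro abelian_group_homI group_hom.intro group_hom_axioms.intro homI abelian_group.a_group)
    (auto simp: module_def linear_maps_def)

lemma
  assumes "f \<in> linear_maps K V W" "module K V" "module K W"
  shows linear_maps_zero: "f \<zero>\<^bsub>V\<^esub> = \<zero>\<^bsub>W\<^esub>"
    and linear_maps_uminus: "v \<in> carrier V \<Longrightarrow> f (\<ominus>\<^bsub>V\<^esub> v) = \<ominus>\<^bsub>W\<^esub> f v"
  using abelian_group_hom.hom_zero[OF linear_maps_abelian_group_hom[OF assms]]
    abelian_group_hom.hom_a_inv[OF linear_maps_abelian_group_hom[OF assms]] by simp_all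

lemma linear_maps_minus:
  assumes f: "f \<in> linear_maps K V W" and V: "module K V" and W: "module K W"
    and uv: "u \<in> carrier V" "v \<in> carrier V"
  shows "f (u \<ominus>\<^bsub>V\<^esub> v) = f u \<ominus>\<^bsub>W\<^esub> f v"
proof -
  interpret V: abelian_group V by (rule module_abelian_group[OF V])
  interpret W: abelian_group W by (rule module_abelian_group[OF W])
  show ?thesis
    using uv by (simp add: V.minus_eq W.minus_eq linear_maps_add[OF f]
        linear_maps_uminus[OF assms(1-3)])
qed

lemma linear_maps_finsum:
  assumes f: "f \<in> linear_maps K V W" and V: "module K V" and W: "module K W"
    and "finite A" and "\<And>i. i \<in> A \<Longrightarrow> g i \<in> carrier V"
  shows "f (\<Oplus>\<^bsub>V\<^esub>i\<in>A. g i) = (\<Oplus>\<^bsub>W\<^esub>i\<in>A. f (g i))"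
proof -
  interpret V: abelian_group V by (rule module_abelian_group[OF V])
  interpret W: abelian_group W by (rule module_abelian_group[OF W])
  show ?thesis
    using assms(4,5)
  proof (induction A rule: finite_induct)
    case empty
    then show ?case by (simp add: linear_maps_zero[OF f V W])
  next
    case (insert a A)
    then show ?case by (simp add: Pi_def linear_maps_closed[OF f] linear_maps_add[OF f])
  qed
qed

lemma linear_maps_id: "(\<lambda>v. v) \<in> linear_maps K V V"
  by (rule linear_mapsI) simp_all

lemma linear_maps_const_zero:
  assumes "module K W"
  shows "(\<lambda>v. \<zero>\<^bsub>W\<^esub>) \<in> linear_maps K V W"
proof -
  interpret W: module K W by fact
  show ?thesis by (rule linear_mapsI) simp_all
qed

lemma linear_maps_comp:
  assumes "f \<in> linear_maps K U V" "g \<in> linear_maps K V W"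
  shows "(\<lambda>v. g (f v)) \<in> linear_maps K U W"
  using assms
  by (intro linear_mapsI) (simp_all add: linear_maps_closed linear_maps_add linear_maps_smult)

lemma linear_maps_cong:
  assumes "f \<in> linear_maps K V W" "module K V" "\<And>v. v \<in> carrier V \<Longrightarrow> g v = f v"
  shows "g \<in> linear_maps K V W"
proof -
  interpret module K V by fact
  show ?thesis
    using assms(1) by (intro linear_mapsI)
      (simp_all add: assms(3) linear_maps_closed linear_maps_add linear_maps_smult)
qed

lemma linear_maps_restrict:
  assumes "f \<in> linear_maps K V W" "module K V"
  shows "restrict f (carrier V) \<in> linear_maps K V W"
  using assms by (rule linear_maps_cong) simp

lemma linear_maps_pointwise_add:
  assumes f: "f \<in> linear_maps K V W" and g: "g \<in> linear_maps K V W" and W: "module K W"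
  shows "(\<lambda>v. f v \<oplus>\<^bsub>W\<^esub> g v) \<in> linear_maps K V W"
proof -
  interpret W: module K W by (rule W)
  note closed = linear_maps_closed[OF f] linear_maps_closed[OF g]
  show ?thesis
    by (rule linear_mapsI) (simp_all add: closed linear_maps_add[OF f] linear_maps_add[OF g]
        linear_maps_smult[OF f] linear_maps_smult[OF g] W.a_ac W.smult_r_distr)
qed

lemma linear_maps_pointwise_smult:
  assumes f: "f \<in> linear_maps K V W" and W: "module K W" and c: "c \<in> carrier K"
  shows "(\<lambda>v. c \<odot>\<^bsub>W\<^esub> f v) \<in> linear_maps K V W"
proof -
  interpret W: module K W by (rule W)
  show ?thesis
    by (rule linear_mapsI) (simp_all add: c linear_maps_closed[OF f] linear_maps_add[OF f]
        linear_maps_smult[OF f] W.smult_r_distr W.smult_assoc1[symmetric] W.R.m_comm)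
qed

lemma linear_maps_pointwise_finsum:
  assumes W: "module K W" and "finite A" and f: "\<And>i. i \<in> A \<Longrightarrow> f i \<in> linear_maps K V W"
  shows "(\<lambda>v. \<Oplus>\<^bsub>W\<^esub>i\<in>A. f i v) \<in> linear_maps K V W"
proof -
  interpret W: module K W by (rule W)
  note closed = linear_maps_closed[OF f]
  show ?thesis
  proof (rule linear_mapsI)
    show "(\<Oplus>\<^bsub>W\<^esub>i\<in>A. f i (u \<oplus>\<^bsub>V\<^esub> v)) = (\<Oplus>\<^bsub>W\<^esub>i\<in>A. f i u) \<oplus>\<^bsub>W\<^esub> (\<Oplus>\<^bsub>W\<^esub>i\<in>A. f i v)"
      if "u \<in> carrier V" "v \<in> carrier V" for u v
      using that closed by (simp add: linear_maps_add[OF f] Pi_def cong: W.finsum_cong)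
    show "(\<Oplus>\<^bsub>W\<^esub>i\<in>A. f i (c \<odot>\<^bsub>V\<^esub> v)) = c \<odot>\<^bsub>W\<^esub> (\<Oplus>\<^bsub>W\<^esub>i\<in>A. f i v)"
      if "c \<in> carrier K" "v \<in> carrier V" for c v
      using that closed assms(2)
      by (simp add: linear_maps_smult[OF f] W.finsum_smult_ldistr Pi_def cong: W.finsum_cong)
  qed (use closed in auto)
qed

lemma linear_maps_lift:
  assumes U: "module K U" and V: "module K V"
    and f: "f \<in> linear_maps K V W" and inj: "inj_on f (carrier V)"
    and g: "g \<in> linear_maps K U W" and range: "\<And>u. u \<in> carrier U \<Longrightarrow> g u \<in> f ` carrier V"
  shows "(\<lambda>u. inv_into (carrier V) f (g u)) \<in> linear_maps K U V"
proof -
  interpret U: module K U by (rule U)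
  interpret V: module K V by (rule V)
  have closed: "inv_into (carrier V) f (g u) \<in> carrier V"
    and lift: "f (inv_into (carrier V) f (g u)) = g u" if "u \<in> carrier U" for u
    using range[OF that] by (auto intro: inv_into_into f_inv_into_f)
  show ?thesis
    by (rule linear_mapsI; (rule inj_onD[OF inj])?)
      (simp_all add: closed lift linear_maps_add[OF f] linear_maps_smult[OF f]
        linear_maps_add[OF g, symmetric] linear_maps_smult[OF g, symmetric])
qed

lemma linear_maps_descend:
  assumes V: "module K V" and q: "q \<in> linear_maps K V Q" and surj: "carrier Q = q ` carrier V"
    and h: "h \<in> linear_maps K V W" and eq: "\<And>v. v \<in> carrier V \<Longrightarrow> f (q v) = h v"
  shows "f \<in> linear_maps K Q W"
proof -
  interpret V: module K V by (rule V)
  show ?thesis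
    by (rule linear_mapsI)
      (auto simp: surj eq linear_maps_closed[OF h] linear_maps_add[OF h] linear_maps_smult[OF h]
        linear_maps_add[OF q, symmetric] linear_maps_smult[OF q, symmetric])
qed

lemma submodule_equalizer:
  assumes f: "f \<in> linear_maps K V W" and g: "g \<in> linear_maps K V W"
    and V: "module K V" and W: "module K W"
  shows "submodule {v \<in> carrier V. f v = g v} K V"
proof -
  interpret V: module K V by (rule V)
  show ?thesis
    by (rule V.submoduleI)
      (auto simp: linear_maps_zero[OF f V W] linear_maps_zero[OF g V W]
        linear_maps_uminus[OF f V W] linear_maps_uminus[OF g V W] linear_maps_add[OF f]
        linear_maps_add[OF g] linear_maps_smult[OF f] linear_maps_smult[OF g])
qed

section \<open>Constructions of modules\<close>

lemma module_surj_image: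
  fixes V :: "('k, 'v) module" and W :: "('k, 'w) module"
  assumes V: "module K V" and img: "carrier W = h ` carrier V" and zero: "h \<zero>\<^bsub>V\<^esub> = \<zero>\<^bsub>W\<^esub>"
    and h: "h \<in> linear_maps K V W"
  shows "module K W"
proof -
  interpret V: module K V by (rule V)
  note add = linear_maps_add[OF h, symmetric] and smult = linear_maps_smult[OF h, symmetric]
  have "abelian_group W"
  proof (rule abelian_groupI)
    fix a assume "a \<in> carrier W"
    then obtain v where v: "v \<in> carrier V" "a = h v" by (auto simp: img)
    then have "h (\<ominus>\<^bsub>V\<^esub> v) \<oplus>\<^bsub>W\<^esub> a = \<zero>\<^bsub>W\<^esub>"
      by (simp add: add V.l_neg zero)
    then show "\<exists>b\<in>carrier W. b \<oplus>\<^bsub>W\<^esub> a = \<zero>\<^bsub>W\<^esub>"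
      using v by (auto simp: img)
    show "\<zero>\<^bsub>W\<^esub> \<oplus>\<^bsub>W\<^esub> a = a"
      using v add[of "\<zero>\<^bsub>V\<^esub>" v] by (simp add: zero)
  next
    show "\<zero>\<^bsub>W\<^esub> \<in> carrier W"
      unfolding img zero[symmetric] by simp
  qed (auto simp: img add V.a_ac)
  then show ?thesis
    by (rule moduleI[OF V.is_cring])
      (auto simp: img add smult V.smult_l_distr V.smult_r_distr V.smult_assoc1)
qed

lemma module_pointwise:
  fixes W :: "('k, 'i \<Rightarrow> 'v) module"
  assumes K: "cring K" and V: "\<And>i. i \<in> I \<Longrightarrow> module K (V i)"
    and sub: "carrier W \<subseteq> (\<Pi>\<^sub>E i\<in>I. carrier (V i))"
    and zero: "\<zero>\<^bsub>W\<^esub> = (\<lambda>i\<in>I. \<zero>\<^bsub>V i\<^esub>)"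
    and add: "\<And>f g. f \<oplus>\<^bsub>W\<^esub> g = (\<lambda>i\<in>I. f i \<oplus>\<^bsub>V i\<^esub> g i)"
    and smult: "\<And>c f. c \<odot>\<^bsub>W\<^esub> f = (\<lambda>i\<in>I. c \<odot>\<^bsub>V i\<^esub> f i)"
    and zero_closed: "\<zero>\<^bsub>W\<^esub> \<in> carrier W"
    and add_closed: "\<And>f g. \<lbrakk>f \<in> carrier W; g \<in> carrier W\<rbrakk> \<Longrightarrow> f \<oplus>\<^bsub>W\<^esub> g \<in> carrier W"
    and smult_closed: "\<And>c f. \<lbrakk>c \<in> carrier K; f \<in> carrier W\<rbrakk> \<Longrightarrow> c \<odot>\<^bsub>W\<^esub> f \<in> carrier W"
  shows "module K W"
proof -
  interpret K: cring K by fact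
  have mem: "f i \<in> carrier (V i)" if "f \<in> carrier W" "i \<in> I" for f i
    using that sub by auto
  have eqI: "f = g" if "f \<in> carrier W" "g \<in> carrier W" "\<And>i. i \<in> I \<Longrightarrow> f i = g i" for f g
    using that sub by (intro PiE_ext[of f I "\<lambda>i. carrier (V i)" g]) auto
  note monoid = module_abelian_monoid[OF V] and closed = zero_closed add_closed smult_closed
  note apply_simps = zero add smult mem monoid abelian_monoid.a_assoc abelian_monoid.a_comm
    abelian_monoid.l_zero module.smult_l_distr[OF V] module.smult_r_distr[OF V]
    module.smult_assoc1[OF V]
  have group: "abelian_group W"
  proof (rule abelian_groupI)
    fix f assume f: "f \<in> carrier W"
    have inverse: "(\<ominus>\<^bsub>K\<^esub> \<one>\<^bsub>K\<^esub>) \<odot>\<^bsub>V i\<^esub> f i \<oplus>\<^bsub>V i\<^esub> f i = \<zero>\<^bsub>V i\<^esub>" if "i \<in> I" for i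
    proof -
      interpret Vi: module K "V i" by (rule V[OF that])
      show ?thesis using mem[OF f that] by (simp add: Vi.smult_l_minus Vi.l_neg)
    qed
    have "(\<ominus>\<^bsub>K\<^esub> \<one>\<^bsub>K\<^esub>) \<odot>\<^bsub>W\<^esub> f \<oplus>\<^bsub>W\<^esub> f = \<zero>\<^bsub>W\<^esub>"
      using f by (intro eqI closed) (auto simp: zero add smult inverse)
    then show "\<exists>g\<in>carrier W. g \<oplus>\<^bsub>W\<^esub> f = \<zero>\<^bsub>W\<^esub>"
      using smult_closed[OF K.a_inv_closed[OF K.one_closed] f] by blast
  next
    fix f g h assume "f \<in> carrier W" "g \<in> carrier W" "h \<in> carrier W"
    note fgh = this
    show "f \<oplus>\<^bsub>W\<^esub> g \<oplus>\<^bsub>W\<^esub> h = f \<oplus>\<^bsub>W\<^esub> (g \<oplus>\<^bsub>W\<^esub> h)"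
      using fgh by (intro eqI closed) (simp_all add: apply_simps)
    show "f \<oplus>\<^bsub>W\<^esub> g = g \<oplus>\<^bsub>W\<^esub> f"
      using fgh by (intro eqI closed) (simp_all add: apply_simps)
    show "\<zero>\<^bsub>W\<^esub> \<oplus>\<^bsub>W\<^esub> f = f"
      using fgh by (intro eqI closed) (simp_all add: apply_simps)
  qed (use closed in auto)
  show ?thesis
    by (rule moduleI[OF K group]; (rule eqI)?)
      (simp_all add: add_closed smult_closed, simp_all add: apply_simps module.smult_one[OF V])
qed

lemma
  shows carrier_direct_sum:
      "carrier (direct_sum I V) = {f \<in> (\<Pi>\<^sub>E i\<in>I. carrier (V i)). finite {i \<in> I. f i \<noteq> \<zero>\<^bsub>V i\<^esub>}}"
    and direct_sum_zero: "\<zero>\<^bsub>direct_sum I V\<^esub> = (\<lambda>i\<in>I. \<zero>\<^bsub>V i\<^esub>)"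
    and direct_sum_add: "f \<oplus>\<^bsub>direct_sum I V\<^esub> g = (\<lambda>i\<in>I. f i \<oplus>\<^bsub>V i\<^esub> g i)"
    and direct_sum_smult: "c \<odot>\<^bsub>direct_sum I V\<^esub> f = (\<lambda>i\<in>I. c \<odot>\<^bsub>V i\<^esub> f i)"
  by (simp_all add: direct_sum_def)

lemma carrier_direct_sum_finite:
  "finite I \<Longrightarrow> carrier (direct_sum I V) = (\<Pi>\<^sub>E i\<in>I. carrier (V i))"
  by (auto simp: carrier_direct_sum)

lemma module_direct_sum:
  assumes "cring K" "finite I" "\<And>i. i \<in> I \<Longrightarrow> module K (V i)"
  shows "module K (direct_sum I V)"
proof (rule module_pointwise[of K I V])
  note monoid = module_abelian_monoid[OF assms(3)]
  show "\<zero>\<^bsub>direct_sum I V\<^esub> \<in> carrier (direct_sum I V)"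
    by (simp add: carrier_direct_sum_finite assms(2) direct_sum_zero abelian_monoid.zero_closed
        monoid)
  show "f \<oplus>\<^bsub>direct_sum I V\<^esub> g \<in> carrier (direct_sum I V)"
    if "f \<in> carrier (direct_sum I V)" "g \<in> carrier (direct_sum I V)" for f g
    using that assms(2)
    by (auto simp: carrier_direct_sum_finite direct_sum_add
        intro!: abelian_monoid.a_closed[OF monoid])
  show "c \<odot>\<^bsub>direct_sum I V\<^esub> f \<in> carrier (direct_sum I V)"
    if "c \<in> carrier K" "f \<in> carrier (direct_sum I V)" for c f
    using that assms(2)
    by (auto simp: carrier_direct_sum_finite direct_sum_smult
        intro!: module.smult_closed[OF assms(3)])
qed (use assms in \<open>auto simp: direct_sum_def\<close>)

lemma direct_sum_proj_linear: "i \<in> I \<Longrightarrow> (\<lambda>f. f i) \<in> linear_maps K (direct_sum I V) (V i)"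
  by (rule linear_mapsI) (auto simp: carrier_direct_sum direct_sum_add direct_sum_smult)

lemma direct_sum_tuple_linear:
  assumes "finite I" "\<And>i. i \<in> I \<Longrightarrow> f i \<in> linear_maps K U (V i)"
  shows "(\<lambda>u. \<lambda>i\<in>I. f i u) \<in> linear_maps K U (direct_sum I V)"
  using assms(1)
  by (intro linear_mapsI)
    (auto simp: carrier_direct_sum_finite direct_sum_add direct_sum_smult
      linear_maps_closed[OF assms(2)] linear_maps_add[OF assms(2)] linear_maps_smult[OF assms(2)])

lemma submodule_Inter:
  assumes V: "module K V" and ne: "\<N> \<noteq> {}" and sub: "\<And>N. N \<in> \<N> \<Longrightarrow> submodule N K V"
  shows "submodule (\<Inter>\<N>) K V"
proof -
  interpret V: module K V by (rule V)
  have zero: "\<zero>\<^bsub>V\<^esub> \<in> N" if "N \<in> \<N>" for N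
    using subgroup.one_closed[OF submodule.axioms(1)[OF sub[OF that]]] by simp
  show ?thesis
  proof (rule V.submoduleI)
    show "\<Inter>\<N> \<subseteq> carrier V"
      using ne V.submoduleE(1)[OF sub] by blast
  qed (use zero V.submoduleE(3-5)[OF sub] in auto)
qed

lemma
  assumes V: "module K V" and S: "S \<subseteq> carrier V"
  shows submodule_spanned_submodule: "submodule (spanned_submodule K V S) K V"
    and spanned_submodule_superset: "S \<subseteq> spanned_submodule K V S"
  unfolding spanned_submodule_def
  using S module.carrier_is_submodule[OF V] by (intro submodule_Inter[OF V]) auto

lemma spanned_submodule_minimal:
  "\<lbrakk>submodule N K V; S \<subseteq> N\<rbrakk> \<Longrightarrow> spanned_submodule K V S \<subseteq> N"
  unfolding spanned_submodule_def by blast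

lemma submodule_abelian_subgroup:
  assumes "module K V" "submodule N K V"
  shows "abelian_subgroup N V"
  using assms module_abelian_group submodule.axioms(1)
  by (intro abelian_subgroupI3 additive_subgroup.intro)

lemma smult_coset:
  assumes V: "module K V" and N: "submodule N K V" and c: "c \<in> carrier K" and v: "v \<in> carrier V"
  shows "c \<odot>\<^bsub>quotient_module V N\<^esub> (N +>\<^bsub>V\<^esub> v) = N +>\<^bsub>V\<^esub> (c \<odot>\<^bsub>V\<^esub> v)"
proof -
  interpret V: module K V by (rule V)
  interpret N: abelian_subgroup N V by (rule submodule_abelian_subgroup[OF V N])
  have "N +>\<^bsub>V\<^esub> (c \<odot>\<^bsub>V\<^esub> a) = N +>\<^bsub>V\<^esub> (c \<odot>\<^bsub>V\<^esub> v)" if a: "a \<in> N +>\<^bsub>V\<^esub> v" for a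
  proof -
    obtain n where n: "n \<in> N" "a = n \<oplus>\<^bsub>V\<^esub> v" "n \<in> carrier V"
      using a N.a_subset by (auto simp: a_r_coset_def')
    then have "c \<odot>\<^bsub>V\<^esub> a \<in> N +>\<^bsub>V\<^esub> (c \<odot>\<^bsub>V\<^esub> v)"
      using c v V.submoduleE(4)[OF N c n(1)] N.a_subset
      by (simp add: V.smult_r_distr V.a_rcosI)
    then show ?thesis
      using N.a_repr_independence' c v by simp
  qed
  then have "(\<Union>a\<in>N +>\<^bsub>V\<^esub> v. N +>\<^bsub>V\<^esub> (c \<odot>\<^bsub>V\<^esub> a)) = N +>\<^bsub>V\<^esub> (c \<odot>\<^bsub>V\<^esub> v)"
    using N.a_rcos_self[OF v] by (intro UN_constant_eq ballI)
  then show ?thesis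
    by (simp add: quotient_module_def)
qed

lemma
  fixes V :: "('k, 'v) module"
  assumes V: "module K V" and N: "submodule N K V"
  shows carrier_quotient_module: "carrier (quotient_module V N) = (\<lambda>v. N +>\<^bsub>V\<^esub> v) ` carrier V"
    and coset_linear: "(\<lambda>v. N +>\<^bsub>V\<^esub> v) \<in> linear_maps K V (quotient_module V N)"
    and module_quotient_module: "module K (quotient_module V N)"
proof -
  interpret V: module K V by (rule V)
  interpret N: abelian_subgroup N V by (rule submodule_abelian_subgroup[OF V N])
  show image: "carrier (quotient_module V N) = (\<lambda>v. N +>\<^bsub>V\<^esub> v) ` carrier V"
    by (auto simp: quotient_module_def A_RCOSETS_def')
  show linear: "(\<lambda>v. N +>\<^bsub>V\<^esub> v) \<in> linear_maps K V (quotient_module V N)"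
  proof (rule linear_mapsI)
    show "N +>\<^bsub>V\<^esub> (u \<oplus>\<^bsub>V\<^esub> v) = (N +>\<^bsub>V\<^esub> u) \<oplus>\<^bsub>quotient_module V N\<^esub> (N +>\<^bsub>V\<^esub> v)"
      if "u \<in> carrier V" "v \<in> carrier V" for u v
      using that by (simp add: quotient_module_def N.a_rcos_sum)
  qed (simp_all add: image smult_coset[OF V N])
  show "module K (quotient_module V N)"
    using V.a_coset_join2[OF V.zero_closed N.a_subgroup N.zero_closed]
    by (intro module_surj_image[OF V image _ linear]) (simp add: quotient_module_def)
qed

section \<open>Coinvariants of finite groups\<close>

definition group_norm ::
    "('g, 'q) monoid_scheme \<Rightarrow> ('k, 'v) module \<Rightarrow> ('g \<Rightarrow> 'v \<Rightarrow> 'v) \<Rightarrow> 'v \<Rightarrow> 'v" where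
  "group_norm G V act v = (\<Oplus>\<^bsub>V\<^esub>s\<in>carrier G. act s v)"

definition invariant_vectors ::
    "('g, 'q) monoid_scheme \<Rightarrow> ('k, 'v) module \<Rightarrow> ('g \<Rightarrow> 'v \<Rightarrow> 'v) \<Rightarrow> 'v set" where
  "invariant_vectors G V act = {v \<in> carrier V. \<forall>s\<in>carrier G. act s v = v}"

definition coinvariant_norm ::
    "('g, 'q) monoid_scheme \<Rightarrow> ('k, 'v) module \<Rightarrow> ('g \<Rightarrow> 'v \<Rightarrow> 'v) \<Rightarrow> 'v set \<Rightarrow> 'v" where
  "coinvariant_norm G V act P = group_norm G V act (SOME v. v \<in> P)"

locale finite_linear_action = G: group G + V: module K V
  for K :: "('k, 'r) ring_scheme" and G :: "('g, 'q) monoid_scheme" and V :: "('k, 'v) module" +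
  fixes act :: "'g \<Rightarrow> 'v \<Rightarrow> 'v"
  assumes finite_group: "finite (carrier G)"
    and act_linear: "s \<in> carrier G \<Longrightarrow> act s \<in> linear_maps K V V"
    and act_act: "\<lbrakk>s \<in> carrier G; t \<in> carrier G; v \<in> carrier V\<rbrakk>
      \<Longrightarrow> act s (act t v) = act (s \<otimes>\<^bsub>G\<^esub> t) v"
begin

lemma act_closed: "\<lbrakk>s \<in> carrier G; v \<in> carrier V\<rbrakk> \<Longrightarrow> act s v \<in> carrier V"
  by (rule linear_maps_closed[OF act_linear])

lemma group_norm_linear: "group_norm G V act \<in> linear_maps K V V"
  unfolding group_norm_def[abs_def]
  by (intro linear_maps_pointwise_finsum V.module_axioms finite_group act_linear)

lemma group_norm_act:
  assumes "s \<in> carrier G" "v \<in> carrier V"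
  shows "group_norm G V act (act s v) = group_norm G V act v"
  using assms V.finsum_bij_betw[OF G.bij_betw_mult_right[OF assms(1)], of "\<lambda>r. act r v"]
  by (simp add: group_norm_def act_act act_closed Pi_def cong: V.finsum_cong)

lemma act_group_norm:
  assumes s: "s \<in> carrier G" and v: "v \<in> carrier V"
  shows "act s (group_norm G V act v) = group_norm G V act v"
proof -
  have "act s (group_norm G V act v) = (\<Oplus>\<^bsub>V\<^esub>r\<in>carrier G. act s (act r v))"
    unfolding group_norm_def
    by (rule linear_maps_finsum[OF act_linear[OF s] V.module_axioms V.module_axioms finite_group])
      (simp add: act_closed v)
  then show ?thesis
    using s v V.finsum_bij_betw[OF G.bij_betw_mult_left[OF s], of "\<lambda>r. act r v"]
    by (simp add: group_norm_def act_act act_closed Pi_def cong: V.finsum_cong)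
qed

lemma
  shows submodule_coinvariant_relations: "submodule (coinvariant_relations K G V act) K V"
    and act_minus_in_coinvariant_relations:
      "\<lbrakk>s \<in> carrier G; v \<in> carrier V\<rbrakk> \<Longrightarrow> act s v \<ominus>\<^bsub>V\<^esub> v \<in> coinvariant_relations K G V act"
proof -
  have "{act s v \<ominus>\<^bsub>V\<^esub> v |s v. s \<in> carrier G \<and> v \<in> carrier V} \<subseteq> carrier V"
    by (auto simp: act_closed)
  note span = submodule_spanned_submodule[OF V.module_axioms this]
    spanned_submodule_superset[OF V.module_axioms this]
  show "submodule (coinvariant_relations K G V act) K V"
    unfolding coinvariant_relations_def by (rule span(1))
  show "act s v \<ominus>\<^bsub>V\<^esub> v \<in> coinvariant_relations K G V act" if "s \<in> carrier G" "v \<in> carrier V"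
    unfolding coinvariant_relations_def using span(2) that by blast
qed

sublocale relations: abelian_subgroup "coinvariant_relations K G V act" V
  by (rule submodule_abelian_subgroup[OF V.module_axioms submodule_coinvariant_relations])

lemma coset_act:
  assumes "s \<in> carrier G" "v \<in> carrier V"
  shows "coinvariant_relations K G V act +>\<^bsub>V\<^esub> act s v = coinvariant_relations K G V act +>\<^bsub>V\<^esub> v"
  using assms relations.a_repr_independence'[of "act s v" v]
    act_minus_in_coinvariant_relations[OF assms]
  by (simp add: relations.a_rcos_module act_closed V.minus_eq)

lemmas
  module_coinvariants =
    module_quotient_module[OF V.module_axioms submodule_coinvariant_relations,
        folded coinvariants_def]
  and coinvariants_coset_linear =
    coset_linear[OF V.module_axioms submodule_coinvariant_relations, folded coinvariants_def]
  and carrier_coinvariants =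
    carrier_quotient_module[OF V.module_axioms submodule_coinvariant_relations,
        folded coinvariants_def]

lemma coinvariant_relations_subset_kernel:
  "coinvariant_relations K G V act \<subseteq> {v \<in> carrier V. group_norm G V act v = \<zero>\<^bsub>V\<^esub>}"
  unfolding coinvariant_relations_def
proof (rule spanned_submodule_minimal)
  show "submodule {v \<in> carrier V. group_norm G V act v = \<zero>\<^bsub>V\<^esub>} K V"
    by (intro submodule_equalizer[OF group_norm_linear linear_maps_const_zero] V.module_axioms)
qed (auto simp: act_closed group_norm_act V.minus_eq[of "group_norm G V act _"] V.r_neg
    linear_maps_minus[OF group_norm_linear V.module_axioms V.module_axioms]
    linear_maps_closed[OF group_norm_linear])

end

text \<open>The condition on \<open>\<pi>\<close> is Higman's criterion for relative projectivity; it makes the Tate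
  cohomology of \<open>V\<close> vanish in the two degrees where the norm occurs.\<close>

locale relatively_projective_action = finite_linear_action +
  fixes \<pi> :: "'v \<Rightarrow> 'v"
  assumes \<pi>_linear: "\<pi> \<in> linear_maps K V V"
    and trace_\<pi>: "v \<in> carrier V \<Longrightarrow> (\<Oplus>\<^bsub>V\<^esub>s\<in>carrier G. act s (\<pi> (act (inv\<^bsub>G\<^esub> s) v))) = v"
begin

lemma \<pi>_closed: "v \<in> carrier V \<Longrightarrow> \<pi> v \<in> carrier V"
  by (rule linear_maps_closed[OF \<pi>_linear])

lemma coset_group_norm:
  assumes v: "v \<in> carrier V"
  shows "coinvariant_relations K G V act +>\<^bsub>V\<^esub> v =
    coinvariant_relations K G V act +>\<^bsub>V\<^esub> \<pi> (group_norm G V act v)"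
    (is "?coset v = _")
proof -
  let ?Q = "coinvariants K G V act"
  note coset_finsum = linear_maps_finsum[OF coinvariants_coset_linear V.module_axioms
      module_coinvariants finite_group]
  have inv: "bij_betw (m_inv G) (carrier G) (carrier G)"
    by (rule bij_betwI[where g = "m_inv G"]) auto
  have "?coset v = (\<Oplus>\<^bsub>?Q\<^esub>s\<in>carrier G. ?coset (act s (\<pi> (act (inv\<^bsub>G\<^esub> s) v))))"
    using v by (subst coset_finsum[symmetric]) (simp_all add: trace_\<pi> act_closed \<pi>_closed)
  also have "\<dots> = (\<Oplus>\<^bsub>?Q\<^esub>s\<in>carrier G. ?coset (\<pi> (act (inv\<^bsub>G\<^esub> s) v)))"
    using v by (intro module_finsum_cong[OF module_coinvariants])
      (simp_all add: coset_act act_closed \<pi>_closed carrier_coinvariants)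
  also have "\<dots> = ?coset (\<Oplus>\<^bsub>V\<^esub>s\<in>carrier G. \<pi> (act (inv\<^bsub>G\<^esub> s) v))"
    using v by (intro coset_finsum[symmetric]) (simp_all add: act_closed \<pi>_closed)
  also have "(\<Oplus>\<^bsub>V\<^esub>s\<in>carrier G. \<pi> (act (inv\<^bsub>G\<^esub> s) v)) = (\<Oplus>\<^bsub>V\<^esub>s\<in>carrier G. \<pi> (act s v))"
    using v by (intro V.finsum_bij_betw[OF inv]) (simp add: act_closed \<pi>_closed)
  also have "\<dots> = \<pi> (group_norm G V act v)"
    unfolding group_norm_def using v
    by (intro linear_maps_finsum[OF \<pi>_linear, symmetric] V.module_axioms finite_group act_closed)
  finally show ?thesis .
qed

lemma coinvariant_relations_eq_kernel:
  "coinvariant_relations K G V act = {v \<in> carrier V. group_norm G V act v = \<zero>\<^bsub>V\<^esub>}"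
proof
  show "{v \<in> carrier V. group_norm G V act v = \<zero>\<^bsub>V\<^esub>} \<subseteq> coinvariant_relations K G V act"
  proof clarify
    fix v assume v: "v \<in> carrier V" and zero: "group_norm G V act v = \<zero>\<^bsub>V\<^esub>"
    have "v \<in> coinvariant_relations K G V act +>\<^bsub>V\<^esub> \<zero>\<^bsub>V\<^esub>"
      using relations.a_rcos_self[OF v] coset_group_norm[OF v] zero
        linear_maps_zero[OF \<pi>_linear V.module_axioms V.module_axioms] by simp
    then show "v \<in> coinvariant_relations K G V act"
      by (simp add: V.a_coset_join2[OF V.zero_closed relations.a_subgroup])
  qed
qed (rule coinvariant_relations_subset_kernel)

lemma coset_eq:
  assumes "v \<in> carrier V"
  shows "coinvariant_relations K G V act +>\<^bsub>V\<^esub> v =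
    {u \<in> carrier V. group_norm G V act u = group_norm G V act v}"
proof -
  have mem_iff: "u \<in> coinvariant_relations K G V act +>\<^bsub>V\<^esub> v
      \<longleftrightarrow> group_norm G V act u = group_norm G V act v"
    if u: "u \<in> carrier V" for u
  proof -
    have "u \<in> coinvariant_relations K G V act +>\<^bsub>V\<^esub> v
      \<longleftrightarrow> u \<ominus>\<^bsub>V\<^esub> v \<in> coinvariant_relations K G V act"
      unfolding V.minus_eq by (rule relations.a_rcos_module[OF assms u])
    also have "\<dots> \<longleftrightarrow> group_norm G V act u \<ominus>\<^bsub>V\<^esub> group_norm G V act v = \<zero>\<^bsub>V\<^esub>"
      unfolding coinvariant_relations_eq_kernel
        linear_maps_minus[OF group_norm_linear V.module_axioms V.module_axioms u assms, symmetric]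
      using u assms by simp
    also have "\<dots> \<longleftrightarrow> group_norm G V act u = group_norm G V act v"
      using u assms
      by (simp add: V.minus_eq V.add.inv_solve_right' linear_maps_closed[OF group_norm_linear])
    finally show ?thesis .
  qed
  show ?thesis
    by (intro equalityI subsetI) (use V.a_r_coset_subset_G[OF relations.a_subset assms] mem_iff in
        auto)
qed

lemma group_norm_image: "group_norm G V act ` carrier V = invariant_vectors G V act"
proof
  show "invariant_vectors G V act \<subseteq> group_norm G V act ` carrier V"
  proof
    fix v assume "v \<in> invariant_vectors G V act"
    then have v: "v \<in> carrier V" "\<And>s. s \<in> carrier G \<Longrightarrow> act s v = v"
      by (simp_all add: invariant_vectors_def)
    then have "group_norm G V act (\<pi> v) = v"
      using trace_\<pi>[OF v(1)]
      by (simp add: group_norm_def act_closed \<pi>_closed Pi_def cong: V.finsum_cong)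
    then show "v \<in> group_norm G V act ` carrier V"
      using \<pi>_closed[OF v(1)] by (intro image_eqI[where x = "\<pi> v"]) simp_all
  qed
qed (auto simp: invariant_vectors_def act_group_norm linear_maps_closed[OF group_norm_linear])

lemma coinvariant_norm_coset:
  assumes "v \<in> carrier V"
  shows "coinvariant_norm G V act (coinvariant_relations K G V act +>\<^bsub>V\<^esub> v) = group_norm G V act v"
proof -
  have "(SOME u. u \<in> coinvariant_relations K G V act +>\<^bsub>V\<^esub> v)
      \<in> coinvariant_relations K G V act +>\<^bsub>V\<^esub> v"
    using relations.a_rcos_self[OF assms] by (rule someI)
  then show ?thesis
    using assms by (simp add: coset_eq coinvariant_norm_def)
qed

lemma coinvariant_norm_linear: "coinvariant_norm G V act \<in> linear_maps K (coinvariants K G V act) V"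
  by (rule linear_maps_descend[OF V.module_axioms coinvariants_coset_linear carrier_coinvariants
        group_norm_linear coinvariant_norm_coset])

lemma bij_betw_coinvariant_norm:
  "bij_betw (coinvariant_norm G V act) (carrier (coinvariants K G V act))
      (invariant_vectors G V act)"
proof -
  have "inj_on (coinvariant_norm G V act) (carrier (coinvariants K G V act))"
    unfolding carrier_coinvariants
    by (rule inj_onI) (clarsimp simp: coinvariant_norm_coset, simp add: coset_eq)
  then show ?thesis
    by (simp add: bij_betw_def carrier_coinvariants image_image coinvariant_norm_coset
        group_norm_image[symmetric])
qed

end

lemma homogeneous_part_eqI:
  assumes V: "module K V" and fin: "finite (carrier G)"
    and sub: "\<And>t. t \<in> carrier G \<Longrightarrow> V' t \<subseteq> carrier V"
    and p_linear: "\<And>t. t \<in> carrier G \<Longrightarrow> p t \<in> linear_maps K V V"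
    and p_mem: "\<And>t v. \<lbrakk>t \<in> carrier G; v \<in> carrier V\<rbrakk> \<Longrightarrow> p t v \<in> V' t"
    and p_component: "\<And>s t v. \<lbrakk>s \<in> carrier G; t \<in> carrier G; v \<in> V' t\<rbrakk>
      \<Longrightarrow> p s v = (if s = t then v else \<zero>\<^bsub>V\<^esub>)"
    and p_sum: "\<And>v. v \<in> carrier V \<Longrightarrow> (\<Oplus>\<^bsub>V\<^esub>t\<in>carrier G. p t v) = v"
    and s: "s \<in> carrier G" and v: "v \<in> carrier V"
  shows "homogeneous_part G V V' s v = p s v"
proof -
  interpret V: module K V by (rule V)
  let ?decomposition = "\<lambda>u. u \<in> (\<Pi>\<^sub>E t\<in>carrier G. V' t) \<and> v = (\<Oplus>\<^bsub>V\<^esub>t\<in>carrier G. u t)"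
  have "p t v \<in> carrier V" if "t \<in> carrier G" for t
    by (rule linear_maps_closed[OF p_linear[OF that] v])
  then have "?decomposition (\<lambda>t\<in>carrier G. p t v)"
    by (simp add: p_mem p_sum v Pi_def cong: V.finsum_cong)
  moreover have "u = (\<lambda>t\<in>carrier G. p t v)" if u: "?decomposition u" for u
  proof (rule extensionalityI[of _ "carrier G"])
    fix s assume s: "s \<in> carrier G"
    have mem: "u t \<in> V' t" "u t \<in> carrier V" if "t \<in> carrier G" for t
      using u that sub by auto
    have "p s v = (\<Oplus>\<^bsub>V\<^esub>t\<in>carrier G. p s (u t))"
      using u linear_maps_finsum[OF p_linear[OF s] V V fin, of u] mem by simp
    also have "\<dots> = u s"
      using V.finsum_eq_single[OF fin s, of "\<lambda>t. p s (u t)"] s mem p_component by simp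
    finally show "u s = (\<lambda>t\<in>carrier G. p t v) s"
      using s by simp
  qed (use u in \<open>auto simp: PiE_iff\<close>)
  ultimately have "(THE u. ?decomposition u) = (\<lambda>t\<in>carrier G. p t v)"
    by (rule the_equality)
  then show ?thesis
    using s by (simp add: homogeneous_part_def)
qed

section \<open>Linear categories and functor categories\<close>

context k_category
begin

lemma
  assumes "x \<in> Obj C" "y \<in> Obj C"
  shows Mor_zero_closed: "\<zero>\<^bsub>Mor C y x\<^esub> \<in> carrier (Mor C y x)"
    and Mor_add_closed: "\<lbrakk>f \<in> carrier (Mor C y x); g \<in> carrier (Mor C y x)\<rbrakk>
      \<Longrightarrow> f \<oplus>\<^bsub>Mor C y x\<^esub> g \<in> carrier (Mor C y x)"
    and Mor_smult_closed: "\<lbrakk>c \<in> carrier K; f \<in> carrier (Mor C y x)\<rbrakk>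
      \<Longrightarrow> c \<odot>\<^bsub>Mor C y x\<^esub> f \<in> carrier (Mor C y x)"
    and Mor_abelian_monoid: "abelian_monoid (Mor C y x)"
proof -
  interpret module K "Mor C y x" using assms by (rule Mor_module)
  show "abelian_monoid (Mor C y x)"
    by (rule abelian_monoid_axioms)
  show "\<zero>\<^bsub>Mor C y x\<^esub> \<in> carrier (Mor C y x)"
    by simp
  show "\<lbrakk>f \<in> carrier (Mor C y x); g \<in> carrier (Mor C y x)\<rbrakk>
      \<Longrightarrow> f \<oplus>\<^bsub>Mor C y x\<^esub> g \<in> carrier (Mor C y x)"
    and "\<lbrakk>c \<in> carrier K; f \<in> carrier (Mor C y x)\<rbrakk> \<Longrightarrow> c \<odot>\<^bsub>Mor C y x\<^esub> f \<in> carrier (Mor C y x)"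
    by simp_all
qed

lemma Mor_finsum_closed:
  "\<lbrakk>x \<in> Obj C; y \<in> Obj C; \<And>i. i \<in> A \<Longrightarrow> f i \<in> carrier (Mor C y x)\<rbrakk>
    \<Longrightarrow> (\<Oplus>\<^bsub>Mor C y x\<^esub>i\<in>A. f i) \<in> carrier (Mor C y x)"
  by (rule module_finsum_closed[OF Mor_module])

lemma Mor_finsum_cong:
  "\<lbrakk>x \<in> Obj C; y \<in> Obj C; \<And>i. i \<in> A \<Longrightarrow> f i = g i; \<And>i. i \<in> A \<Longrightarrow> g i \<in> carrier (Mor C y x)\<rbrakk>
    \<Longrightarrow> (\<Oplus>\<^bsub>Mor C y x\<^esub>i\<in>A. f i) = (\<Oplus>\<^bsub>Mor C y x\<^esub>i\<in>A. g i)"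
  by (rule module_finsum_cong[OF Mor_module])

context
  fixes x y z
  assumes xyz: "x \<in> Obj C" "y \<in> Obj C" "z \<in> Obj C"
begin

lemma Cmp_closed:
  "\<lbrakk>g \<in> carrier (Mor C z y); f \<in> carrier (Mor C y x)\<rbrakk> \<Longrightarrow> Cmp C z y x g f \<in> carrier (Mor C z x)"
  by (rule linear_maps_closed[OF Cmp_linear_left[OF xyz]])

lemma
  assumes f: "f \<in> carrier (Mor C y x)"
  shows Cmp_add_left: "\<lbrakk>g \<in> carrier (Mor C z y); g' \<in> carrier (Mor C z y)\<rbrakk>
      \<Longrightarrow> Cmp C z y x (g \<oplus>\<^bsub>Mor C z y\<^esub> g') f = Cmp C z y x g f \<oplus>\<^bsub>Mor C z x\<^esub> Cmp C z y x g' f"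
    and Cmp_smult_left: "\<lbrakk>c \<in> carrier K; g \<in> carrier (Mor C z y)\<rbrakk>
      \<Longrightarrow> Cmp C z y x (c \<odot>\<^bsub>Mor C z y\<^esub> g) f = c \<odot>\<^bsub>Mor C z x\<^esub> Cmp C z y x g f"
    and Cmp_zero_left: "Cmp C z y x \<zero>\<^bsub>Mor C z y\<^esub> f = \<zero>\<^bsub>Mor C z x\<^esub>"
    and Cmp_finsum_left: "\<lbrakk>finite A; \<And>i. i \<in> A \<Longrightarrow> h i \<in> carrier (Mor C z y)\<rbrakk>
      \<Longrightarrow> Cmp C z y x (\<Oplus>\<^bsub>Mor C z y\<^esub>i\<in>A. h i) f = (\<Oplus>\<^bsub>Mor C z x\<^esub>i\<in>A. Cmp C z y x (h i) f)"
proof -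
  note linear = Cmp_linear_left[OF xyz f]
  note modules = Mor_module[OF xyz(2,3)] Mor_module[OF xyz(1,3)]
  show "\<lbrakk>g \<in> carrier (Mor C z y); g' \<in> carrier (Mor C z y)\<rbrakk>
      \<Longrightarrow> Cmp C z y x (g \<oplus>\<^bsub>Mor C z y\<^esub> g') f = Cmp C z y x g f \<oplus>\<^bsub>Mor C z x\<^esub> Cmp C z y x g' f"
    by (rule linear_maps_add[OF linear])
  show "\<lbrakk>c \<in> carrier K; g \<in> carrier (Mor C z y)\<rbrakk>
      \<Longrightarrow> Cmp C z y x (c \<odot>\<^bsub>Mor C z y\<^esub> g) f = c \<odot>\<^bsub>Mor C z x\<^esub> Cmp C z y x g f"
    by (rule linear_maps_smult[OF linear])
  show "Cmp C z y x \<zero>\<^bsub>Mor C z y\<^esub> f = \<zero>\<^bsub>Mor C z x\<^esub>"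
    by (rule linear_maps_zero[OF linear modules])
  show "\<lbrakk>finite A; \<And>i. i \<in> A \<Longrightarrow> h i \<in> carrier (Mor C z y)\<rbrakk>
      \<Longrightarrow> Cmp C z y x (\<Oplus>\<^bsub>Mor C z y\<^esub>i\<in>A. h i) f = (\<Oplus>\<^bsub>Mor C z x\<^esub>i\<in>A. Cmp C z y x (h i) f)"
    by (rule linear_maps_finsum[OF linear modules])
qed

lemma
  assumes g: "g \<in> carrier (Mor C z y)"
  shows Cmp_add_right: "\<lbrakk>f \<in> carrier (Mor C y x); f' \<in> carrier (Mor C y x)\<rbrakk>
      \<Longrightarrow> Cmp C z y x g (f \<oplus>\<^bsub>Mor C y x\<^esub> f') = Cmp C z y x g f \<oplus>\<^bsub>Mor C z x\<^esub> Cmp C z y x g f'"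
    and Cmp_smult_right: "\<lbrakk>c \<in> carrier K; f \<in> carrier (Mor C y x)\<rbrakk>
      \<Longrightarrow> Cmp C z y x g (c \<odot>\<^bsub>Mor C y x\<^esub> f) = c \<odot>\<^bsub>Mor C z x\<^esub> Cmp C z y x g f"
    and Cmp_zero_right: "Cmp C z y x g \<zero>\<^bsub>Mor C y x\<^esub> = \<zero>\<^bsub>Mor C z x\<^esub>"
    and Cmp_finsum_right: "\<lbrakk>finite A; \<And>i. i \<in> A \<Longrightarrow> h i \<in> carrier (Mor C y x)\<rbrakk>
      \<Longrightarrow> Cmp C z y x g (\<Oplus>\<^bsub>Mor C y x\<^esub>i\<in>A. h i) = (\<Oplus>\<^bsub>Mor C z x\<^esub>i\<in>A. Cmp C z y x g (h i))"
proof -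
  note linear = Cmp_linear_right[OF xyz g]
  note modules = Mor_module[OF xyz(1,2)] Mor_module[OF xyz(1,3)]
  show "\<lbrakk>f \<in> carrier (Mor C y x); f' \<in> carrier (Mor C y x)\<rbrakk>
      \<Longrightarrow> Cmp C z y x g (f \<oplus>\<^bsub>Mor C y x\<^esub> f') = Cmp C z y x g f \<oplus>\<^bsub>Mor C z x\<^esub> Cmp C z y x g f'"
    by (rule linear_maps_add[OF linear])
  show "\<lbrakk>c \<in> carrier K; f \<in> carrier (Mor C y x)\<rbrakk>
      \<Longrightarrow> Cmp C z y x g (c \<odot>\<^bsub>Mor C y x\<^esub> f) = c \<odot>\<^bsub>Mor C z x\<^esub> Cmp C z y x g f"
    by (rule linear_maps_smult[OF linear])
  show "Cmp C z y x g \<zero>\<^bsub>Mor C y x\<^esub> = \<zero>\<^bsub>Mor C z x\<^esub>"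
    by (rule linear_maps_zero[OF linear modules])
  show "\<lbrakk>finite A; \<And>i. i \<in> A \<Longrightarrow> h i \<in> carrier (Mor C y x)\<rbrakk>
      \<Longrightarrow> Cmp C z y x g (\<Oplus>\<^bsub>Mor C y x\<^esub>i\<in>A. h i) = (\<Oplus>\<^bsub>Mor C z x\<^esub>i\<in>A. Cmp C z y x g (h i))"
    by (rule linear_maps_finsum[OF linear modules])
qed

end

end

lemma k_functorI:
  assumes "\<And>x. x \<in> Obj C \<Longrightarrow> FObj F x \<in> Obj D"
    and "\<And>x y. \<lbrakk>x \<in> Obj C; y \<in> Obj C\<rbrakk>
      \<Longrightarrow> FMor F y x \<in> linear_maps K (Mor C y x) (Mor D (FObj F y) (FObj F x))"
    and "\<And>x. x \<in> Obj C \<Longrightarrow> FMor F x x (Idt C x) = Idt D (FObj F x)"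
    and "\<And>x y z g f. \<lbrakk>x \<in> Obj C; y \<in> Obj C; z \<in> Obj C; g \<in> carrier (Mor C z y);
        f \<in> carrier (Mor C y x)\<rbrakk>
      \<Longrightarrow> FMor F z x (Cmp C z y x g f) =
          Cmp D (FObj F z) (FObj F y) (FObj F x) (FMor F z y g) (FMor F y x f)"
  shows "k_functor K C D F"
  using assms unfolding k_functor_def by blast

lemma
  assumes "k_functor K C D F"
  shows k_functor_FObj: "x \<in> Obj C \<Longrightarrow> FObj F x \<in> Obj D"
    and k_functor_linear: "\<lbrakk>x \<in> Obj C; y \<in> Obj C\<rbrakk>
      \<Longrightarrow> FMor F y x \<in> linear_maps K (Mor C y x) (Mor D (FObj F y) (FObj F x))"
    and k_functor_Idt: "x \<in> Obj C \<Longrightarrow> FMor F x x (Idt C x) = Idt D (FObj F x)"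
    and k_functor_Cmp: "\<lbrakk>x \<in> Obj C; y \<in> Obj C; z \<in> Obj C; g \<in> carrier (Mor C z y);
        f \<in> carrier (Mor C y x)\<rbrakk>
      \<Longrightarrow> FMor F z x (Cmp C z y x g f) =
          Cmp D (FObj F z) (FObj F y) (FObj F x) (FMor F z y g) (FMor F y x f)"
    and k_functor_closed: "\<lbrakk>x \<in> Obj C; y \<in> Obj C; f \<in> carrier (Mor C y x)\<rbrakk>
      \<Longrightarrow> FMor F y x f \<in> carrier (Mor D (FObj F y) (FObj F x))"
  using assms unfolding k_functor_def by (auto intro: linear_maps_closed)

lemma k_functor_id_functor: "k_functor K C C id_functor"
  by (rule k_functorI) (auto simp: id_functor_def linear_maps_def)

lemma k_functor_comp_functor:
  assumes F: "k_functor K C D F" and E: "k_functor K D H E"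
  shows "k_functor K C H (comp_functor E F)"
proof (rule k_functorI)
  fix x y assume "x \<in> Obj C" "y \<in> Obj C"
  then show "FMor (comp_functor E F) y x
    \<in> linear_maps K (Mor C y x) (Mor H (FObj (comp_functor E F) y) (FObj (comp_functor E F) x))"
    using linear_maps_comp[OF k_functor_linear[OF F] k_functor_linear[OF E], of x y]
    by (simp add: comp_functor_def k_functor_FObj[OF F])
qed (simp_all add: comp_functor_def k_functor_FObj[OF F] k_functor_FObj[OF E] k_functor_Idt[OF F]
    k_functor_Idt[OF E] k_functor_closed[OF F] k_functor_Cmp[OF F] k_functor_Cmp[OF E])

lemma
  shows Obj_functor_category: "Obj (functor_category K C D) = {F. k_functor K C D F}"
    and carrier_Mor_functor_category:
      "carrier (Mor (functor_category K C D) E F) = natural_transformations C D F E"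
    and zero_functor_category:
      "\<zero>\<^bsub>Mor (functor_category K C D) E F\<^esub> = (\<lambda>x\<in>Obj C. \<zero>\<^bsub>Mor D (FObj E x) (FObj F x)\<^esub>)"
    and add_functor_category: "\<sigma> \<oplus>\<^bsub>Mor (functor_category K C D) E F\<^esub> \<tau> =
      (\<lambda>x\<in>Obj C. \<sigma> x \<oplus>\<^bsub>Mor D (FObj E x) (FObj F x)\<^esub> \<tau> x)"
    and smult_functor_category: "c \<odot>\<^bsub>Mor (functor_category K C D) E F\<^esub> \<tau> =
      (\<lambda>x\<in>Obj C. c \<odot>\<^bsub>Mor D (FObj E x) (FObj F x)\<^esub> \<tau> x)"
    and Cmp_functor_category: "Cmp (functor_category K C D) H E F \<sigma> \<tau> =
      (\<lambda>x\<in>Obj C. Cmp D (FObj H x) (FObj E x) (FObj F x) (\<sigma> x) (\<tau> x))"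
    and Idt_functor_category: "Idt (functor_category K C D) F = (\<lambda>x\<in>Obj C. Idt D (FObj F x))"
  by (simp_all add: functor_category_def)

lemmas functor_category_simps = Obj_functor_category carrier_Mor_functor_category
  zero_functor_category add_functor_category smult_functor_category Cmp_functor_category
  Idt_functor_category

lemma natural_transformationsI:
  assumes "\<tau> \<in> extensional (Obj C)"
    and "\<And>x. x \<in> Obj C \<Longrightarrow> \<tau> x \<in> carrier (Mor D (FObj E x) (FObj F x))"
    and "\<And>x y f. \<lbrakk>x \<in> Obj C; y \<in> Obj C; f \<in> carrier (Mor C y x)\<rbrakk>
      \<Longrightarrow> Cmp D (FObj E y) (FObj F y) (FObj F x) (\<tau> y) (FMor F y x f) =
          Cmp D (FObj E y) (FObj E x) (FObj F x) (FMor E y x f) (\<tau> x)"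
  shows "\<tau> \<in> natural_transformations C D F E"
  using assms unfolding natural_transformations_def by (auto simp: PiE_def)

lemma
  assumes "\<tau> \<in> natural_transformations C D F E"
  shows natural_transformations_closed:
      "x \<in> Obj C \<Longrightarrow> \<tau> x \<in> carrier (Mor D (FObj E x) (FObj F x))"
    and natural_transformations_natural: "\<lbrakk>x \<in> Obj C; y \<in> Obj C; f \<in> carrier (Mor C y x)\<rbrakk>
      \<Longrightarrow> Cmp D (FObj E y) (FObj F y) (FObj F x) (\<tau> y) (FMor F y x f) =
          Cmp D (FObj E y) (FObj E x) (FObj F x) (FMor E y x f) (\<tau> x)"
    and natural_transformations_extensional: "\<tau> \<in> extensional (Obj C)"
  using assms unfolding natural_transformations_def by (auto simp: PiE_iff)

lemma natural_transformations_eqI: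
  assumes "\<sigma> \<in> natural_transformations C D F E" "\<tau> \<in> natural_transformations C D F E"
    and "\<And>x. x \<in> Obj C \<Longrightarrow> \<sigma> x = \<tau> x"
  shows "\<sigma> = \<tau>"
  using assms by (blast intro: extensionalityI natural_transformations_extensional)

definition inverse_morphisms :: "('k, 'o, 'm) kcat \<Rightarrow> 'o \<Rightarrow> 'o \<Rightarrow> 'm \<Rightarrow> 'm \<Rightarrow> bool" where
  "inverse_morphisms C x y f g \<longleftrightarrow> f \<in> carrier (Mor C y x) \<and> g \<in> carrier (Mor C x y) \<and>
     Cmp C x y x g f = Idt C x \<and> Cmp C y x y f g = Idt C y"

lemma isomorphic_in_iff:
  "isomorphic_in C x y \<longleftrightarrow> x \<in> Obj C \<and> y \<in> Obj C \<and> (\<exists>f g. inverse_morphisms C x y f g)"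
  unfolding isomorphic_in_def inverse_morphisms_def by blast

context
  fixes K :: "('k, 'r) ring_scheme" and D :: "('k, 'p, 'n) kcat"
  assumes D: "k_category K D"
begin

interpretation D: k_category K D
  by (rule D)

context
  fixes C :: "('k, 'o, 'm) kcat" and E F :: "('o, 'm, 'p, 'n) kfun"
  assumes E: "k_functor K C D E" and F: "k_functor K C D F"
begin

lemmas functor_closed = k_functor_FObj[OF E] k_functor_FObj[OF F] k_functor_closed[OF E]
  k_functor_closed[OF F]

lemma natural_transformations_Cmp:
  fixes H :: "('o, 'm, 'p, 'n) kfun"
  assumes H: "k_functor K C D H" and \<sigma>: "\<sigma> \<in> natural_transformations C D E H"
    and \<tau>: "\<tau> \<in> natural_transformations C D F E"
  shows "(\<lambda>x\<in>Obj C. Cmp D (FObj H x) (FObj E x) (FObj F x) (\<sigma> x) (\<tau> x))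
    \<in> natural_transformations C D F H" (is "restrict ?\<rho> _ \<in> _")
proof (rule natural_transformationsI)
  note [simp] = functor_closed k_functor_FObj[OF H] k_functor_closed[OF H]
    natural_transformations_closed[OF \<sigma>] natural_transformations_closed[OF \<tau>]
  show "restrict ?\<rho> (Obj C) x \<in> carrier (Mor D (FObj H x) (FObj F x))" if "x \<in> Obj C" for x
    using that by (simp add: D.Cmp_closed)
  fix x y f assume [simp]: "x \<in> Obj C" "y \<in> Obj C" "f \<in> carrier (Mor C y x)"
  have "Cmp D (FObj H y) (FObj F y) (FObj F x) (?\<rho> y) (FMor F y x f)
    = Cmp D (FObj H y) (FObj E y) (FObj F x) (\<sigma> y)
        (Cmp D (FObj E y) (FObj F y) (FObj F x) (\<tau> y) (FMor F y x f))"
    by (simp add: D.Cmp_assoc)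
  also have "\<dots> = Cmp D (FObj H y) (FObj E x) (FObj F x)
      (Cmp D (FObj H y) (FObj E y) (FObj E x) (\<sigma> y) (FMor E y x f)) (\<tau> x)"
    by (simp add: natural_transformations_natural[OF \<tau>] D.Cmp_assoc)
  also have "\<dots> = Cmp D (FObj H y) (FObj H x) (FObj F x) (FMor H y x f) (?\<rho> x)"
    by (simp add: natural_transformations_natural[OF \<sigma>] D.Cmp_assoc)
  finally show "Cmp D (FObj H y) (FObj F y) (FObj F x) (restrict ?\<rho> (Obj C) y) (FMor F y x f)
    = Cmp D (FObj H y) (FObj H x) (FObj F x) (FMor H y x f) (restrict ?\<rho> (Obj C) x)"
    by simp
qed simp

lemma natural_transformations_add:
  assumes \<sigma>: "\<sigma> \<in> natural_transformations C D F E" and \<tau>: "\<tau> \<in> natural_transformations C D F E"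
  shows "(\<lambda>x\<in>Obj C. \<sigma> x \<oplus>\<^bsub>Mor D (FObj E x) (FObj F x)\<^esub> \<tau> x) \<in> natural_transformations C D F E"
  by (rule natural_transformationsI)
    (simp_all add: functor_closed D.Mor_add_closed D.Cmp_add_left D.Cmp_add_right
      natural_transformations_closed[OF \<sigma>] natural_transformations_closed[OF \<tau>]
      natural_transformations_natural[OF \<sigma>] natural_transformations_natural[OF \<tau>])

lemma natural_transformations_smult:
  assumes c: "c \<in> carrier K" and \<tau>: "\<tau> \<in> natural_transformations C D F E"
  shows "(\<lambda>x\<in>Obj C. c \<odot>\<^bsub>Mor D (FObj E x) (FObj F x)\<^esub> \<tau> x) \<in> natural_transformations C D F E"
  by (rule natural_transformationsI)
    (simp_all add: c functor_closed D.Mor_smult_closed D.Cmp_smult_left D.Cmp_smult_right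
      natural_transformations_closed[OF \<tau>] natural_transformations_natural[OF \<tau>])

lemma natural_transformations_zero:
  "(\<lambda>x\<in>Obj C. \<zero>\<^bsub>Mor D (FObj E x) (FObj F x)\<^esub>) \<in> natural_transformations C D F E"
  by (rule natural_transformationsI)
    (simp_all add: functor_closed D.Mor_zero_closed D.Cmp_zero_left D.Cmp_zero_right)

lemma natural_transformations_Idt: "(\<lambda>x\<in>Obj C. Idt D (FObj F x)) \<in> natural_transformations C D F F"
  by (rule natural_transformationsI)
    (simp_all add: functor_closed D.Idt_closed D.Idt_left D.Idt_right)

lemma module_natural_transformations: "module K (Mor (functor_category K C D) E F)"
proof (rule module_pointwise[of K "Obj C" "\<lambda>x. Mor D (FObj E x) (FObj F x)"])
  show "carrier (Mor (functor_category K C D) E F)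
    \<subseteq> (\<Pi>\<^sub>E x\<in>Obj C. carrier (Mor D (FObj E x) (FObj F x)))"
    by (auto simp: carrier_Mor_functor_category natural_transformations_def)
qed (simp_all add: D.is_cring D.Mor_module functor_closed functor_category_simps
    natural_transformations_zero natural_transformations_add natural_transformations_smult)

lemma natural_transformations_inverse:
  assumes \<tau>: "\<tau> \<in> natural_transformations C D F E"
    and inv: "\<And>x. x \<in> Obj C \<Longrightarrow> inverse_morphisms D (FObj F x) (FObj E x) (\<tau> x) (\<sigma> x)"
  shows "restrict \<sigma> (Obj C) \<in> natural_transformations C D E F"
proof (rule natural_transformationsI)
  have \<sigma>: "\<sigma> x \<in> carrier (Mor D (FObj F x) (FObj E x))"
    and \<sigma>\<tau>: "Cmp D (FObj F x) (FObj E x) (FObj F x) (\<sigma> x) (\<tau> x) = Idt D (FObj F x)"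
    and \<tau>\<sigma>: "Cmp D (FObj E x) (FObj F x) (FObj E x) (\<tau> x) (\<sigma> x) = Idt D (FObj E x)"
    if "x \<in> Obj C" for x
    using inv[OF that] by (simp_all add: inverse_morphisms_def)
  note [simp] = functor_closed natural_transformations_closed[OF \<tau>] \<sigma> D.Cmp_closed
  show "restrict \<sigma> (Obj C) x \<in> carrier (Mor D (FObj F x) (FObj E x))" if "x \<in> Obj C" for x
    using that by simp
  fix x y f assume [simp]: "x \<in> Obj C" "y \<in> Obj C" "f \<in> carrier (Mor C y x)"
  let ?\<sigma>f = "Cmp D (FObj F y) (FObj E y) (FObj E x) (\<sigma> y) (FMor E y x f)"
  have "?\<sigma>f = Cmp D (FObj F y) (FObj E x) (FObj E x) ?\<sigma>f
      (Cmp D (FObj E x) (FObj F x) (FObj E x) (\<tau> x) (\<sigma> x))"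
    by (simp add: \<tau>\<sigma> D.Idt_right)
  also have "\<dots> = Cmp D (FObj F y) (FObj E y) (FObj E x) (\<sigma> y)
      (Cmp D (FObj E y) (FObj F x) (FObj E x)
      (Cmp D (FObj E y) (FObj E x) (FObj F x) (FMor E y x f) (\<tau> x)) (\<sigma> x))"
    by (simp add: D.Cmp_assoc)
  also have "\<dots> = Cmp D (FObj F y) (FObj F y) (FObj E x)
      (Cmp D (FObj F y) (FObj E y) (FObj F y) (\<sigma> y) (\<tau> y))
      (Cmp D (FObj F y) (FObj F x) (FObj E x) (FMor F y x f) (\<sigma> x))"
    by (simp add: D.Cmp_assoc natural_transformations_natural[OF \<tau>, symmetric])
  also have "\<dots> = Cmp D (FObj F y) (FObj F x) (FObj E x) (FMor F y x f) (\<sigma> x)"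
    by (simp add: \<sigma>\<tau> D.Idt_left)
  finally show "Cmp D (FObj F y) (FObj E y) (FObj E x) (restrict \<sigma> (Obj C) y) (FMor E y x f) =
      Cmp D (FObj F y) (FObj F x) (FObj E x) (FMor F y x f) (restrict \<sigma> (Obj C) x)"
    by simp
qed simp

lemma isomorphic_in_functor_categoryI:
  assumes \<tau>: "\<tau> \<in> natural_transformations C D F E"
    and inv: "\<And>x. x \<in> Obj C \<Longrightarrow> inverse_morphisms D (FObj F x) (FObj E x) (\<tau> x) (\<sigma> x)"
  shows "isomorphic_in (functor_category K C D) F E"
proof -
  have "inverse_morphisms (functor_category K C D) F E \<tau> (restrict \<sigma> (Obj C))"
    using inv natural_transformations_inverse[OF \<tau> inv] \<tau>
    by (auto simp: inverse_morphisms_def functor_category_simps intro!: restrict_ext)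
  then show ?thesis
    using E F by (auto simp: isomorphic_in_iff Obj_functor_category)
qed

end

theorem k_category_functor_category:
  fixes C :: "('k, 'o, 'm) kcat"
  shows "k_category K (functor_category K C D)"
proof (rule k_category.intro[OF D.field_axioms k_category_axioms.intro],
    unfold Obj_functor_category mem_Collect_eq)
  let ?FC = "functor_category K C D"
  note [simp] = functor_category_simps
  fix E F G H :: "('o, 'm, 'p, 'n) kfun"
  assume functors: "k_functor K C D E" "k_functor K C D F" "k_functor K C D G" "k_functor K C D H"
  note FObj = k_functor_FObj[OF functors(1)] k_functor_FObj[OF functors(2)]
    k_functor_FObj[OF functors(3)] k_functor_FObj[OF functors(4)]
  note closed = natural_transformations_closed
  show "module K (Mor ?FC F E)"
    using functors by (simp add: module_natural_transformations)
  show "Idt ?FC E \<in> carrier (Mor ?FC E E)"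
    using functors natural_transformations_Idt by simp
  show "Cmp ?FC F F E (Idt ?FC F) \<tau> = \<tau>" and "Cmp ?FC F E E \<tau> (Idt ?FC E) = \<tau>"
    if "\<tau> \<in> carrier (Mor ?FC F E)" for \<tau>
  proof -
    have \<tau>: "\<tau> \<in> natural_transformations C D E F"
      using that by simp
    note restrict = extensional_restrict[OF natural_transformations_extensional[OF \<tau>]]
    show "Cmp ?FC F F E (Idt ?FC F) \<tau> = \<tau>" and "Cmp ?FC F E E \<tau> (Idt ?FC E) = \<tau>"
      using \<tau> FObj restrict by (simp_all add: closed D.Idt_left D.Idt_right cong: restrict_cong)
  qed
  show "(\<lambda>\<sigma>. Cmp ?FC G F E \<sigma> \<tau>) \<in> linear_maps K (Mor ?FC G F) (Mor ?FC G E)"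
    if "\<tau> \<in> carrier (Mor ?FC F E)" for \<tau>
    using that FObj functors by (intro linear_mapsI)
      (auto simp: natural_transformations_Cmp closed D.Cmp_add_left D.Cmp_smult_left
          intro!: restrict_ext)
  show "(\<lambda>\<tau>. Cmp ?FC G F E \<sigma> \<tau>) \<in> linear_maps K (Mor ?FC F E) (Mor ?FC G E)"
    if "\<sigma> \<in> carrier (Mor ?FC G F)" for \<sigma>
    using that FObj functors by (intro linear_mapsI)
      (auto simp: natural_transformations_Cmp closed D.Cmp_add_right D.Cmp_smult_right
        intro!: restrict_ext)
  show "Cmp ?FC H F E (Cmp ?FC H G F \<rho> \<sigma>) \<tau> = Cmp ?FC H G E \<rho> (Cmp ?FC G F E \<sigma> \<tau>)"
    if "\<rho> \<in> carrier (Mor ?FC H G)" "\<sigma> \<in> carrier (Mor ?FC G F)" "\<tau> \<in> carrier (Mor ?FC F E)" for \<rho> \<sigma> \<tau>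
    using that FObj by (auto simp: closed D.Cmp_assoc intro!: restrict_ext)
qed

end

section \<open>Equivalences of linear categories\<close>

locale weak_equivalence = C: k_category K C + D: k_category K D
  for K :: "('k, 'r) ring_scheme" and C :: "('k, 'o, 'm) kcat" and D :: "('k, 'p, 'n) kcat" +
  fixes F :: "('o, 'm, 'p, 'n) kfun"
  assumes F_functor: "k_functor K C D F"
    and fully_faithful: "\<lbrakk>x \<in> Obj C; y \<in> Obj C\<rbrakk>
      \<Longrightarrow> bij_betw (FMor F y x) (carrier (Mor C y x)) (carrier (Mor D (FObj F y) (FObj F x)))"
    and essentially_surjective: "q \<in> Obj D \<Longrightarrow> \<exists>p\<in>Obj C. isomorphic_in D (FObj F p) q"
begin

lemmas F_closed = k_functor_FObj[OF F_functor] k_functor_closed[OF F_functor]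

definition preimage :: "'o \<Rightarrow> 'o \<Rightarrow> 'n \<Rightarrow> 'm" where
  "preimage y x g = inv_into (carrier (Mor C y x)) (FMor F y x) g"

lemma
  assumes "x \<in> Obj C" "y \<in> Obj C" "g \<in> carrier (Mor D (FObj F y) (FObj F x))"
  shows preimage_closed: "preimage y x g \<in> carrier (Mor C y x)"
    and F_preimage: "FMor F y x (preimage y x g) = g"
  using assms fully_faithful[OF assms(1,2)] unfolding preimage_def bij_betw_def
  by (auto intro: inv_into_into f_inv_into_f)

lemma faithfulD:
  "\<lbrakk>FMor F y x f = FMor F y x g; x \<in> Obj C; y \<in> Obj C; f \<in> carrier (Mor C y x);
    g \<in> carrier (Mor C y x)\<rbrakk> \<Longrightarrow> f = g"
  using fully_faithful unfolding bij_betw_def by (meson inj_onD)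

definition source :: "'p \<Rightarrow> 'o" where
  "source q = (SOME p. p \<in> Obj C \<and> isomorphic_in D (FObj F p) q)"

definition counit_pair :: "'p \<Rightarrow> 'n \<times> 'n" where
  "counit_pair q = (SOME (e, e'). inverse_morphisms D (FObj F (source q)) q e e')"

abbreviation counit :: "'p \<Rightarrow> 'n" where
  "counit q \<equiv> fst (counit_pair q)"

abbreviation counit_inv :: "'p \<Rightarrow> 'n" where
  "counit_inv q \<equiv> snd (counit_pair q)"

lemma
  assumes q: "q \<in> Obj D"
  shows source_closed: "source q \<in> Obj C"
    and inverse_morphisms_counit:
      "inverse_morphisms D (FObj F (source q)) q (counit q) (counit_inv q)"
proof -
  have source: "source q \<in> Obj C \<and> isomorphic_in D (FObj F (source q)) q"
    unfolding source_def by (rule someI_ex) (use essentially_surjective[OF q] in blast)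
  then show "source q \<in> Obj C" by blast
  have "\<exists>p. case p of (e, e') \<Rightarrow> inverse_morphisms D (FObj F (source q)) q e e'"
    using source by (auto simp: isomorphic_in_iff)
  then have "case counit_pair q of (e, e') \<Rightarrow> inverse_morphisms D (FObj F (source q)) q e e'"
    unfolding counit_pair_def by (rule someI_ex)
  then show "inverse_morphisms D (FObj F (source q)) q (counit q) (counit_inv q)"
    by (simp add: case_prod_beta)
qed

lemma
  assumes "q \<in> Obj D"
  shows counit_closed: "counit q \<in> carrier (Mor D q (FObj F (source q)))"
    and counit_inv_closed: "counit_inv q \<in> carrier (Mor D (FObj F (source q)) q)"
    and counit_inv_counit:
      "Cmp D (FObj F (source q)) q (FObj F (source q)) (counit_inv q) (counit q)
        = Idt D (FObj F (source q))"
    and counit_counit_inv: "Cmp D q (FObj F (source q)) q (counit q) (counit_inv q) = Idt D q"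
  using inverse_morphisms_counit[OF assms] by (simp_all add: inverse_morphisms_def)

lemma counit_counit_inv_cancel:
  assumes "q \<in> Obj D" "p \<in> Obj D" "f \<in> carrier (Mor D q p)"
  shows "Cmp D q (FObj F (source q)) p (counit q) (Cmp D (FObj F (source q)) q p (counit_inv q) f) =
      f"
  using assms
  by (simp add: D.Cmp_assoc[symmetric] counit_counit_inv D.Idt_left counit_closed counit_inv_closed
      F_closed source_closed)

definition conjugate :: "'p \<Rightarrow> 'p \<Rightarrow> 'n \<Rightarrow> 'n" where
  "conjugate q p f = Cmp D (FObj F (source q)) q (FObj F (source p)) (counit_inv q)
     (Cmp D q p (FObj F (source p)) f (counit p))"

lemma conjugate_linear:
  assumes "p \<in> Obj D" "q \<in> Obj D"
  shows "conjugate q p \<in> linear_maps K (Mor D q p) (Mor D (FObj F (source q)) (FObj F (source p)))"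
  unfolding conjugate_def[abs_def]
  by (rule linear_maps_comp[OF D.Cmp_linear_left D.Cmp_linear_right])
    (simp_all add: assms F_closed source_closed counit_closed counit_inv_closed)

lemma conjugate_closed:
  "\<lbrakk>p \<in> Obj D; q \<in> Obj D; f \<in> carrier (Mor D q p)\<rbrakk>
    \<Longrightarrow> conjugate q p f \<in> carrier (Mor D (FObj F (source q)) (FObj F (source p)))"
  by (rule linear_maps_closed[OF conjugate_linear])

lemma conjugate_Idt: "q \<in> Obj D \<Longrightarrow> conjugate q q (Idt D q) = Idt D (FObj F (source q))"
  by (simp add: conjugate_def D.Idt_left F_closed source_closed counit_closed counit_inv_counit)

lemma conjugate_Cmp:
  assumes "p \<in> Obj D" "q \<in> Obj D" "r \<in> Obj D" "g \<in> carrier (Mor D r q)" "f \<in> carrier (Mor D q p)"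
  shows "conjugate r p (Cmp D r q p g f) = Cmp D (FObj F (source r)) (FObj F (source q))
    (FObj F (source p)) (conjugate r q g) (conjugate q p f)"
  using assms by (simp add: conjugate_def D.Cmp_assoc D.Cmp_closed counit_counit_inv_cancel F_closed
      source_closed counit_closed counit_inv_closed)

lemma counit_conjugate:
  assumes "p \<in> Obj D" "q \<in> Obj D" "f \<in> carrier (Mor D q p)"
  shows "Cmp D q (FObj F (source q)) (FObj F (source p)) (counit q) (conjugate q p f) =
    Cmp D q p (FObj F (source p)) f (counit p)"
  using assms
  by (simp add: conjugate_def counit_counit_inv_cancel D.Cmp_closed F_closed source_closed
      counit_closed)

definition quasi_inverse :: "('p, 'n, 'o, 'm) kfun" where
  "quasi_inverse = \<lparr>FObj = source,
     FMor = (\<lambda>q p f. preimage (source q) (source p) (conjugate q p f))\<rparr>"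

lemma
  shows FObj_quasi_inverse: "FObj quasi_inverse = source"
    and FMor_quasi_inverse: "FMor quasi_inverse q p f =
        preimage (source q) (source p) (conjugate q p f)"
  by (simp_all add: quasi_inverse_def)

lemma k_functor_quasi_inverse: "k_functor K D C quasi_inverse"
proof (rule k_functorI)
  fix p q assume pq: "p \<in> Obj D" "q \<in> Obj D"
  note sources = source_closed[OF pq(1)] source_closed[OF pq(2)]
  note bij = fully_faithful[OF sources]
  show "FMor quasi_inverse q p \<in> linear_maps K (Mor D q p) (Mor C (FObj quasi_inverse q)
      (FObj quasi_inverse p))"
    unfolding FMor_quasi_inverse[abs_def] FObj_quasi_inverse preimage_def
    by (rule linear_maps_lift[OF D.Mor_module[OF pq] C.Mor_module[OF sources]
          k_functor_linear[OF F_functor sources] bij_betw_imp_inj_on[OF bij]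
              conjugate_linear[OF pq]])
      (simp add: bij_betw_imp_surj_on[OF bij] conjugate_closed pq)
next
  fix q assume "q \<in> Obj D"
  then show "FMor quasi_inverse q q (Idt D q) = Idt C (FObj quasi_inverse q)"
    by (intro faithfulD[of "source q" "source q"])
      (simp_all add: FObj_quasi_inverse FMor_quasi_inverse preimage_closed F_preimage F_closed
        source_closed C.Idt_closed D.Idt_closed conjugate_Idt k_functor_Idt[OF F_functor])
next
  fix p q r g f
  assume "p \<in> Obj D" "q \<in> Obj D" "r \<in> Obj D" "g \<in> carrier (Mor D r q)" "f \<in> carrier (Mor D q p)"
  then show "FMor quasi_inverse r p (Cmp D r q p g f) =
    Cmp C (FObj quasi_inverse r) (FObj quasi_inverse q) (FObj quasi_inverse p)
      (FMor quasi_inverse r q g) (FMor quasi_inverse q p f)"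
    by (intro faithfulD[of "source r" "source p"])
      (simp_all add: FObj_quasi_inverse FMor_quasi_inverse preimage_closed F_preimage
          conjugate_closed
        F_closed source_closed C.Cmp_closed D.Cmp_closed conjugate_Cmp k_functor_Cmp[OF F_functor])
qed (simp add: FObj_quasi_inverse source_closed)

lemma comp_quasi_inverse_isomorphic_id:
  "isomorphic_in (functor_category K D D) (comp_functor F quasi_inverse) id_functor"
proof (rule isomorphic_in_functor_categoryI[OF D.k_category_axioms k_functor_id_functor
      k_functor_comp_functor[OF k_functor_quasi_inverse F_functor], where \<sigma> = counit_inv])
  show "restrict counit (Obj D) \<in> natural_transformations D D (comp_functor F quasi_inverse)
      id_functor"
    by (rule natural_transformationsI)
      (simp_all add: comp_functor_def id_functor_def FObj_quasi_inverse FMor_quasi_inverse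
        counit_closed F_preimage source_closed conjugate_closed counit_conjugate)
qed (simp add: comp_functor_def id_functor_def FObj_quasi_inverse inverse_morphisms_counit)

lemma quasi_inverse_comp_isomorphic_id:
  "isomorphic_in (functor_category K C C) (comp_functor quasi_inverse F) id_functor"
proof (rule isomorphic_in_functor_categoryI[OF C.k_category_axioms k_functor_id_functor
      k_functor_comp_functor[OF F_functor k_functor_quasi_inverse]])
  note [simp] = comp_functor_def id_functor_def FObj_quasi_inverse FMor_quasi_inverse F_closed
    preimage_closed F_preimage source_closed counit_closed counit_inv_closed conjugate_closed
    C.Cmp_closed D.Cmp_closed C.Idt_closed k_functor_Cmp[OF F_functor] k_functor_Idt[OF F_functor]
    counit_conjugate counit_counit_inv counit_inv_counit
  let ?unit_inv = "\<lambda>p. preimage p (source (FObj F p)) (counit (FObj F p))"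
  let ?unit = "\<lambda>p. preimage (source (FObj F p)) p (counit_inv (FObj F p))"
  show "restrict ?unit_inv (Obj C)
    \<in> natural_transformations C C (comp_functor quasi_inverse F) id_functor"
  proof (rule natural_transformationsI)
    fix p q f assume [simp]: "p \<in> Obj C" "q \<in> Obj C" "f \<in> carrier (Mor C q p)"
    let ?p = "source (FObj F p)" and ?q = "source (FObj F q)"
    have "Cmp C q ?q ?p (?unit_inv q) (preimage ?q ?p
        (conjugate (FObj F q) (FObj F p) (FMor F q p f)))
        = Cmp C q p ?p f (?unit_inv p)"
      by (rule faithfulD[of q ?p]) simp_all
    then show "Cmp C (FObj id_functor q) (FObj (comp_functor quasi_inverse F) q)
        (FObj (comp_functor quasi_inverse F) p) (restrict ?unit_inv (Obj C) q)
        (FMor (comp_functor quasi_inverse F) q p f) =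
      Cmp C (FObj id_functor q) (FObj id_functor p) (FObj (comp_functor quasi_inverse F) p)
        (FMor id_functor q p f) (restrict ?unit_inv (Obj C) p)"
      by simp
  qed simp_all
  fix p assume [simp]: "p \<in> Obj C"
  let ?p = "source (FObj F p)"
  have "Cmp C ?p p ?p (?unit p) (?unit_inv p) = Idt C ?p"
    by (rule faithfulD[of ?p ?p]) simp_all
  moreover have "Cmp C p ?p p (?unit_inv p) (?unit p) = Idt C p"
    by (rule faithfulD[of p p]) simp_all
  ultimately show "inverse_morphisms C (FObj (comp_functor quasi_inverse F) p) (FObj id_functor p)
      (restrict ?unit_inv (Obj C) p) (?unit p)"
    by (simp add: inverse_morphisms_def)
qed

theorem k_equivalent: "k_equivalent K C D"
  unfolding k_equivalent_def
  using F_functor k_functor_quasi_inverse quasi_inverse_comp_isomorphic_id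
    comp_quasi_inverse_isomorphic_id by blast

end

section \<open>Modules over a linear category\<close>

lemma
  shows Obj_vector_spaces: "Obj (vector_spaces K) = {V. module K V}"
    and carrier_Mor_vector_spaces:
      "carrier (Mor (vector_spaces K) W V) = linear_maps K V W \<inter> extensional (carrier V)"
    and zero_vector_spaces: "\<zero>\<^bsub>Mor (vector_spaces K) W V\<^esub> = (\<lambda>v\<in>carrier V. \<zero>\<^bsub>W\<^esub>)"
    and add_vector_spaces: "f \<oplus>\<^bsub>Mor (vector_spaces K) W V\<^esub> g = (\<lambda>v\<in>carrier V. f v \<oplus>\<^bsub>W\<^esub> g v)"
    and smult_vector_spaces: "c \<odot>\<^bsub>Mor (vector_spaces K) W V\<^esub> f = (\<lambda>v\<in>carrier V. c \<odot>\<^bsub>W\<^esub> f v)"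
    and Cmp_vector_spaces: "Cmp (vector_spaces K) W V U g f = compose (carrier U) g f"
    and Idt_vector_spaces: "Idt (vector_spaces K) V = (\<lambda>v\<in>carrier V. v)"
  by (simp_all add: vector_spaces_def)

lemmas vector_spaces_simps = Obj_vector_spaces carrier_Mor_vector_spaces zero_vector_spaces
  add_vector_spaces smult_vector_spaces Cmp_vector_spaces Idt_vector_spaces

lemma module_Mor_vector_spaces:
  fixes V W :: "('k, 'v) module"
  assumes V: "module K V" and W: "module K W"
  shows "module K (Mor (vector_spaces K) W V)"
proof (rule module_pointwise[of K "carrier V" "\<lambda>_. W"])
  show "cring K"
    using V by (rule module.axioms)
  show "carrier (Mor (vector_spaces K) W V) \<subseteq> (\<Pi>\<^sub>E v\<in>carrier V. carrier W)"
    by (auto simp: vector_spaces_simps linear_maps_closed PiE_def)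
qed (use V W in \<open>auto simp: vector_spaces_simps linear_maps_restrict linear_maps_const_zero
    linear_maps_pointwise_add linear_maps_pointwise_smult\<close>)

theorem k_category_vector_spaces:
  assumes "field K"
  shows "k_category K (vector_spaces K)"
proof (rule k_category.intro[OF assms k_category_axioms.intro],
    unfold Obj_vector_spaces mem_Collect_eq)
  let ?Vect = "vector_spaces K"
  note [simp] = vector_spaces_simps
  fix T U V W :: "('a, 'v) module"
  assume modules: "module K T" "module K U" "module K V" "module K W"
  show "module K (Mor ?Vect V U)"
    using modules by (intro module_Mor_vector_spaces)
  show "Idt ?Vect U \<in> carrier (Mor ?Vect U U)"
    using modules by (simp add: linear_maps_restrict linear_maps_id)
  show "Cmp ?Vect V V U (Idt ?Vect V) f = f" and "Cmp ?Vect V U U f (Idt ?Vect U) = f"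
    if "f \<in> carrier (Mor ?Vect V U)" for f
    using that by (auto simp: linear_maps_def intro: Id_compose compose_Id)
  have compose: "compose (carrier U) g f \<in> linear_maps K U W"
    if "f \<in> linear_maps K U V" "g \<in> linear_maps K V W" for f g
    unfolding compose_def by (rule linear_maps_restrict[OF linear_maps_comp[OF that] modules(2)])
  show "(\<lambda>f. Cmp ?Vect W V U g f) \<in> linear_maps K (Mor ?Vect V U) (Mor ?Vect W U)"
    if "g \<in> carrier (Mor ?Vect W V)" for g
    using that by (intro linear_mapsI) (auto simp: compose, auto simp: compose_def fun_eq_iff
        linear_maps_closed linear_maps_add linear_maps_smult)
  show "(\<lambda>g. Cmp ?Vect W V U g f) \<in> linear_maps K (Mor ?Vect W V) (Mor ?Vect W U)"
    if "f \<in> carrier (Mor ?Vect V U)" for f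
    using that by (intro linear_mapsI) (auto simp: compose, auto simp: compose_def fun_eq_iff
        linear_maps_closed)
  show "Cmp ?Vect W U T (Cmp ?Vect W V U h g) f = Cmp ?Vect W V T h (Cmp ?Vect V U T g f)"
    if "h \<in> carrier (Mor ?Vect W V)" "g \<in> carrier (Mor ?Vect V U)" "f \<in> carrier (Mor ?Vect U T)"
        for h g f
    using that by (auto simp: compose_def fun_eq_iff linear_maps_closed)
qed

type_synonym ('k, 'o, 'm, 'v) cat_module = "('o, 'm, ('k, 'v) module, 'v \<Rightarrow> 'v) kfun"

type_synonym ('k, 'o, 'm, 'v) cat_modules =
  "('k, ('k, 'o, 'm, 'v) cat_module, 'o \<Rightarrow> 'v \<Rightarrow> 'v) kcat"

locale left_module = k_category K C
  for K :: "('k, 'r) ring_scheme" and C :: "('k, 'o, 'm) kcat" +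
  fixes M :: "('k, 'o, 'm, 'v) cat_module"
  assumes module_functor: "k_functor K C (vector_spaces K) M"
begin

lemma space_module: "x \<in> Obj C \<Longrightarrow> module K (FObj M x)"
  using k_functor_FObj[OF module_functor] by (simp add: Obj_vector_spaces)

lemma act_linear:
  "\<lbrakk>x \<in> Obj C; y \<in> Obj C; f \<in> carrier (Mor C y x)\<rbrakk>
    \<Longrightarrow> FMor M y x f \<in> linear_maps K (FObj M x) (FObj M y)"
  using k_functor_closed[OF module_functor] by (simp add: carrier_Mor_vector_spaces)

lemma act_closed:
  "\<lbrakk>x \<in> Obj C; y \<in> Obj C; f \<in> carrier (Mor C y x); v \<in> carrier (FObj M x)\<rbrakk>
    \<Longrightarrow> FMor M y x f v \<in> carrier (FObj M y)"
  by (rule linear_maps_closed[OF act_linear])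

lemma act_linear_Mor:
  "\<lbrakk>x \<in> Obj C; y \<in> Obj C; v \<in> carrier (FObj M x)\<rbrakk>
    \<Longrightarrow> (\<lambda>f. FMor M y x f v) \<in> linear_maps K (Mor C y x) (FObj M y)"
  using k_functor_linear[OF module_functor, of x y]
  by (intro linear_mapsI)
    (simp_all add: act_closed linear_maps_add linear_maps_smult vector_spaces_simps)

lemma act_Idt: "\<lbrakk>x \<in> Obj C; v \<in> carrier (FObj M x)\<rbrakk> \<Longrightarrow> FMor M x x (Idt C x) v = v"
  using k_functor_Idt[OF module_functor] by (simp add: vector_spaces_simps)

lemma act_Cmp:
  "\<lbrakk>x \<in> Obj C; y \<in> Obj C; z \<in> Obj C; g \<in> carrier (Mor C z y); f \<in> carrier (Mor C y x);
    v \<in> carrier (FObj M x)\<rbrakk> \<Longrightarrow> FMor M z x (Cmp C z y x g f) v = FMor M z y g (FMor M y x f v)"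
  using k_functor_Cmp[OF module_functor] by (simp add: vector_spaces_simps compose_def)

lemma act_finsum:
  "\<lbrakk>x \<in> Obj C; y \<in> Obj C; f \<in> carrier (Mor C y x); finite A;
    \<And>i. i \<in> A \<Longrightarrow> v i \<in> carrier (FObj M x)\<rbrakk>
    \<Longrightarrow> FMor M y x f (\<Oplus>\<^bsub>FObj M x\<^esub>i\<in>A. v i) = (\<Oplus>\<^bsub>FObj M y\<^esub>i\<in>A. FMor M y x f (v i))"
  by (rule linear_maps_finsum[OF act_linear space_module space_module])

lemma act_finsum_Mor:
  "\<lbrakk>x \<in> Obj C; y \<in> Obj C; v \<in> carrier (FObj M x); finite A;
    \<And>i. i \<in> A \<Longrightarrow> f i \<in> carrier (Mor C y x)\<rbrakk>
    \<Longrightarrow> FMor M y x (\<Oplus>\<^bsub>Mor C y x\<^esub>i\<in>A. f i) v = (\<Oplus>\<^bsub>FObj M y\<^esub>i\<in>A. FMor M y x (f i) v)"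
  by (rule linear_maps_finsum[OF act_linear_Mor Mor_module space_module])

end

lemma left_moduleI:
  assumes C: "k_category K C"
    and space: "\<And>x. x \<in> Obj C \<Longrightarrow> module K (FObj M x)"
    and linear: "\<And>x y f. \<lbrakk>x \<in> Obj C; y \<in> Obj C; f \<in> carrier (Mor C y x)\<rbrakk>
      \<Longrightarrow> FMor M y x f \<in> linear_maps K (FObj M x) (FObj M y)"
    and extensional: "\<And>x y f. \<lbrakk>x \<in> Obj C; y \<in> Obj C; f \<in> carrier (Mor C y x)\<rbrakk>
      \<Longrightarrow> FMor M y x f \<in> extensional (carrier (FObj M x))"
    and linear_Mor: "\<And>x y v. \<lbrakk>x \<in> Obj C; y \<in> Obj C; v \<in> carrier (FObj M x)\<rbrakk>
      \<Longrightarrow> (\<lambda>f. FMor M y x f v) \<in> linear_maps K (Mor C y x) (FObj M y)"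
    and Idt: "\<And>x v. \<lbrakk>x \<in> Obj C; v \<in> carrier (FObj M x)\<rbrakk> \<Longrightarrow> FMor M x x (Idt C x) v = v"
    and Cmp: "\<And>x y z g f v. \<lbrakk>x \<in> Obj C; y \<in> Obj C; z \<in> Obj C; g \<in> carrier (Mor C z y);
        f \<in> carrier (Mor C y x); v \<in> carrier (FObj M x)\<rbrakk>
      \<Longrightarrow> FMor M z x (Cmp C z y x g f) v = FMor M z y g (FMor M y x f v)"
  shows "left_module K C M"
proof (intro left_module.intro C left_module_axioms.intro k_functorI)
  interpret C: k_category K C by (rule C)
  have eqI: "FMor M y x f = restrict g (carrier (FObj M x))"
    if "x \<in> Obj C" "y \<in> Obj C" "f \<in> carrier (Mor C y x)"
      "\<And>v. v \<in> carrier (FObj M x) \<Longrightarrow> FMor M y x f v = g v" for x y f g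
    by (rule extensionalityI[OF extensional[OF that(1-3)] restrict_extensional]) (simp add: that(4))
  fix x y assume xy: "x \<in> Obj C" "y \<in> Obj C"
  show "FMor M y x \<in> linear_maps K (Mor C y x) (Mor (vector_spaces K) (FObj M y) (FObj M x))"
    using xy by (intro linear_mapsI)
      (auto simp: vector_spaces_simps linear extensional C.Mor_add_closed C.Mor_smult_closed
        linear_maps_add[OF linear_Mor] linear_maps_smult[OF linear_Mor] intro!: eqI)
  show "FMor M x x (Idt C x) = Idt (vector_spaces K) (FObj M x)"
    using xy by (auto simp: vector_spaces_simps Idt C.Idt_closed intro!: eqI)
  fix z g f assume "z \<in> Obj C" "g \<in> carrier (Mor C z y)" "f \<in> carrier (Mor C y x)"
  then show "FMor M z x (Cmp C z y x g f) =
      Cmp (vector_spaces K) (FObj M z) (FObj M y) (FObj M x) (FMor M z y g) (FMor M y x f)"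
    using xy by (auto simp: vector_spaces_simps compose_def Cmp C.Cmp_closed intro!: eqI)
qed (simp add: Obj_vector_spaces space)

abbreviation module_homs ::
    "('k, 'r) ring_scheme \<Rightarrow> ('k, 'o, 'm) kcat \<Rightarrow> ('k, 'o, 'm, 'v) cat_module
      \<Rightarrow> ('k, 'o, 'm, 'v) cat_module \<Rightarrow> ('o \<Rightarrow> 'v \<Rightarrow> 'v) set" where
  "module_homs K C M N \<equiv> natural_transformations C (vector_spaces K) M N"

lemma module_homs_iff:
  "\<tau> \<in> module_homs K C M N \<longleftrightarrow> \<tau> \<in> extensional (Obj C) \<and>
    (\<forall>x\<in>Obj C. \<tau> x \<in> linear_maps K (FObj M x) (FObj N x) \<inter> extensional (carrier (FObj M x))) \<and>
    (\<forall>x\<in>Obj C. \<forall>y\<in>Obj C. \<forall>f\<in>carrier (Mor C y x). \<forall>v\<in>carrier (FObj M x).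
      \<tau> y (FMor M y x f v) = FMor N y x f (\<tau> x v))"
  unfolding natural_transformations_def vector_spaces_simps
  by (auto simp: PiE_iff compose_def restrict_def fun_eq_iff)

lemma
  assumes "\<tau> \<in> module_homs K C M N" "x \<in> Obj C"
  shows module_homs_linear: "\<tau> x \<in> linear_maps K (FObj M x) (FObj N x)"
    and module_homs_extensional: "\<tau> x \<in> extensional (carrier (FObj M x))"
    and module_homs_closed: "v \<in> carrier (FObj M x) \<Longrightarrow> \<tau> x v \<in> carrier (FObj N x)"
    and module_homs_natural: "\<lbrakk>y \<in> Obj C; f \<in> carrier (Mor C y x); v \<in> carrier (FObj M x)\<rbrakk>
      \<Longrightarrow> \<tau> y (FMor M y x f v) = FMor N y x f (\<tau> x v)"
proof -
  show linear: "\<tau> x \<in> linear_maps K (FObj M x) (FObj N x)"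
    using assms by (simp add: module_homs_iff)
  show "\<tau> x \<in> extensional (carrier (FObj M x))"
    using assms by (simp add: module_homs_iff)
  show "v \<in> carrier (FObj M x) \<Longrightarrow> \<tau> x v \<in> carrier (FObj N x)"
    by (rule linear_maps_closed[OF linear])
  show "\<lbrakk>y \<in> Obj C; f \<in> carrier (Mor C y x); v \<in> carrier (FObj M x)\<rbrakk>
      \<Longrightarrow> \<tau> y (FMor M y x f v) = FMor N y x f (\<tau> x v)"
    using assms by (simp add: module_homs_iff)
qed

lemma module_homs_eqI:
  assumes "\<sigma> \<in> module_homs K C M N" "\<tau> \<in> module_homs K C M N"
    and "\<And>x v. \<lbrakk>x \<in> Obj C; v \<in> carrier (FObj M x)\<rbrakk> \<Longrightarrow> \<sigma> x v = \<tau> x v"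
  shows "\<sigma> = \<tau>"
  using assms by (blast intro: natural_transformations_eqI extensionalityI module_homs_extensional)

lemma Obj_left_modules: "k_category K C \<Longrightarrow> Obj (left_modules K C) = {M. left_module K C M}"
  by (auto simp: left_modules_def Obj_functor_category left_module_def left_module_axioms_def)

lemma
  shows carrier_Mor_left_modules: "carrier (Mor (left_modules K C) N M) = module_homs K C M N"
    and add_left_modules: "\<sigma> \<oplus>\<^bsub>Mor (left_modules K C) N M\<^esub> \<tau> =
      (\<lambda>x\<in>Obj C. \<lambda>v\<in>carrier (FObj M x). \<sigma> x v \<oplus>\<^bsub>FObj N x\<^esub> \<tau> x v)"
    and smult_left_modules: "c \<odot>\<^bsub>Mor (left_modules K C) N M\<^esub> \<tau> =
      (\<lambda>x\<in>Obj C. \<lambda>v\<in>carrier (FObj M x). c \<odot>\<^bsub>FObj N x\<^esub> \<tau> x v)"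
    and Cmp_left_modules: "Cmp (left_modules K C) P N M \<sigma> \<tau> =
      (\<lambda>x\<in>Obj C. compose (carrier (FObj M x)) (\<sigma> x) (\<tau> x))"
    and Idt_left_modules: "Idt (left_modules K C) M = (\<lambda>x\<in>Obj C. \<lambda>v\<in>carrier (FObj M x). v)"
  by (simp_all add: left_modules_def functor_category_simps vector_spaces_simps)

lemma k_category_left_modules: "field K \<Longrightarrow> k_category K (left_modules K C)"
  unfolding left_modules_def by (intro k_category_functor_category k_category_vector_spaces)

text \<open>Unlike a morphism of \<open>left_modules K C\<close>, an isomorphism in this sense may relate modules whose
  elements have different types.\<close>

definition module_isomorphism ::
    "('k, 'r) ring_scheme \<Rightarrow> ('k, 'o, 'm) kcat \<Rightarrow> ('k, 'o, 'm, 'v) cat_module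
      \<Rightarrow> ('k, 'o, 'm, 'w) cat_module \<Rightarrow> ('o \<Rightarrow> 'v \<Rightarrow> 'w) \<Rightarrow> bool" where
  "module_isomorphism K C M N \<tau> \<longleftrightarrow>
     (\<forall>x\<in>Obj C. \<tau> x \<in> linear_maps K (FObj M x) (FObj N x) \<and>
       bij_betw (\<tau> x) (carrier (FObj M x)) (carrier (FObj N x))) \<and>
     (\<forall>x\<in>Obj C. \<forall>y\<in>Obj C. \<forall>f\<in>carrier (Mor C y x). \<forall>v\<in>carrier (FObj M x).
       \<tau> y (FMor M y x f v) = FMor N y x f (\<tau> x v))"

lemma
  assumes "module_isomorphism K C M N \<tau>" "x \<in> Obj C"
  shows module_isomorphism_linear: "\<tau> x \<in> linear_maps K (FObj M x) (FObj N x)"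
    and module_isomorphism_bij: "bij_betw (\<tau> x) (carrier (FObj M x)) (carrier (FObj N x))"
    and module_isomorphism_natural: "\<lbrakk>y \<in> Obj C; f \<in> carrier (Mor C y x); v \<in> carrier (FObj M x)\<rbrakk>
      \<Longrightarrow> \<tau> y (FMor M y x f v) = FMor N y x f (\<tau> x v)"
  using assms unfolding module_isomorphism_def by blast+

lemma module_isomorphism_comp:
  assumes \<sigma>: "module_isomorphism K C L M \<sigma>" and \<tau>: "module_isomorphism K C M N \<tau>"
  shows "module_isomorphism K C L N (\<lambda>x v. \<tau> x (\<sigma> x v))"
  unfolding module_isomorphism_def
proof (intro conjI ballI)
  fix x assume x: "x \<in> Obj C"
  note \<sigma>_linear = module_isomorphism_linear[OF \<sigma> x]
  show "(\<lambda>v. \<tau> x (\<sigma> x v)) \<in> linear_maps K (FObj L x) (FObj N x)"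
    by (rule linear_maps_comp[OF \<sigma>_linear module_isomorphism_linear[OF \<tau> x]])
  show "bij_betw (\<lambda>v. \<tau> x (\<sigma> x v)) (carrier (FObj L x)) (carrier (FObj N x))"
    using bij_betw_trans[OF module_isomorphism_bij[OF \<sigma> x] module_isomorphism_bij[OF \<tau> x]]
    by (simp add: comp_def)
  fix y f v assume "y \<in> Obj C" "f \<in> carrier (Mor C y x)" "v \<in> carrier (FObj L x)"
  then show "\<tau> y (\<sigma> y (FMor L y x f v)) = FMor N y x f (\<tau> x (\<sigma> x v))"
    using x by (simp add: module_isomorphism_natural[OF \<sigma>] module_isomorphism_natural[OF \<tau>]
        linear_maps_closed[OF \<sigma>_linear])
qed

lemma module_isomorphism_inverse:
  assumes M: "left_module K C M" and N: "left_module K C N" and \<tau>: "module_isomorphism K C M N \<tau>"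
  shows "module_isomorphism K C N M (\<lambda>x. inv_into (carrier (FObj M x)) (\<tau> x))"
  unfolding module_isomorphism_def
proof (intro conjI ballI)
  interpret M: left_module K C M by (rule M)
  interpret N: left_module K C N by (rule N)
  fix x assume x: "x \<in> Obj C"
  note bij = module_isomorphism_bij[OF \<tau>]
  show "inv_into (carrier (FObj M x)) (\<tau> x) \<in> linear_maps K (FObj N x) (FObj M x)"
    using bij[OF x] unfolding bij_betw_def
    by (intro linear_maps_lift[OF N.space_module M.space_module module_isomorphism_linear[OF \<tau>] _
          linear_maps_id] x) simp_all
  show "bij_betw (inv_into (carrier (FObj M x)) (\<tau> x)) (carrier (FObj N x)) (carrier (FObj M x))"
    by (rule bij_betw_inv_into[OF bij[OF x]])
  fix y f v assume yf: "y \<in> Obj C" "f \<in> carrier (Mor C y x)" and v: "v \<in> carrier (FObj N x)"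
  then obtain u where u: "u \<in> carrier (FObj M x)" "v = \<tau> x u"
    using bij[OF x] v by (auto simp: bij_betw_def)
  have inverse: "inv_into (carrier (FObj M z)) (\<tau> z) (\<tau> z w) = w"
    if "z \<in> Obj C" "w \<in> carrier (FObj M z)" for z w
    using bij[OF that(1)] that(2) by (simp add: bij_betw_def)
  show "inv_into (carrier (FObj M y)) (\<tau> y) (FMor N y x f v) =
      FMor M y x f (inv_into (carrier (FObj M x)) (\<tau> x) v)"
    using x yf u by (simp add: module_isomorphism_natural[OF \<tau>, symmetric] inverse M.act_closed)
qed

lemma restrict_module_isomorphism:
  assumes M: "left_module K C M" and \<tau>: "module_isomorphism K C M N \<tau>"
  shows "(\<lambda>x\<in>Obj C. restrict (\<tau> x) (carrier (FObj M x))) \<in> module_homs K C M N"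
proof -
  interpret M: left_module K C M by (rule M)
  show ?thesis
    by (simp add: module_homs_iff module_isomorphism_linear[OF \<tau>] M.space_module
        linear_maps_restrict
        module_isomorphism_natural[OF \<tau>] M.act_closed)
qed

lemma isomorphic_in_left_modulesI:
  assumes M: "left_module K C M" and N: "left_module K C N" and \<tau>: "module_isomorphism K C M N \<tau>"
  shows "isomorphic_in (left_modules K C) M N"
proof -
  interpret M: left_module K C M by (rule M)
  interpret N: left_module K C N by (rule N)
  note \<sigma> = module_isomorphism_inverse[OF M N \<tau>]
  let ?\<tau> = "\<lambda>x\<in>Obj C. restrict (\<tau> x) (carrier (FObj M x))"
  let ?\<sigma> = "\<lambda>x\<in>Obj C. restrict (inv_into (carrier (FObj M x)) (\<tau> x)) (carrier (FObj N x))"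
  have "inv_into (carrier (FObj M x)) (\<tau> x) (\<tau> x v) = v" if "x \<in> Obj C" "v \<in> carrier (FObj M x)"
      for x v
    using module_isomorphism_bij[OF \<tau> that(1)] that(2) by (simp add: bij_betw_def)
  moreover have "\<tau> x (inv_into (carrier (FObj M x)) (\<tau> x) v) = v"
    if "x \<in> Obj C" "v \<in> carrier (FObj N x)" for x v
    using module_isomorphism_bij[OF \<tau> that(1)] that(2) by (auto simp: bij_betw_def f_inv_into_f)
  ultimately have "inverse_morphisms (left_modules K C) M N ?\<tau> ?\<sigma>"
    using restrict_module_isomorphism[OF M \<tau>] restrict_module_isomorphism[OF N \<sigma>]
      linear_maps_closed[OF module_isomorphism_linear[OF \<tau>]]
      linear_maps_closed[OF module_isomorphism_linear[OF \<sigma>]]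
    by (simp add: inverse_morphisms_def carrier_Mor_left_modules Cmp_left_modules Idt_left_modules
        compose_def cong: restrict_cong)
  then show ?thesis
    using M N by (auto simp: isomorphic_in_iff Obj_left_modules[OF M.k_category_axioms])
qed

lemma left_module_transport:
  fixes M :: "('k, 'o, 'm, 'w) cat_module" and enc :: "'o \<Rightarrow> 'w \<Rightarrow> 'v"
  assumes M: "left_module K C M" and inj: "\<And>x. x \<in> Obj C \<Longrightarrow> inj_on (enc x) (carrier (FObj M x))"
  obtains N :: "('k, 'o, 'm, 'v) cat_module"
  where "left_module K C N" "module_isomorphism K C M N enc"
proof -
  interpret M: left_module K C M by (rule M)
  define dec where "dec x = inv_into (carrier (FObj M x)) (enc x)" for x
  have dec[simp]: "dec x (enc x v) = v" if "x \<in> Obj C" "v \<in> carrier (FObj M x)" for x v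
    unfolding dec_def by (rule inv_into_f_f[OF inj[OF that(1)] that(2)])
  define N :: "('k, 'o, 'm, 'v) cat_module" where
    "N = \<lparr>FObj = (\<lambda>x. \<lparr>carrier = enc x ` carrier (FObj M x), mult = undefined, one = undefined,
        ring.zero = enc x \<zero>\<^bsub>FObj M x\<^esub>, add = (\<lambda>a b. enc x (dec x a \<oplus>\<^bsub>FObj M x\<^esub> dec x b)),
        smult = (\<lambda>c a. enc x (c \<odot>\<^bsub>FObj M x\<^esub> dec x a))\<rparr>),
      FMor = (\<lambda>y x f. \<lambda>a\<in>enc x ` carrier (FObj M x). enc y (FMor M y x f (dec x a)))\<rparr>"
  have image: "carrier (FObj N x) = enc x ` carrier (FObj M x)" for x
    by (simp add: N_def)
  have linear: "enc x \<in> linear_maps K (FObj M x) (FObj N x)" if "x \<in> Obj C" for x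
    by (rule linear_mapsI) (simp_all add: N_def that)
  have act: "FMor N y x f (enc x v) = enc y (FMor M y x f v)"
    if "x \<in> Obj C" "v \<in> carrier (FObj M x)" for x y f v
    using that by (simp add: N_def)
  have "left_module K C N"
  proof (rule left_moduleI)
    show "module K (FObj N x)" if "x \<in> Obj C" for x
      by (rule module_surj_image[OF M.space_module[OF that] image _ linear[OF that]])
        (simp add: N_def)
    show "FMor N y x f \<in> linear_maps K (FObj N x) (FObj N y)"
      if "x \<in> Obj C" "y \<in> Obj C" "f \<in> carrier (Mor C y x)" for x y f
      by (rule linear_maps_descend[OF M.space_module linear image
            linear_maps_comp[OF M.act_linear linear]]) (simp_all add: that act)
    show "FMor N y x f \<in> extensional (carrier (FObj N x))" for x y f
      by (simp add: N_def)
    show "(\<lambda>f. FMor N y x f w) \<in> linear_maps K (Mor C y x) (FObj N y)"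
      if "x \<in> Obj C" "y \<in> Obj C" "w \<in> carrier (FObj N x)" for x y w
      using that
      by (auto simp: image act intro!: linear_maps_comp[OF M.act_linear_Mor linear])
  qed (auto simp: image act M.act_Idt M.act_Cmp M.act_closed M.k_category_axioms)
  moreover have "module_isomorphism K C M N enc"
    by (simp add: module_isomorphism_def linear image act inj bij_betw_def)
  ultimately show thesis
    by (rule that)
qed

lemma ex_inj_on_PiE:
  assumes "infinite (UNIV :: 'v set)" "finite J"
  shows "\<exists>enc :: ('j \<Rightarrow> 'v) \<Rightarrow> 'v. inj_on enc (\<Pi>\<^sub>E j\<in>J. UNIV)"
proof -
  obtain enc :: "'v list \<Rightarrow> 'v" where enc: "inj enc"
    using lists_infinite_bij_betw_types[OF assms(1)] bij_is_inj by blast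
  obtain js where js: "set js = J"
    using finite_list[OF assms(2)] by blast
  have "inj_on (\<lambda>v. enc (map v js)) (\<Pi>\<^sub>E j\<in>J. UNIV)"
  proof (rule inj_onI)
    fix u v :: "'j \<Rightarrow> 'v"
    assume "u \<in> (\<Pi>\<^sub>E j\<in>J. UNIV)" "v \<in> (\<Pi>\<^sub>E j\<in>J. UNIV)" "enc (map u js) = enc (map v js)"
    then show "u = v"
      using js by (intro PiE_ext[of u J "\<lambda>_. UNIV" v]) (auto dest: injD[OF enc])
  qed
  then show ?thesis by blast
qed

section \<open>Full corners\<close>

text \<open>
  In the idempotent completion of \<open>D\<close>, \<open>emb\<close> identifies \<open>C\<close> with the full subcategory of the
  objects \<open>(img c, emb c c (Idt C c))\<close>, and \<open>proj\<close> and \<open>incl\<close> exhibit every object \<open>X\<close> of \<open>D\<close> as a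
  retract of the direct sum of the objects belonging to \<open>summand X i\<close>. For algebras this is the
  passage from \<open>D\<close> to \<open>eDe\<close> for an idempotent \<open>e\<close> with \<open>DeD = D\<close>.
\<close>

locale full_corner = C: k_category K C + D: k_category K D
  for K :: "('k, 'r) ring_scheme" and C :: "('k, 'o, 'm) kcat" and D :: "('k, 'p, 'n) kcat" +
  fixes img :: "'o \<Rightarrow> 'p" and emb :: "'o \<Rightarrow> 'o \<Rightarrow> 'm \<Rightarrow> 'n" and J :: "'p \<Rightarrow> 'j set"
    and summand :: "'p \<Rightarrow> 'j \<Rightarrow> 'o" and proj :: "'p \<Rightarrow> 'j \<Rightarrow> 'n" and incl :: "'p \<Rightarrow> 'j \<Rightarrow> 'n"
  assumes img_closed: "c \<in> Obj C \<Longrightarrow> img c \<in> Obj D"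
    and emb_linear: "\<lbrakk>c \<in> Obj C; c' \<in> Obj C\<rbrakk>
      \<Longrightarrow> emb c' c \<in> linear_maps K (Mor C c' c) (Mor D (img c') (img c))"
    and emb_Cmp: "\<lbrakk>c \<in> Obj C; c' \<in> Obj C; c'' \<in> Obj C; g \<in> carrier (Mor C c'' c');
        f \<in> carrier (Mor C c' c)\<rbrakk>
      \<Longrightarrow> emb c'' c (Cmp C c'' c' c g f) =
          Cmp D (img c'') (img c') (img c) (emb c'' c' g) (emb c' c f)"
    and emb_inj: "\<lbrakk>c \<in> Obj C; c' \<in> Obj C\<rbrakk> \<Longrightarrow> inj_on (emb c' c) (carrier (Mor C c' c))"
    and emb_full: "\<lbrakk>c \<in> Obj C; c' \<in> Obj C; h \<in> carrier (Mor D (img c') (img c));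
        Cmp D (img c') (img c') (img c) (emb c' c' (Idt C c')) h = h;
        Cmp D (img c') (img c) (img c) h (emb c c (Idt C c)) = h\<rbrakk>
      \<Longrightarrow> h \<in> emb c' c ` carrier (Mor C c' c)"
    and finite_J: "X \<in> Obj D \<Longrightarrow> finite (J X)"
    and summand_closed: "\<lbrakk>X \<in> Obj D; i \<in> J X\<rbrakk> \<Longrightarrow> summand X i \<in> Obj C"
    and proj_closed: "\<lbrakk>X \<in> Obj D; i \<in> J X\<rbrakk> \<Longrightarrow> proj X i \<in> carrier (Mor D (img (summand X i)) X)"
    and incl_closed: "\<lbrakk>X \<in> Obj D; i \<in> J X\<rbrakk> \<Longrightarrow> incl X i \<in> carrier (Mor D X (img (summand X i)))"
    and idem_proj: "\<lbrakk>X \<in> Obj D; i \<in> J X\<rbrakk>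
      \<Longrightarrow> Cmp D (img (summand X i)) (img (summand X i)) X
            (emb (summand X i) (summand X i) (Idt C (summand X i))) (proj X i) = proj X i"
    and incl_idem: "\<lbrakk>X \<in> Obj D; i \<in> J X\<rbrakk>
      \<Longrightarrow> Cmp D X (img (summand X i)) (img (summand X i)) (incl X i)
            (emb (summand X i) (summand X i) (Idt C (summand X i))) = incl X i"
    and sum_incl_proj: "X \<in> Obj D
      \<Longrightarrow> (\<Oplus>\<^bsub>Mor D X X\<^esub>i\<in>J X. Cmp D X (img (summand X i)) X (incl X i) (proj X i)) = Idt D X"
begin

abbreviation idem :: "'o \<Rightarrow> 'n" where
  "idem c \<equiv> emb c c (Idt C c)"

abbreviation summand_img :: "'p \<Rightarrow> 'j \<Rightarrow> 'p" where
  "summand_img X i \<equiv> img (summand X i)"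

lemma emb_closed:
  "\<lbrakk>c \<in> Obj C; c' \<in> Obj C; f \<in> carrier (Mor C c' c)\<rbrakk>
      \<Longrightarrow> emb c' c f \<in> carrier (Mor D (img c') (img c))"
  by (rule linear_maps_closed[OF emb_linear])

lemma
  assumes "c \<in> Obj C" "c' \<in> Obj C" "f \<in> carrier (Mor C c' c)"
  shows idem_emb: "Cmp D (img c') (img c') (img c) (idem c') (emb c' c f) = emb c' c f"
    and emb_idem: "Cmp D (img c') (img c) (img c) (emb c' c f) (idem c) = emb c' c f"
  using assms
  by (simp_all add: emb_Cmp[symmetric] C.Idt_closed C.Idt_left C.Idt_right)

lemmas [simp] = img_closed emb_closed idem_emb emb_idem finite_J summand_closed
  proj_closed incl_closed idem_proj incl_idem C.Idt_closed D.Idt_closed C.Cmp_closed D.Cmp_closed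

definition corner_space :: "('k, 'p, 'n, 'v) cat_module \<Rightarrow> 'o \<Rightarrow> ('k, 'v) module" where
  "corner_space M c = (FObj M (img c))
     \<lparr>carrier := {v \<in> carrier (FObj M (img c)). FMor M (img c) (img c) (idem c) v = v}\<rparr>"

definition corner_module :: "('k, 'p, 'n, 'v) cat_module \<Rightarrow> ('k, 'o, 'm, 'v) cat_module" where
  "corner_module M = \<lparr>FObj = corner_space M,
     FMor = (\<lambda>c' c f. restrict (FMor M (img c') (img c) (emb c' c f))
         (carrier (corner_space M c)))\<rparr>"

lemma mem_corner_space:
  "v \<in> carrier (corner_space M c)
    \<longleftrightarrow> v \<in> carrier (FObj M (img c)) \<and> FMor M (img c) (img c) (idem c) v = v"
  by (simp add: corner_space_def)

lemma
  assumes "v \<in> carrier (corner_space M c)"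
  shows corner_space_closed: "v \<in> carrier (FObj M (img c))"
    and corner_space_fixed: "FMor M (img c) (img c) (idem c) v = v"
  using assms by (simp_all add: mem_corner_space)

lemma linear_maps_into_corner_space:
  "f \<in> linear_maps K V (corner_space M c) \<longleftrightarrow> f \<in> linear_maps K V (FObj M (img c)) \<and>
    (\<forall>v\<in>carrier V. FMor M (img c) (img c) (idem c) (f v) = f v)"
  by (auto simp: linear_maps_def corner_space_def)

lemma linear_maps_from_corner_space:
  "f \<in> linear_maps K (FObj M (img c)) W \<Longrightarrow> f \<in> linear_maps K (corner_space M c) W"
  by (auto simp: linear_maps_def corner_space_def)

lemma
  shows FObj_corner_module: "FObj (corner_module M) = corner_space M"
    and FMor_corner_module: "FMor (corner_module M) c' c f =
      restrict (FMor M (img c') (img c) (emb c' c f)) (carrier (corner_space M c))"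
  by (simp_all add: corner_module_def)

context
  fixes M :: "('k, 'p, 'n, 'v) cat_module"
  assumes M: "left_module K D M"
begin

interpretation M: left_module K D M
  by (rule M)

lemma act_in_corner_space:
  assumes "c \<in> Obj C" "X \<in> Obj D" "h \<in> carrier (Mor D (img c) X)"
    and "Cmp D (img c) (img c) X (idem c) h = h" "v \<in> carrier (FObj M X)"
  shows "FMor M (img c) X h v \<in> carrier (corner_space M c)"
  using assms by (simp add: mem_corner_space M.act_closed M.act_Cmp[symmetric])

lemma module_corner_space:
  assumes "c \<in> Obj C"
  shows "module K (corner_space M c)"
proof -
  have space: "module K (FObj M (img c))"
    using assms by (simp add: M.space_module)
  have "submodule {v \<in> carrier (FObj M (img c)). FMor M (img c) (img c) (idem c) v = v} K
      (FObj M (img c))"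
    using assms by (intro submodule_equalizer[OF M.act_linear linear_maps_id space space]) simp_all
  then show ?thesis
    unfolding corner_space_def using space by (rule submodule.submodule_is_module)
qed

lemma left_module_corner_module: "left_module K C (corner_module M)"
proof (rule left_moduleI)
  fix c c' f v
  assume c: "c \<in> Obj C" "c' \<in> Obj C"
  show "FMor (corner_module M) c' c f \<in> linear_maps K (FObj (corner_module M) c)
      (FObj (corner_module M) c')" if f: "f \<in> carrier (Mor C c' c)"
  proof -
    have "FMor M (img c') (img c) (emb c' c f)
        \<in> linear_maps K (corner_space M c) (corner_space M c')"
      using c f by (simp add: linear_maps_into_corner_space linear_maps_from_corner_space
          M.act_linear
          M.act_Cmp[symmetric] mem_corner_space)
    then show ?thesis
      unfolding FObj_corner_module FMor_corner_module
      by (rule linear_maps_restrict[OF _ module_corner_space[OF c(1)]])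
  qed
  show "(\<lambda>f. FMor (corner_module M) c' c f v) \<in> linear_maps K (Mor C c' c)
      (FObj (corner_module M) c')"
    if v: "v \<in> carrier (FObj (corner_module M) c)"
  proof -
    have "v \<in> carrier (FObj M (img c))"
      using v by (simp add: FObj_corner_module mem_corner_space)
    then have "(\<lambda>f. FMor M (img c') (img c) (emb c' c f) v)
        \<in> linear_maps K (Mor C c' c) (corner_space M c')"
      using c linear_maps_comp[OF emb_linear M.act_linear_Mor, of c c' v]
      by (simp add: linear_maps_into_corner_space M.act_Cmp[symmetric])
    then show ?thesis
      using v by (simp add: FObj_corner_module FMor_corner_module)
  qed
qed (simp_all add: FObj_corner_module FMor_corner_module C.k_category_axioms module_corner_space
    corner_space_closed corner_space_fixed emb_Cmp M.act_Cmp act_in_corner_space)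

lemma act_linear_into_corner_space:
  assumes c: "c \<in> Obj C" and X: "X \<in> Obj D" and v: "v \<in> carrier (FObj M X)"
    and h: "h \<in> carrier (Mor D (img c) X)" and idem_h: "Cmp D (img c) (img c) X (idem c) h = h"
  shows "(\<lambda>g. FMor M (img c) X (Cmp D (img c) X X h g) v)
    \<in> linear_maps K (Mor D X X) (corner_space M c)"
  unfolding linear_maps_into_corner_space
proof
  show "(\<lambda>g. FMor M (img c) X (Cmp D (img c) X X h g) v)
      \<in> linear_maps K (Mor D X X) (FObj M (img c))"
    by (rule linear_maps_comp[OF D.Cmp_linear_right M.act_linear_Mor]) (use c X v h in simp_all)
qed (use c X v h in \<open>simp add: M.act_Cmp[symmetric] D.Cmp_assoc[symmetric] idem_h\<close>)

lemma sum_incl_proj_act: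
  assumes X: "X \<in> Obj D" and v: "v \<in> carrier (FObj M X)"
  shows "(\<Oplus>\<^bsub>FObj M X\<^esub>i\<in>J X. FMor M X (summand_img X i) (incl X i)
    (FMor M (summand_img X i) X (proj X i) v)) = v"
proof -
  have "(\<Oplus>\<^bsub>FObj M X\<^esub>i\<in>J X. FMor M X (summand_img X i) (incl X i)
      (FMor M (summand_img X i) X (proj X i) v)) =
    (\<Oplus>\<^bsub>FObj M X\<^esub>i\<in>J X. FMor M X X (Cmp D X (summand_img X i) X (incl X i) (proj X i)) v)"
    using X v by (intro module_finsum_cong[OF M.space_module])
        (simp_all add: M.act_Cmp M.act_closed)
  also have "\<dots> = FMor M X X (\<Oplus>\<^bsub>Mor D X X\<^esub>i\<in>J X. Cmp D X (summand_img X i) X (incl X i) (proj X i)) v"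
    using X v by (intro M.act_finsum_Mor[symmetric]) simp_all
  finally show ?thesis
    using X v by (simp add: sum_incl_proj M.act_Idt)
qed

end

definition corner_functor ::
    "(('k, 'p, 'n, 'v) cat_module, 'p \<Rightarrow> 'v \<Rightarrow> 'v, ('k, 'o, 'm, 'v) cat_module, 'o \<Rightarrow> 'v \<Rightarrow> 'v) kfun" where
  "corner_functor = \<lparr>FObj = corner_module,
     FMor = (\<lambda>N M \<tau>. \<lambda>c\<in>Obj C. restrict (\<tau> (img c)) (carrier (corner_space M c)))\<rparr>"

lemma
  shows FObj_corner_functor: "FObj corner_functor = corner_module"
    and FMor_corner_functor: "FMor corner_functor N M \<tau> =
      (\<lambda>c\<in>Obj C. restrict (\<tau> (img c)) (carrier (corner_space M c)))"
  by (simp_all add: corner_functor_def)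

lemma module_homs_corner_functor:
  assumes M: "left_module K D M" and \<tau>: "\<tau> \<in> module_homs K D M N"
  shows "FMor corner_functor N M \<tau> \<in> module_homs K C (corner_module M) (corner_module N)"
proof -
  interpret M: left_module K D M by (rule M)
  note linear = module_homs_linear[OF \<tau> img_closed]
  have corner_linear: "\<tau> (img c) \<in> linear_maps K (corner_space M c) (corner_space N c)"
    if "c \<in> Obj C" for c
    using that by (simp add: linear_maps_into_corner_space linear_maps_from_corner_space linear
        module_homs_natural[OF \<tau>, symmetric] mem_corner_space)
  show ?thesis
    by (simp add: module_homs_iff FObj_corner_module FMor_corner_module FMor_corner_functor
        linear_maps_restrict corner_linear linear_maps_closed[OF corner_linear] corner_space_closed
        module_corner_space[OF M] act_in_corner_space[OF M] module_homs_natural[OF \<tau>])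
qed

lemma k_functor_corner_functor:
  "k_functor K (left_modules K D) (left_modules K C)
    (corner_functor :: (('k, 'p, 'n, 'v) cat_module, 'p \<Rightarrow> 'v \<Rightarrow> 'v,
      ('k, 'o, 'm, 'v) cat_module, 'o \<Rightarrow> 'v \<Rightarrow> 'v) kfun)"
proof (rule k_functorI, unfold Obj_left_modules[OF D.k_category_axioms]
    Obj_left_modules[OF C.k_category_axioms] carrier_Mor_left_modules mem_Collect_eq)
  fix L M N :: "('k, 'p, 'n, 'v) cat_module"
  assume modules: "left_module K D L" "left_module K D M" "left_module K D N"
  have ops: "u \<oplus>\<^bsub>corner_space P c\<^esub> v = u \<oplus>\<^bsub>FObj P (img c)\<^esub> v"
    "a \<odot>\<^bsub>corner_space P c\<^esub> v = a \<odot>\<^bsub>FObj P (img c)\<^esub> v"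
    for P :: "('k, 'p, 'n, 'v) cat_module" and c u v a
    by (simp_all add: corner_space_def)
  note [simp] = FObj_corner_functor FMor_corner_functor FObj_corner_module corner_space_closed
  show "left_module K C (FObj corner_functor L)"
    using modules by (simp add: left_module_corner_module)
  show "FMor corner_functor M L \<in> linear_maps K (Mor (left_modules K D) M L)
      (Mor (left_modules K C) (FObj corner_functor M) (FObj corner_functor L))"
    using module_homs_corner_functor[OF modules(1), of _ M]
    by (intro linear_mapsI) (simp_all add: carrier_Mor_left_modules add_left_modules
        smult_left_modules
        ops cong: restrict_cong)
  show "FMor corner_functor L L (Idt (left_modules K D) L) =
      Idt (left_modules K C) (FObj corner_functor L)"
    by (simp add: Idt_left_modules cong: restrict_cong)
  fix \<sigma> \<tau> assume "\<sigma> \<in> module_homs K D M N" and \<tau>: "\<tau> \<in> module_homs K D L M"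
  have "\<tau> (img c) v \<in> carrier (corner_space M c)" if "c \<in> Obj C" "v \<in> carrier (corner_space L c)"
      for c v
    using module_homs_closed[OF module_homs_corner_functor[OF modules(1) \<tau>] that(1), of v] that
        by simp
  then show "FMor corner_functor N L (Cmp (left_modules K D) N M L \<sigma> \<tau>) =
      Cmp (left_modules K C) (FObj corner_functor N) (FObj corner_functor M) (FObj corner_functor L)
        (FMor corner_functor N M \<sigma>) (FMor corner_functor M L \<tau>)"
    by (simp add: Cmp_left_modules compose_def cong: restrict_cong)
qed

definition extension ::
    "('k, 'p, 'n, 'v) cat_module \<Rightarrow> ('k, 'p, 'n, 'v) cat_module \<Rightarrow> ('o \<Rightarrow> 'v \<Rightarrow> 'v) \<Rightarrow> 'p \<Rightarrow> 'v \<Rightarrow> 'v" where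
  "extension N M \<sigma> = (\<lambda>X\<in>Obj D. \<lambda>v\<in>carrier (FObj M X).
     \<Oplus>\<^bsub>FObj N X\<^esub>i\<in>J X. FMor N X (summand_img X i) (incl X i)
       (\<sigma> (summand X i) (FMor M (summand_img X i) X (proj X i) v)))"

context
  fixes M N :: "('k, 'p, 'n, 'v) cat_module"
  assumes M: "left_module K D M" and N: "left_module K D N"
begin

interpretation M: left_module K D M
  by (rule M)

interpretation N: left_module K D N
  by (rule N)

lemma extension_corner_functor:
  assumes \<tau>: "\<tau> \<in> module_homs K D M N"
  shows "extension N M (FMor corner_functor N M \<tau>) = \<tau>"
proof (rule extensionalityI[of _ "Obj D"])
  fix X assume X: "X \<in> Obj D"
  show "extension N M (FMor corner_functor N M \<tau>) X = \<tau> X"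
  proof (rule extensionalityI[OF _ module_homs_extensional[OF \<tau> X]])
    fix v assume v: "v \<in> carrier (FObj M X)"
    have "extension N M (FMor corner_functor N M \<tau>) X v =
      (\<Oplus>\<^bsub>FObj N X\<^esub>i\<in>J X. FMor N X (summand_img X i) (incl X i)
        (FMor N (summand_img X i) X (proj X i) (\<tau> X v)))"
      using X v unfolding extension_def FMor_corner_functor
      by (simp, intro module_finsum_cong[OF N.space_module])
        (simp_all add: act_in_corner_space[OF M] module_homs_natural[OF \<tau>] N.act_closed
          module_homs_closed[OF \<tau>])
    also have "\<dots> = \<tau> X v"
      using X v by (intro sum_incl_proj_act[OF N] module_homs_closed[OF \<tau>])
    finally show "extension N M (FMor corner_functor N M \<tau>) X v = \<tau> X v" .
  qed (simp add: extension_def X)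
qed (simp_all add: extension_def natural_transformations_extensional[OF \<tau>])

context
  fixes \<sigma>
  assumes \<sigma>: "\<sigma> \<in> module_homs K C (corner_module M) (corner_module N)"
begin

lemma corner_hom_linear:
  "c \<in> Obj C \<Longrightarrow> \<sigma> c \<in> linear_maps K (corner_space M c) (FObj N (img c))"
  using module_homs_linear[OF \<sigma>] by (simp add: FObj_corner_module linear_maps_into_corner_space)

lemma corner_hom_closed:
  "\<lbrakk>c \<in> Obj C; v \<in> carrier (corner_space M c)\<rbrakk> \<Longrightarrow> \<sigma> c v \<in> carrier (corner_space N c)"
  using module_homs_closed[OF \<sigma>] by (simp add: FObj_corner_module)

lemma corner_hom_natural:
  assumes c: "c \<in> Obj C" "c' \<in> Obj C" and v: "v \<in> carrier (corner_space M c)"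
    and h: "h \<in> carrier (Mor D (img c') (img c))" "Cmp D (img c') (img c') (img c) (idem c') h = h"
      "Cmp D (img c') (img c) (img c) h (idem c) = h"
  shows "\<sigma> c' (FMor M (img c') (img c) h v) = FMor N (img c') (img c) h (\<sigma> c v)"
proof -
  obtain f where "f \<in> carrier (Mor C c' c)" "h = emb c' c f"
    using emb_full[OF c h] by blast
  then show ?thesis
    using module_homs_natural[OF \<sigma> c, of f v] c v corner_hom_closed
    by (simp add: FObj_corner_module FMor_corner_module)
qed

text \<open>Since \<open>\<sigma>\<close> commutes with \<open>h\<close> composed with \<open>incl X i\<close>, both sides agree after inserting the
  decomposition of \<open>Idt D X\<close>.\<close>

lemma act_extension:
  assumes c: "c \<in> Obj C" and X: "X \<in> Obj D" and v: "v \<in> carrier (FObj M X)"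
    and h: "h \<in> carrier (Mor D (img c) X)" and idem_h: "Cmp D (img c) (img c) X (idem c) h = h"
  shows "FMor N (img c) X h (extension N M \<sigma> X v) = \<sigma> c (FMor M (img c) X h v)"
proof -
  define \<Phi> where "\<Phi> = (\<lambda>g. \<sigma> c (FMor M (img c) X (Cmp D (img c) X X h g) v))"
  have \<Phi>_linear: "\<Phi> \<in> linear_maps K (Mor D X X) (FObj N (img c))"
    unfolding \<Phi>_def
    by (rule linear_maps_comp[OF act_linear_into_corner_space[OF M assms] corner_hom_linear[OF c]])
  have term_eq: "FMor N (img c) X h (FMor N X (summand_img X i) (incl X i)
      (\<sigma> (summand X i) (FMor M (summand_img X i) X (proj X i) v)))
    = \<Phi> (Cmp D X (summand_img X i) X (incl X i) (proj X i))" (is "?t i = _") if i: "i \<in> J X" for i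
  proof -
    let ?h = "Cmp D (img c) X (summand_img X i) h (incl X i)"
    have proj_v: "FMor M (summand_img X i) X (proj X i) v \<in> carrier (corner_space M (summand X i))"
      using X v i by (intro act_in_corner_space[OF M]) simp_all
    have "?t i = FMor N (img c) (summand_img X i) ?h
        (\<sigma> (summand X i) (FMor M (summand_img X i) X (proj X i) v))"
      using c X h i corner_hom_closed[OF _ proj_v] by (simp add: N.act_Cmp mem_corner_space)
    also have "\<dots> = \<sigma> c (FMor M (img c) (summand_img X i) ?h
        (FMor M (summand_img X i) X (proj X i) v))"
      using c X h i proj_v idem_h
      by (intro corner_hom_natural[symmetric])
          (simp_all add: D.Cmp_assoc, simp add: D.Cmp_assoc[symmetric])
    also have "\<dots> = \<Phi> (Cmp D X (summand_img X i) X (incl X i) (proj X i))"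
      using c X v h i idem_h by (simp add: \<Phi>_def M.act_Cmp[symmetric] D.Cmp_assoc[symmetric])
    finally show ?thesis .
  qed
  have "FMor N (img c) X h (extension N M \<sigma> X v) = (\<Oplus>\<^bsub>FObj N (img c)\<^esub>i\<in>J X. ?t i)"
    using c X v h unfolding extension_def by (simp, intro N.act_finsum)
      (simp_all add: N.act_closed corner_space_closed corner_hom_closed act_in_corner_space[OF M])
  also have "\<dots> = (\<Oplus>\<^bsub>FObj N (img c)\<^esub>i\<in>J X. \<Phi> (Cmp D X (summand_img X i) X (incl X i) (proj X i)))"
    using c X by (intro module_finsum_cong[OF N.space_module])
      (simp_all add: term_eq linear_maps_closed[OF \<Phi>_linear])
  also have "\<dots> = \<Phi> (Idt D X)"
    using c X by (subst sum_incl_proj[symmetric], simp)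
      (rule linear_maps_finsum[OF \<Phi>_linear D.Mor_module N.space_module, symmetric], simp_all)
  finally show ?thesis
    using c X h idem_h by (simp add: \<Phi>_def D.Idt_right)
qed

lemma extension_linear:
  assumes X: "X \<in> Obj D"
  shows "extension N M \<sigma> X \<in> linear_maps K (FObj M X) (FObj N X)"
proof -
  have proj: "FMor M (summand_img X i) X (proj X i)
      \<in> linear_maps K (FObj M X) (corner_space M (summand X i))" if "i \<in> J X" for i
    using X that by (simp add: linear_maps_into_corner_space M.act_linear M.act_Cmp[symmetric])
  have "(\<lambda>v. \<Oplus>\<^bsub>FObj N X\<^esub>i\<in>J X. FMor N X (summand_img X i) (incl X i)
      (\<sigma> (summand X i) (FMor M (summand_img X i) X (proj X i) v)))
    \<in> linear_maps K (FObj M X) (FObj N X)"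
    using X by (intro linear_maps_pointwise_finsum N.space_module finite_J
        linear_maps_comp[OF linear_maps_comp[OF proj corner_hom_linear] N.act_linear]) simp_all
  then show ?thesis
    using X by (simp add: extension_def linear_maps_restrict M.space_module)
qed

lemma extension_natural:
  assumes XY: "X \<in> Obj D" "Y \<in> Obj D" and f: "f \<in> carrier (Mor D Y X)"
    and v: "v \<in> carrier (FObj M X)"
  shows "extension N M \<sigma> Y (FMor M Y X f v) = FMor N Y X f (extension N M \<sigma> X v)"
proof -
  note closed = linear_maps_closed[OF extension_linear[OF XY(1)] v]
  have "extension N M \<sigma> Y (FMor M Y X f v) =
    (\<Oplus>\<^bsub>FObj N Y\<^esub>j\<in>J Y. FMor N Y (summand_img Y j) (incl Y j)
      (\<sigma> (summand Y j) (FMor M (summand_img Y j) X (Cmp D (summand_img Y j) Y X (proj Y j) f) v)))"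
    using XY f v
    by (simp add: extension_def M.act_closed, intro module_finsum_cong[OF N.space_module])
      (simp_all add: M.act_Cmp N.act_closed corner_space_closed corner_hom_closed
        act_in_corner_space[OF M] M.act_closed)
  also have "\<dots> = (\<Oplus>\<^bsub>FObj N Y\<^esub>j\<in>J Y. FMor N Y (summand_img Y j) (incl Y j)
      (FMor N (summand_img Y j) Y (proj Y j) (FMor N Y X f (extension N M \<sigma> X v))))"
    using XY f v closed by (intro module_finsum_cong[OF N.space_module])
      (simp_all add: act_extension[symmetric] D.Cmp_assoc[symmetric] N.act_Cmp N.act_closed)
  also have "\<dots> = FMor N Y X f (extension N M \<sigma> X v)"
    using XY f closed by (intro sum_incl_proj_act[OF N] N.act_closed)
  finally show ?thesis .
qed

lemma extension_hom: "extension N M \<sigma> \<in> module_homs K D M N"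
  unfolding module_homs_iff using extension_linear extension_natural by (simp add: extension_def)

lemma corner_functor_extension: "FMor corner_functor N M (extension N M \<sigma>) = \<sigma>"
proof (rule module_homs_eqI[OF module_homs_corner_functor[OF M extension_hom] \<sigma>])
  fix c v assume c: "c \<in> Obj C" and v: "v \<in> carrier (FObj (corner_module M) c)"
  have v': "v \<in> carrier (FObj M (img c))" "FMor M (img c) (img c) (idem c) v = v"
    using v by (simp_all add: FObj_corner_module mem_corner_space)
  have "extension N M \<sigma> (img c) v = FMor N (img c) (img c) (idem c) (extension N M \<sigma> (img c) v)"
    using c v' by (subst extension_natural[symmetric]) simp_all
  also have "\<dots> = \<sigma> c v"
    using c v' by (simp add: act_extension)
  finally show "FMor corner_functor N M (extension N M \<sigma>) c v = \<sigma> c v"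
    using c v by (simp add: FMor_corner_functor FObj_corner_module)
qed

end

lemma corner_functor_fully_faithful:
  "bij_betw (FMor corner_functor N M) (module_homs K D M N)
    (module_homs K C (corner_module M) (corner_module N))"
  by (rule bij_betwI[where g = "extension N M"])
    (simp_all add: module_homs_corner_functor[OF M] extension_hom extension_corner_functor
      corner_functor_extension)

end

end

section \<open>Induced modules\<close>

context full_corner
begin

definition into_corner :: "'o \<Rightarrow> 'p \<Rightarrow> 'n set" where
  "into_corner c X = {h \<in> carrier (Mor D (img c) X). Cmp D (img c) (img c) X (idem c) h = h}"

definition out_of_corner :: "'p \<Rightarrow> 'o \<Rightarrow> 'n set" where
  "out_of_corner X c = {h \<in> carrier (Mor D X (img c)). Cmp D X (img c) (img c) h (idem c) = h}"

lemma
  assumes "X \<in> Obj D" "i \<in> J X"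
  shows proj_into_corner: "proj X i \<in> into_corner (summand X i) X"
    and incl_out_of_corner: "incl X i \<in> out_of_corner X (summand X i)"
  using assms by (simp_all add: into_corner_def out_of_corner_def)

lemma idem_out_of_corner: "c \<in> Obj C \<Longrightarrow> idem c \<in> out_of_corner (img c) c"
  and idem_into_corner: "c \<in> Obj C \<Longrightarrow> idem c \<in> into_corner c (img c)"
  by (simp_all add: into_corner_def out_of_corner_def)

lemma
  assumes "c \<in> Obj C" "X \<in> Obj D" "Y \<in> Obj D" "f \<in> carrier (Mor D Y X)"
  shows Cmp_into_corner: "h \<in> into_corner c Y \<Longrightarrow> Cmp D (img c) Y X h f \<in> into_corner c X"
    and Cmp_out_of_corner: "h \<in> out_of_corner X c \<Longrightarrow> Cmp D Y X (img c) f h \<in> out_of_corner Y c"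
proof -
  show "Cmp D (img c) Y X h f \<in> into_corner c X" if "h \<in> into_corner c Y"
    using assms that by (simp add: into_corner_def D.Cmp_assoc[symmetric])
  show "Cmp D Y X (img c) f h \<in> out_of_corner Y c" if "h \<in> out_of_corner X c"
    using assms that by (simp add: out_of_corner_def D.Cmp_assoc)
qed

lemma
  shows into_cornerD: "h \<in> into_corner c X \<Longrightarrow> h \<in> carrier (Mor D (img c) X)"
    and out_of_cornerD: "h \<in> out_of_corner X c \<Longrightarrow> h \<in> carrier (Mor D X (img c))"
  by (simp_all add: into_corner_def out_of_corner_def)

definition lower :: "'o \<Rightarrow> 'o \<Rightarrow> 'n \<Rightarrow> 'm" where
  "lower c' c = inv_into (carrier (Mor C c' c)) (emb c' c)"

lemma lower_emb:
  "\<lbrakk>c \<in> Obj C; c' \<in> Obj C; f \<in> carrier (Mor C c' c)\<rbrakk> \<Longrightarrow> lower c' c (emb c' c f) = f"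
  unfolding lower_def by (rule inv_into_f_f[OF emb_inj])

context
  fixes c c' X
  assumes c: "c \<in> Obj C" and c': "c' \<in> Obj C" and X: "X \<in> Obj D"
begin

lemma Cmp_in_emb_image:
  assumes "a \<in> into_corner c' X" "b \<in> out_of_corner X c"
  shows "Cmp D (img c') X (img c) a b \<in> emb c' c ` carrier (Mor C c' c)"
  using assms c c' X
  by (intro emb_full) (simp_all add: into_corner_def out_of_corner_def D.Cmp_assoc,
      simp add: D.Cmp_assoc[symmetric])

lemma
  assumes "a \<in> into_corner c' X" "b \<in> out_of_corner X c"
  shows lower_closed: "lower c' c (Cmp D (img c') X (img c) a b) \<in> carrier (Mor C c' c)"
    and emb_lower: "emb c' c (lower c' c (Cmp D (img c') X (img c) a b)) =
        Cmp D (img c') X (img c) a b"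
  using Cmp_in_emb_image[OF assms] unfolding lower_def
  by (auto intro: inv_into_into f_inv_into_f)

lemma lower_Cmp_linear:
  assumes a: "a \<in> into_corner c' X" and h: "h \<in> linear_maps K V (Mor D X (img c))"
    and V: "module K V"
    and range: "\<And>v. v \<in> carrier V \<Longrightarrow> h v \<in> out_of_corner X c"
  shows "(\<lambda>v. lower c' c (Cmp D (img c') X (img c) a (h v))) \<in> linear_maps K V (Mor C c' c)"
proof -
  have "(\<lambda>v. Cmp D (img c') X (img c) a (h v)) \<in> linear_maps K V (Mor D (img c') (img c))"
    using c c' X into_cornerD[OF a] by (intro linear_maps_comp[OF h D.Cmp_linear_right]) simp_all
  then show ?thesis
    unfolding lower_def using c c' X a range
    by (intro linear_maps_lift[OF V C.Mor_module emb_linear emb_inj] Cmp_in_emb_image)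
qed

end

lemma lower_Cmp_emb:
  assumes "c \<in> Obj C" "c' \<in> Obj C" "c'' \<in> Obj C" "X \<in> Obj D"
    and a: "a \<in> into_corner c'' X" and b: "b \<in> out_of_corner X c'" and f: "f \<in> carrier (Mor C c' c)"
  shows "lower c'' c (Cmp D (img c'') X (img c) a (Cmp D X (img c') (img c) b (emb c' c f))) =
    Cmp C c'' c' c (lower c'' c' (Cmp D (img c'') X (img c') a b)) f"
proof -
  have "Cmp D (img c'') X (img c) a (Cmp D X (img c') (img c) b (emb c' c f)) =
    emb c'' c (Cmp C c'' c' c (lower c'' c' (Cmp D (img c'') X (img c') a b)) f)"
    using assms
    by (simp add: emb_Cmp emb_lower lower_closed D.Cmp_assoc into_cornerD out_of_cornerD)
  then show ?thesis
    using assms by (simp add: lower_emb lower_closed)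
qed

lemma lower_factor:
  assumes c: "c \<in> Obj C" "c' \<in> Obj C" and Y: "Y \<in> Obj D"
    and a: "a \<in> into_corner c' Y" and b: "b \<in> out_of_corner Y c"
  shows "lower c' c (Cmp D (img c') Y (img c) a b) =
    (\<Oplus>\<^bsub>Mor C c' c\<^esub>j\<in>J Y. Cmp C c' (summand Y j) c
      (lower c' (summand Y j) (Cmp D (img c') Y (summand_img Y j) a (incl Y j)))
      (lower (summand Y j) c (Cmp D (summand_img Y j) Y (img c) (proj Y j) b)))"
proof -
  define \<Psi> where
    "\<Psi> = (\<lambda>g. lower c' c (Cmp D (img c') Y (img c) a (Cmp D Y Y (img c) g b)))"
  have \<Psi>_linear: "\<Psi> \<in> linear_maps K (Mor D Y Y) (Mor C c' c)"
    unfolding \<Psi>_def using c Y b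
    by (intro lower_Cmp_linear a D.Cmp_linear_left D.Mor_module Cmp_out_of_corner)
      (simp_all add: out_of_cornerD)
  have \<Psi>_term: "\<Psi> (Cmp D Y (summand_img Y j) Y (incl Y j) (proj Y j)) =
    Cmp C c' (summand Y j) c
      (lower c' (summand Y j) (Cmp D (img c') Y (summand_img Y j) a (incl Y j)))
      (lower (summand Y j) c (Cmp D (summand_img Y j) Y (img c) (proj Y j) b))"
    if j: "j \<in> J Y" for j
  proof -
    have "Cmp D Y Y (img c) (Cmp D Y (summand_img Y j) Y (incl Y j) (proj Y j)) b =
      Cmp D Y (summand_img Y j) (img c) (incl Y j) (emb (summand Y j) c
        (lower (summand Y j) c (Cmp D (summand_img Y j) Y (img c) (proj Y j) b)))"
      using c Y b j by (simp add: emb_lower proj_into_corner D.Cmp_assoc out_of_cornerD)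
    then show ?thesis
      using c Y a b j
      by (simp add: \<Psi>_def lower_Cmp_emb incl_out_of_corner lower_closed proj_into_corner)
  qed
  have "lower c' c (Cmp D (img c') Y (img c) a b) = \<Psi> (Idt D Y)"
    using c Y b by (simp add: \<Psi>_def D.Idt_left out_of_cornerD)
  also have "\<dots> = (\<Oplus>\<^bsub>Mor C c' c\<^esub>j\<in>J Y. \<Psi> (Cmp D Y (summand_img Y j) Y (incl Y j) (proj Y j)))"
    using c Y by (subst sum_incl_proj[symmetric], simp)
      (rule linear_maps_finsum[OF \<Psi>_linear D.Mor_module C.Mor_module], simp_all)
  also have "\<dots> = (\<Oplus>\<^bsub>Mor C c' c\<^esub>j\<in>J Y. Cmp C c' (summand Y j) c
      (lower c' (summand Y j) (Cmp D (img c') Y (summand_img Y j) a (incl Y j)))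
      (lower (summand Y j) c (Cmp D (summand_img Y j) Y (img c) (proj Y j) b)))"
    using c Y a b by (intro C.Mor_finsum_cong)
      (simp_all add: \<Psi>_term lower_closed incl_out_of_corner proj_into_corner)
  finally show ?thesis .
qed

definition coefficient :: "'p \<Rightarrow> 'p \<Rightarrow> 'j \<Rightarrow> 'j \<Rightarrow> 'n \<Rightarrow> 'm" where
  "coefficient Y X j i f = lower (summand Y j) (summand X i)
     (Cmp D (summand_img Y j) Y (summand_img X i) (proj Y j)
         (Cmp D Y X (summand_img X i) f (incl X i)))"

context
  fixes X Y
  assumes X: "X \<in> Obj D" and Y: "Y \<in> Obj D"
begin

lemma coefficient_linear:
  assumes "i \<in> J X" "j \<in> J Y"
  shows "coefficient Y X j i \<in> linear_maps K (Mor D Y X) (Mor C (summand Y j) (summand X i))"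
  unfolding coefficient_def[abs_def] using assms X Y
  by (intro lower_Cmp_linear D.Cmp_linear_left D.Mor_module)
    (simp_all add: proj_into_corner Cmp_out_of_corner incl_out_of_corner)

lemma coefficient_closed:
  "\<lbrakk>i \<in> J X; j \<in> J Y; f \<in> carrier (Mor D Y X)\<rbrakk>
    \<Longrightarrow> coefficient Y X j i f \<in> carrier (Mor C (summand Y j) (summand X i))"
  by (rule linear_maps_closed[OF coefficient_linear])

lemma coefficient_Cmp:
  assumes "Z \<in> Obj D" "g \<in> carrier (Mor D Z Y)" "f \<in> carrier (Mor D Y X)" "i \<in> J X" "k \<in> J Z"
  shows "coefficient Z X k i (Cmp D Z Y X g f) = (\<Oplus>\<^bsub>Mor C (summand Z k) (summand X i)\<^esub>j\<in>J Y.
    Cmp C (summand Z k) (summand Y j) (summand X i) (coefficient Z Y k j g)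
        (coefficient Y X j i f))"
proof -
  let ?a = "Cmp D (summand_img Z k) Z Y (proj Z k) g"
    and ?b = "Cmp D Y X (summand_img X i) f (incl X i)"
  have "coefficient Z X k i (Cmp D Z Y X g f) =
    lower (summand Z k) (summand X i) (Cmp D (summand_img Z k) Y (summand_img X i) ?a ?b)"
    using assms X Y by (simp add: coefficient_def D.Cmp_assoc)
  also have "\<dots> = (\<Oplus>\<^bsub>Mor C (summand Z k) (summand X i)\<^esub>j\<in>J Y.
    Cmp C (summand Z k) (summand Y j) (summand X i)
      (lower (summand Z k) (summand Y j) (Cmp D (summand_img Z k) Y (summand_img Y j) ?a
          (incl Y j)))
      (lower (summand Y j) (summand X i) (Cmp D (summand_img Y j) Y (summand_img X i) (proj Y j)
          ?b)))"
    using assms X Y by (intro lower_factor Cmp_into_corner Cmp_out_of_corner)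
      (simp_all add: proj_into_corner incl_out_of_corner)
  also have "\<dots> = (\<Oplus>\<^bsub>Mor C (summand Z k) (summand X i)\<^esub>j\<in>J Y.
    Cmp C (summand Z k) (summand Y j) (summand X i) (coefficient Z Y k j g)
        (coefficient Y X j i f))"
    using assms X Y by (intro C.Mor_finsum_cong) (simp_all add: coefficient_def D.Cmp_assoc
        lower_closed proj_into_corner incl_out_of_corner Cmp_out_of_corner)
  finally show ?thesis .
qed

end

definition induced_sum :: "('k, 'o, 'm, 'v) cat_module \<Rightarrow> 'p \<Rightarrow> ('k, 'j \<Rightarrow> 'v) module" where
  "induced_sum N X = direct_sum (J X) (\<lambda>j. FObj N (summand X j))"

definition matrix_act ::
    "('k, 'o, 'm, 'v) cat_module \<Rightarrow> 'p \<Rightarrow> 'p \<Rightarrow> 'n \<Rightarrow> ('j \<Rightarrow> 'v) \<Rightarrow> 'j \<Rightarrow> 'v" where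
  "matrix_act N Y X f v = (\<lambda>j\<in>J Y. \<Oplus>\<^bsub>FObj N (summand Y j)\<^esub>i\<in>J X.
     FMor N (summand Y j) (summand X i) (coefficient Y X j i f) (v i))"

definition induced_space :: "('k, 'o, 'm, 'v) cat_module \<Rightarrow> 'p \<Rightarrow> ('k, 'j \<Rightarrow> 'v) module" where
  "induced_space N X = (induced_sum N X)
     \<lparr>carrier := {v \<in> carrier (induced_sum N X). matrix_act N X X (Idt D X) v = v}\<rparr>"

definition induced_module :: "('k, 'o, 'm, 'v) cat_module \<Rightarrow> ('k, 'p, 'n, 'j \<Rightarrow> 'v) cat_module" where
  "induced_module N = \<lparr>FObj = induced_space N,
     FMor = (\<lambda>Y X f. restrict (matrix_act N Y X f) (carrier (induced_space N X)))\<rparr>"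

text \<open>The element \<open>g \<otimes> w\<close> of the induced module, where \<open>g\<close> is a morphism from \<open>img c\<close> to \<open>X\<close>.\<close>

definition tensor :: "('k, 'o, 'm, 'v) cat_module \<Rightarrow> 'p \<Rightarrow> 'o \<Rightarrow> 'n \<Rightarrow> 'v \<Rightarrow> 'j \<Rightarrow> 'v" where
  "tensor N X c g w = (\<lambda>j\<in>J X. FMor N (summand X j) c
     (lower (summand X j) c (Cmp D (summand_img X j) X (img c) (proj X j) g)) w)"

lemma
  shows FObj_induced_module: "FObj (induced_module N) = induced_space N"
    and FMor_induced_module:
      "FMor (induced_module N) Y X f = restrict (matrix_act N Y X f) (carrier (induced_space N X))"
  by (simp_all add: induced_module_def)

lemma mem_induced_space:
  "v \<in> carrier (induced_space N X)
    \<longleftrightarrow> v \<in> carrier (induced_sum N X) \<and> matrix_act N X X (Idt D X) v = v"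
  by (simp add: induced_space_def)

lemma linear_maps_into_induced_space:
  "f \<in> linear_maps K V (induced_space N X) \<longleftrightarrow> f \<in> linear_maps K V (induced_sum N X) \<and>
    (\<forall>v\<in>carrier V. matrix_act N X X (Idt D X) (f v) = f v)"
  by (auto simp: linear_maps_def induced_space_def)

lemma linear_maps_from_induced_space:
  "f \<in> linear_maps K (induced_sum N X) W \<Longrightarrow> f \<in> linear_maps K (induced_space N X) W"
  by (auto simp: linear_maps_def induced_space_def)

context
  fixes N :: "('k, 'o, 'm, 'v) cat_module"
  assumes N: "left_module K C N"
begin

interpretation N: left_module K C N
  by (rule N)

lemma
  assumes X: "X \<in> Obj D"
  shows module_induced_sum: "module K (induced_sum N X)"
    and carrier_induced_sum: "carrier (induced_sum N X) =
        (\<Pi>\<^sub>E j\<in>J X. carrier (FObj N (summand X j)))"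
  unfolding induced_sum_def using X
  by (simp_all add: module_direct_sum C.is_cring N.space_module carrier_direct_sum_finite)

lemma induced_sum_mem:
  "\<lbrakk>v \<in> carrier (induced_sum N X); X \<in> Obj D; j \<in> J X\<rbrakk> \<Longrightarrow> v j \<in> carrier (FObj N (summand X j))"
  by (auto simp: carrier_induced_sum)

lemma induced_sum_eqI:
  assumes "u \<in> carrier (induced_sum N X)" "v \<in> carrier (induced_sum N X)" "X \<in> Obj D"
    and "\<And>j. j \<in> J X \<Longrightarrow> u j = v j"
  shows "u = v"
  using assms by (auto simp: carrier_induced_sum intro: PiE_ext)

lemma matrix_act_linear:
  assumes "X \<in> Obj D" "Y \<in> Obj D" "f \<in> carrier (Mor D Y X)"
  shows "matrix_act N Y X f \<in> linear_maps K (induced_sum N X) (induced_sum N Y)"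
  unfolding matrix_act_def[abs_def] induced_sum_def using assms
  by (intro direct_sum_tuple_linear linear_maps_pointwise_finsum
      linear_maps_comp[OF direct_sum_proj_linear[where V = "\<lambda>i. FObj N (summand X i)"]
          N.act_linear])
    (simp_all add: N.space_module coefficient_closed)

lemma matrix_act_closed:
  "\<lbrakk>X \<in> Obj D; Y \<in> Obj D; f \<in> carrier (Mor D Y X); v \<in> carrier (induced_sum N X)\<rbrakk>
    \<Longrightarrow> matrix_act N Y X f v \<in> carrier (induced_sum N Y)"
  by (rule linear_maps_closed[OF matrix_act_linear])

lemma matrix_act_linear_Mor:
  assumes "X \<in> Obj D" "Y \<in> Obj D" "v \<in> carrier (induced_sum N X)"
  shows "(\<lambda>f. matrix_act N Y X f v) \<in> linear_maps K (Mor D Y X) (induced_sum N Y)"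
  unfolding matrix_act_def[abs_def] induced_sum_def using assms
  by (intro direct_sum_tuple_linear linear_maps_pointwise_finsum
      linear_maps_comp[OF coefficient_linear N.act_linear_Mor])
    (simp_all add: N.space_module induced_sum_mem)

lemma matrix_act_Cmp:
  assumes XYZ: "X \<in> Obj D" "Y \<in> Obj D" "Z \<in> Obj D" and g: "g \<in> carrier (Mor D Z Y)"
    and f: "f \<in> carrier (Mor D Y X)" and v: "v \<in> carrier (induced_sum N X)"
  shows "matrix_act N Z X (Cmp D Z Y X g f) v = matrix_act N Z Y g (matrix_act N Y X f v)"
proof (rule induced_sum_eqI[OF _ _ XYZ(3)])
  note [simp] = XYZ g f coefficient_closed induced_sum_mem[OF v] N.act_closed
  fix k assume [simp]: "k \<in> J Z"
  interpret Nk: module K "FObj N (summand Z k)"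
    by (rule N.space_module) simp
  let ?t = "\<lambda>i j. FMor N (summand Z k) (summand Y j) (coefficient Z Y k j g)
    (FMor N (summand Y j) (summand X i) (coefficient Y X j i f) (v i))"
  have "matrix_act N Z X (Cmp D Z Y X g f) v k =
    (\<Oplus>\<^bsub>FObj N (summand Z k)\<^esub>i\<in>J X. \<Oplus>\<^bsub>FObj N (summand Z k)\<^esub>j\<in>J Y. ?t i j)"
    by (simp add: matrix_act_def, intro module_finsum_cong[OF Nk.module_axioms])
      (auto simp: coefficient_Cmp N.act_finsum_Mor N.act_Cmp Pi_def
          intro!: Nk.finsum_closed Nk.finsum_cong')
  also have "\<dots> = (\<Oplus>\<^bsub>FObj N (summand Z k)\<^esub>j\<in>J Y. \<Oplus>\<^bsub>FObj N (summand Z k)\<^esub>i\<in>J X. ?t i j)"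
    by (rule Nk.finsum_swap) simp_all
  also have "\<dots> = matrix_act N Z Y g (matrix_act N Y X f v) k"
    by (simp add: matrix_act_def, intro module_finsum_cong[OF Nk.module_axioms])
      (simp_all add: N.act_finsum module_finsum_closed[OF N.space_module])
  finally show "matrix_act N Z X (Cmp D Z Y X g f) v k =
      matrix_act N Z Y g (matrix_act N Y X f v) k" .
qed (use assms in \<open>simp_all add: matrix_act_closed\<close>)

lemma matrix_act_Idt_Cmp:
  "\<lbrakk>X \<in> Obj D; Y \<in> Obj D; f \<in> carrier (Mor D Y X); v \<in> carrier (induced_sum N X)\<rbrakk>
    \<Longrightarrow> matrix_act N Y Y (Idt D Y) (matrix_act N Y X f v) = matrix_act N Y X f v"
  by (simp add: matrix_act_Cmp[symmetric] D.Idt_left)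

lemma module_induced_space:
  assumes X: "X \<in> Obj D"
  shows "module K (induced_space N X)"
proof -
  note sum = module_induced_sum[OF X]
  have "submodule {v \<in> carrier (induced_sum N X). matrix_act N X X (Idt D X) v = v} K
      (induced_sum N X)"
    using X by (intro submodule_equalizer[OF matrix_act_linear linear_maps_id sum sum]) simp_all
  then show ?thesis
    unfolding induced_space_def using sum by (rule submodule.submodule_is_module)
qed

lemma left_module_induced_module: "left_module K D (induced_module N)"
proof (rule left_moduleI)
  fix X Y f v
  assume XY: "X \<in> Obj D" "Y \<in> Obj D"
  show "FMor (induced_module N) Y X f \<in> linear_maps K (FObj (induced_module N) X)
      (FObj (induced_module N) Y)" if f: "f \<in> carrier (Mor D Y X)"
  proof -
    have "matrix_act N Y X f \<in> linear_maps K (induced_space N X) (induced_space N Y)"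
      using XY f by (simp add: linear_maps_into_induced_space linear_maps_from_induced_space
          matrix_act_linear matrix_act_Idt_Cmp mem_induced_space)
    then show ?thesis
      unfolding FObj_induced_module FMor_induced_module
      by (rule linear_maps_restrict[OF _ module_induced_space[OF XY(1)]])
  qed
  show "(\<lambda>f. FMor (induced_module N) Y X f v) \<in> linear_maps K (Mor D Y X)
      (FObj (induced_module N) Y)"
    if "v \<in> carrier (FObj (induced_module N) X)"
    using that XY by (simp add: FObj_induced_module FMor_induced_module
        linear_maps_into_induced_space
        mem_induced_space matrix_act_linear_Mor matrix_act_Idt_Cmp)
qed (simp_all add: FObj_induced_module FMor_induced_module D.k_category_axioms module_induced_space
    mem_induced_space matrix_act_Cmp matrix_act_Idt_Cmp matrix_act_closed)

lemma tensor_linear: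
  assumes "X \<in> Obj D" "c \<in> Obj C" "g \<in> out_of_corner X c"
  shows "tensor N X c g \<in> linear_maps K (FObj N c) (induced_sum N X)"
  unfolding tensor_def[abs_def] induced_sum_def using assms
  by (intro direct_sum_tuple_linear N.act_linear)
    (simp_all add: lower_closed proj_into_corner)

lemma matrix_act_tensor:
  assumes XY: "X \<in> Obj D" "Y \<in> Obj D" and c: "c \<in> Obj C" and f: "f \<in> carrier (Mor D Y X)"
    and g: "g \<in> out_of_corner X c" and w: "w \<in> carrier (FObj N c)"
  shows "matrix_act N Y X f (tensor N X c g w) = tensor N Y c (Cmp D Y X (img c) f g) w"
  unfolding matrix_act_def tensor_def[of N Y]
proof (rule restrict_ext)
  note [simp] = XY c f g w lower_closed proj_into_corner incl_out_of_corner coefficient_closed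
    out_of_cornerD[OF g]
  fix j assume [simp]: "j \<in> J Y"
  have factor: "lower (summand Y j) c (Cmp D (summand_img Y j) Y (img c) (proj Y j)
      (Cmp D Y X (img c) f g))
    = (\<Oplus>\<^bsub>Mor C (summand Y j) c\<^esub>i\<in>J X. Cmp C (summand Y j) (summand X i) c (coefficient Y X j i f)
        (lower (summand X i) c (Cmp D (summand_img X i) X (img c) (proj X i) g)))"
    using lower_factor[of c "summand Y j" X "Cmp D (summand_img Y j) Y X (proj Y j) f" g]
    by (simp add: coefficient_def Cmp_into_corner D.Cmp_assoc cong: restrict_cong)
      (intro C.Mor_finsum_cong; simp add: D.Cmp_assoc Cmp_out_of_corner)
  have "(\<Oplus>\<^bsub>FObj N (summand Y j)\<^esub>i\<in>J X.
      FMor N (summand Y j) (summand X i) (coefficient Y X j i f) (tensor N X c g w i))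
    = (\<Oplus>\<^bsub>FObj N (summand Y j)\<^esub>i\<in>J X. FMor N (summand Y j) c
        (Cmp C (summand Y j) (summand X i) c (coefficient Y X j i f)
          (lower (summand X i) c (Cmp D (summand_img X i) X (img c) (proj X i) g))) w)"
    by (intro module_finsum_cong[OF N.space_module])
        (simp_all add: tensor_def N.act_Cmp N.act_closed)
  then show "(\<Oplus>\<^bsub>FObj N (summand Y j)\<^esub>i\<in>J X.
      FMor N (summand Y j) (summand X i) (coefficient Y X j i f) (tensor N X c g w i))
    = FMor N (summand Y j) c
        (lower (summand Y j) c (Cmp D (summand_img Y j) Y (img c) (proj Y j)
            (Cmp D Y X (img c) f g))) w"
    by (simp add: factor N.act_finsum_Mor)
qed

lemma tensor_emb:
  assumes "X \<in> Obj D" "c \<in> Obj C" "c' \<in> Obj C" "g \<in> out_of_corner X c'" "f \<in> carrier (Mor C c' c)"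
    and "w \<in> carrier (FObj N c)"
  shows "tensor N X c (Cmp D X (img c') (img c) g (emb c' c f)) w =
      tensor N X c' g (FMor N c' c f w)"
  unfolding tensor_def using assms
  by (intro restrict_ext) (simp add: lower_Cmp_emb proj_into_corner N.act_Cmp lower_closed)

lemma tensor_in_induced_space:
  assumes "X \<in> Obj D" "c \<in> Obj C" "g \<in> out_of_corner X c" "w \<in> carrier (FObj N c)"
  shows "tensor N X c g w \<in> carrier (induced_space N X)"
  using assms by (simp add: mem_induced_space linear_maps_closed[OF tensor_linear] matrix_act_tensor
      D.Idt_left out_of_cornerD)

lemma tensor_idem_linear:
  assumes "c \<in> Obj C"
  shows "tensor N (img c) c (idem c) \<in> linear_maps K (FObj N c) (corner_space (induced_module N) c)"
  using assms by (simp add: linear_maps_into_corner_space FObj_induced_module FMor_induced_module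
      linear_maps_into_induced_space tensor_linear idem_out_of_corner matrix_act_tensor D.Idt_left
      tensor_in_induced_space)

definition contraction :: "'o \<Rightarrow> ('j \<Rightarrow> 'v) \<Rightarrow> 'v" where
  "contraction c v = (\<Oplus>\<^bsub>FObj N c\<^esub>i\<in>J (img c). FMor N c (summand (img c) i)
     (lower c (summand (img c) i)
       (Cmp D (img c) (img c) (summand_img (img c) i) (idem c) (incl (img c) i))) (v i))"

context
  fixes c
  assumes c[simp]: "c \<in> Obj C"
begin

lemma lower_idem_incl_closed:
  "i \<in> J (img c) \<Longrightarrow> lower c (summand (img c) i)
    (Cmp D (img c) (img c) (summand_img (img c) i) (idem c) (incl (img c) i))
      \<in> carrier (Mor C c (summand (img c) i))"
  by (simp add: lower_closed idem_into_corner incl_out_of_corner)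

lemma contraction_closed:
  assumes v: "v \<in> carrier (induced_sum N (img c))"
  shows "contraction c v \<in> carrier (FObj N c)"
  unfolding contraction_def
  by (intro module_finsum_closed[OF N.space_module] N.act_closed)
    (simp_all add: lower_idem_incl_closed induced_sum_mem[OF v])

lemma contraction_tensor:
  assumes w: "w \<in> carrier (FObj N c)"
  shows "contraction c (tensor N (img c) c (idem c) w) = w"
proof -
  let ?a = "\<lambda>i. lower c (summand (img c) i)
      (Cmp D (img c) (img c) (summand_img (img c) i) (idem c) (incl (img c) i))"
    and ?b = "\<lambda>i. lower (summand (img c) i) c
      (Cmp D (summand_img (img c) i) (img c) (img c) (proj (img c) i) (idem c))"
  note [simp] = w lower_idem_incl_closed lower_closed proj_into_corner idem_out_of_corner
  have "contraction c (tensor N (img c) c (idem c) w) =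
    (\<Oplus>\<^bsub>FObj N c\<^esub>i\<in>J (img c). FMor N c c (Cmp C c (summand (img c) i) c (?a i) (?b i)) w)"
    unfolding contraction_def
    by (intro module_finsum_cong[OF N.space_module])
        (simp_all add: tensor_def N.act_Cmp N.act_closed)
  also have "\<dots> = FMor N c c (\<Oplus>\<^bsub>Mor C c c\<^esub>i\<in>J (img c). Cmp C c (summand (img c) i) c (?a i) (?b i)) w"
    by (intro N.act_finsum_Mor[symmetric]) simp_all
  also have "(\<Oplus>\<^bsub>Mor C c c\<^esub>i\<in>J (img c). Cmp C c (summand (img c) i) c (?a i) (?b i)) =
      lower c c (Cmp D (img c) (img c) (img c) (idem c) (idem c))"
    by (intro lower_factor[symmetric]) (simp_all add: idem_into_corner)
  finally show ?thesis
    by (simp add: lower_emb N.act_Idt)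
qed

lemma tensor_contraction:
  assumes v: "v \<in> carrier (induced_sum N (img c))"
  shows "tensor N (img c) c (idem c) (contraction c v) = matrix_act N (img c) (img c) (idem c) v"
  unfolding tensor_def matrix_act_def
proof (rule restrict_ext)
  fix j assume [simp]: "j \<in> J (img c)"
  let ?a = "\<lambda>i. lower c (summand (img c) i)
      (Cmp D (img c) (img c) (summand_img (img c) i) (idem c) (incl (img c) i))"
    and ?b = "lower (summand (img c) j) c
      (Cmp D (summand_img (img c) j) (img c) (img c) (proj (img c) j) (idem c))"
  note [simp] = induced_sum_mem[OF v] lower_idem_incl_closed lower_closed proj_into_corner
    idem_out_of_corner idem_into_corner incl_out_of_corner coefficient_closed
  have coefficient: "coefficient (img c) (img c) j i (idem c) =
      Cmp C (summand (img c) j) c (summand (img c) i) ?b (?a i)" if [simp]: "i \<in> J (img c)" for i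
  proof -
    have "coefficient (img c) (img c) j i (idem c) = lower (summand (img c) j) (summand (img c) i)
        (Cmp D (summand_img (img c) j) (img c) (summand_img (img c) i) (proj (img c) j)
          (Cmp D (img c) (img c) (summand_img (img c) i) (idem c)
              (emb c (summand (img c) i) (?a i))))"
      by (simp add: coefficient_def emb_lower D.Cmp_assoc[symmetric])
    then show ?thesis
      by (simp add: lower_Cmp_emb del: idem_emb)
  qed
  show "FMor N (summand (img c) j) c ?b (contraction c v) =
    (\<Oplus>\<^bsub>FObj N (summand (img c) j)\<^esub>i\<in>J (img c). FMor N (summand (img c) j) (summand (img c) i)
      (coefficient (img c) (img c) j i (idem c)) (v i))"
    unfolding contraction_def
    by (subst N.act_finsum) (auto simp: coefficient N.act_Cmp N.act_closed
        intro!: module_finsum_cong[OF N.space_module])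
qed

end

lemma module_isomorphism_corner_induced:
  "module_isomorphism K C N (corner_module (induced_module N)) (\<lambda>c. tensor N (img c) c (idem c))"
  unfolding module_isomorphism_def FObj_corner_module FMor_corner_module
proof (intro conjI ballI)
  fix c assume c: "c \<in> Obj C"
  note linear = tensor_idem_linear[OF c]
  show "tensor N (img c) c (idem c) \<in> linear_maps K (FObj N c) (corner_space (induced_module N) c)"
    by (rule linear)
  have corner: "v \<in> carrier (induced_sum N (img c)) \<and> matrix_act N (img c) (img c) (idem c) v = v"
    if "v \<in> carrier (corner_space (induced_module N) c)" for v
    using corner_space_closed[OF that] corner_space_fixed[OF that]
    by (simp add: FObj_induced_module FMor_induced_module mem_induced_space)
  show "bij_betw (tensor N (img c) c (idem c)) (carrier (FObj N c))
      (carrier (corner_space (induced_module N) c))"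
    by (rule bij_betwI[where g = "contraction c"])
      (use c corner linear_maps_closed[OF linear] in
        \<open>auto simp: contraction_closed contraction_tensor tensor_contraction\<close>)
  fix c' f w assume c': "c' \<in> Obj C" and f: "f \<in> carrier (Mor C c' c)"
    and w: "w \<in> carrier (FObj N c)"
  have "tensor N (img c') c' (idem c') (FMor N c' c f w) = tensor N (img c') c (emb c' c f) w"
    using c c' f w by (simp add: tensor_emb[symmetric] idem_out_of_corner)
  also have "\<dots> = matrix_act N (img c') (img c) (emb c' c f) (tensor N (img c) c (idem c) w)"
    using c c' f w by (simp add: matrix_act_tensor idem_out_of_corner)
  finally show "tensor N (img c') c' (idem c') (FMor N c' c f w) =
      restrict (FMor (induced_module N) (img c') (img c) (emb c' c f))
        (carrier (corner_space (induced_module N) c)) (tensor N (img c) c (idem c) w)"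
    using c w linear_maps_closed[OF linear w] by (simp add: FMor_induced_module
        tensor_in_induced_space idem_out_of_corner)
qed

end

lemma corner_module_isomorphism:
  fixes M :: "('k, 'p, 'n, 'v) cat_module" and M' :: "('k, 'p, 'n, 'w) cat_module"
  assumes M: "left_module K D M" and \<tau>: "module_isomorphism K D M M' \<tau>"
  shows "module_isomorphism K C (corner_module M) (corner_module M') (\<lambda>c. \<tau> (img c))"
  unfolding module_isomorphism_def FObj_corner_module FMor_corner_module
proof (intro conjI ballI)
  fix c assume c: "c \<in> Obj C"
  note linear = module_isomorphism_linear[OF \<tau> img_closed[OF c]]
    and bij = module_isomorphism_bij[OF \<tau> img_closed[OF c]]
    and natural = module_isomorphism_natural[OF \<tau> img_closed[OF c]]
  show "\<tau> (img c) \<in> linear_maps K (corner_space M c) (corner_space M' c)"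
    using c by (simp add: linear_maps_into_corner_space linear_maps_from_corner_space linear
        natural[symmetric] mem_corner_space)
  then have closed: "v \<in> carrier (corner_space M c) \<Longrightarrow> \<tau> (img c) v \<in> carrier (corner_space M' c)"
      for v
    by (rule linear_maps_closed)
  have "\<exists>v\<in>carrier (corner_space M c). \<tau> (img c) v = w" if w: "w \<in> carrier (corner_space M' c)"
      for w
  proof -
    obtain v where v: "v \<in> carrier (FObj M (img c))" "w = \<tau> (img c) v"
      using bij corner_space_closed[OF w] by (auto simp: bij_betw_def)
    have "FMor M (img c) (img c) (idem c) v \<in> carrier (corner_space M c)"
      using c v by (intro act_in_corner_space[OF M]) simp_all
    moreover have "\<tau> (img c) (FMor M (img c) (img c) (idem c) v) = w"
      using c v corner_space_fixed[OF w] by (simp add: natural)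
    ultimately show ?thesis by blast
  qed
  then show "bij_betw (\<tau> (img c)) (carrier (corner_space M c)) (carrier (corner_space M' c))"
    using bij_betw_imp_inj_on[OF bij] closed
    by (auto simp: bij_betw_def inj_on_def corner_space_closed)
  fix c' f v assume "c' \<in> Obj C" "f \<in> carrier (Mor C c' c)" "v \<in> carrier (corner_space M c)"
  then show "\<tau> (img c') (restrict (FMor M (img c') (img c) (emb c' c f))
      (carrier (corner_space M c)) v) =
      restrict (FMor M' (img c') (img c) (emb c' c f)) (carrier (corner_space M' c)) (\<tau> (img c) v)"
    using c closed by (simp add: natural corner_space_closed)
qed

text \<open>The values of \<open>induced_module N\<close> are finite tuples; as \<open>'v\<close> is infinite, they can be encoded in
  \<open>'v\<close>.\<close>

lemma corner_functor_essentially_surjective: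
  fixes N :: "('k, 'o, 'm, 'v) cat_module"
  assumes inf: "infinite (UNIV :: 'v set)" and N: "left_module K C N"
  shows "\<exists>M. left_module K D M \<and> isomorphic_in (left_modules K C) (corner_module M) N"
proof -
  define enc where "enc X = (SOME e :: ('j \<Rightarrow> 'v) \<Rightarrow> 'v. inj_on e (\<Pi>\<^sub>E j\<in>J X. UNIV))" for X
  have enc: "inj_on (enc X) (carrier (FObj (induced_module N) X))" if "X \<in> Obj D" for X
  proof (rule inj_on_subset)
    show "inj_on (enc X) (\<Pi>\<^sub>E j\<in>J X. UNIV)"
      unfolding enc_def using that by (intro someI_ex[OF ex_inj_on_PiE[OF inf]]) simp
    show "carrier (FObj (induced_module N) X) \<subseteq> (\<Pi>\<^sub>E j\<in>J X. UNIV)"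
      using that by (auto simp: FObj_induced_module mem_induced_space carrier_induced_sum[OF N])
  qed
  note induced = left_module_induced_module[OF N]
  obtain M :: "('k, 'p, 'n, 'v) cat_module" where M: "left_module K D M"
    and iso: "module_isomorphism K D (induced_module N) M enc"
    using left_module_transport[OF induced enc] by blast
  note corner = left_module_corner_module[OF M]
  have "module_isomorphism K C N (corner_module M)
      (\<lambda>c w. enc (img c) (tensor N (img c) c (idem c) w))"
    by (rule module_isomorphism_comp[OF module_isomorphism_corner_induced[OF N]
          corner_module_isomorphism[OF induced iso]])
  then have "isomorphic_in (left_modules K C) (corner_module M) N"
    by (rule isomorphic_in_left_modulesI[OF corner N module_isomorphism_inverse[OF N corner]])
  then show ?thesis
    using M by blast
qed

theorem morita_equivalent_corner:
  assumes "infinite (UNIV :: 'v set)"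
  shows "morita_equivalent TYPE('v) K D C"
proof -
  let ?F = "corner_functor :: (('k, 'p, 'n, 'v) cat_module, 'p \<Rightarrow> 'v \<Rightarrow> 'v,
      ('k, 'o, 'm, 'v) cat_module, 'o \<Rightarrow> 'v \<Rightarrow> 'v) kfun"
  have "weak_equivalence K (left_modules K D :: ('k, 'p, 'n, 'v) cat_modules)
      (left_modules K C :: ('k, 'o, 'm, 'v) cat_modules) ?F"
    by (intro weak_equivalence.intro weak_equivalence_axioms.intro
        k_category_left_modules[OF C.field_axioms] k_functor_corner_functor)
      (auto simp: Obj_left_modules C.k_category_axioms D.k_category_axioms carrier_Mor_left_modules
        FObj_corner_functor corner_functor_fully_faithful
        intro: corner_functor_essentially_surjective[OF assms])
  then show ?thesis
    unfolding morita_equivalent_def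
    using weak_equivalence.k_equivalent C.k_category_axioms D.k_category_axioms by blast
qed

end

section \<open>Matrix presentations\<close>

locale matrix_presentation = k_category K C
  for K :: "('k, 'r) ring_scheme" and C :: "('k, 'o, 'm) kcat" +
  fixes D :: "('k, 'p, 'n) kcat" and J :: "'p \<Rightarrow> 'j set" and ob :: "'p \<Rightarrow> 'j \<Rightarrow> 'o"
    and ent :: "'p \<Rightarrow> 'p \<Rightarrow> 'j \<Rightarrow> 'j \<Rightarrow> 'n \<Rightarrow> 'm"
  assumes finite_J: "X \<in> Obj D \<Longrightarrow> finite (J X)"
    and ob_closed: "\<lbrakk>X \<in> Obj D; j \<in> J X\<rbrakk> \<Longrightarrow> ob X j \<in> Obj C"
    and D_module: "\<lbrakk>X \<in> Obj D; Y \<in> Obj D\<rbrakk> \<Longrightarrow> module K (Mor D Y X)"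
    and D_Cmp_closed: "\<lbrakk>X \<in> Obj D; Y \<in> Obj D; Z \<in> Obj D; g \<in> carrier (Mor D Z Y);
        f \<in> carrier (Mor D Y X)\<rbrakk> \<Longrightarrow> Cmp D Z Y X g f \<in> carrier (Mor D Z X)"
    and D_Idt_closed: "X \<in> Obj D \<Longrightarrow> Idt D X \<in> carrier (Mor D X X)"
    and ent_linear: "\<lbrakk>X \<in> Obj D; Y \<in> Obj D; i \<in> J X; j \<in> J Y\<rbrakk>
      \<Longrightarrow> ent Y X j i \<in> linear_maps K (Mor D Y X) (Mor C (ob Y j) (ob X i))"
    and ent_Cmp: "\<lbrakk>X \<in> Obj D; Y \<in> Obj D; Z \<in> Obj D; g \<in> carrier (Mor D Z Y);
        f \<in> carrier (Mor D Y X); i \<in> J X; k \<in> J Z\<rbrakk>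
      \<Longrightarrow> ent Z X k i (Cmp D Z Y X g f) = (\<Oplus>\<^bsub>Mor C (ob Z k) (ob X i)\<^esub>j\<in>J Y.
            Cmp C (ob Z k) (ob Y j) (ob X i) (ent Z Y k j g) (ent Y X j i f))"
    and ent_Idt: "\<lbrakk>X \<in> Obj D; i \<in> J X; j \<in> J X\<rbrakk>
      \<Longrightarrow> ent X X j i (Idt D X) = (if j = i then Idt C (ob X i) else \<zero>\<^bsub>Mor C (ob X j) (ob X i)\<^esub>)"
    and ent_inj: "\<lbrakk>X \<in> Obj D; Y \<in> Obj D; f \<in> carrier (Mor D Y X); f' \<in> carrier (Mor D Y X);
        \<And>j i. \<lbrakk>j \<in> J Y; i \<in> J X\<rbrakk> \<Longrightarrow> ent Y X j i f = ent Y X j i f'\<rbrakk> \<Longrightarrow> f = f'"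
begin

lemma ent_closed:
  "\<lbrakk>X \<in> Obj D; Y \<in> Obj D; i \<in> J X; j \<in> J Y; f \<in> carrier (Mor D Y X)\<rbrakk>
    \<Longrightarrow> ent Y X j i f \<in> carrier (Mor C (ob Y j) (ob X i))"
  by (rule linear_maps_closed[OF ent_linear])

lemma ent_finsum:
  "\<lbrakk>X \<in> Obj D; Y \<in> Obj D; i \<in> J X; j \<in> J Y; finite A; \<And>a. a \<in> A \<Longrightarrow> f a \<in> carrier (Mor D Y X)\<rbrakk>
    \<Longrightarrow> ent Y X j i (\<Oplus>\<^bsub>Mor D Y X\<^esub>a\<in>A. f a) = (\<Oplus>\<^bsub>Mor C (ob Y j) (ob X i)\<^esub>a\<in>A. ent Y X j i (f a))"
  by (rule linear_maps_finsum[OF ent_linear D_module Mor_module]) (simp_all add: ob_closed)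

lemma linear_if_ent_linear:
  assumes V: "module K V" and XY: "X \<in> Obj D" "Y \<in> Obj D"
    and closed: "\<And>v. v \<in> carrier V \<Longrightarrow> h v \<in> carrier (Mor D Y X)"
    and linear: "\<And>j i. \<lbrakk>j \<in> J Y; i \<in> J X\<rbrakk>
      \<Longrightarrow> (\<lambda>v. ent Y X j i (h v)) \<in> linear_maps K V (Mor C (ob Y j) (ob X i))"
  shows "h \<in> linear_maps K V (Mor D Y X)"
proof -
  interpret V: module K V by (rule V)
  interpret Mor: module K "Mor D Y X" by (rule D_module[OF XY])
  show ?thesis
    by (rule linear_mapsI; (rule ent_inj[OF XY])?)
      (simp_all add: closed XY linear_maps_add[OF ent_linear] linear_maps_smult[OF ent_linear]
        linear_maps_add[OF linear] linear_maps_smult[OF linear])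
qed

context
  fixes X Y Z
  assumes XYZ: "X \<in> Obj D" "Y \<in> Obj D" "Z \<in> Obj D"
begin

lemma D_Cmp_linear_right:
  assumes g: "g \<in> carrier (Mor D Z Y)"
  shows "(\<lambda>f. Cmp D Z Y X g f) \<in> linear_maps K (Mor D Y X) (Mor D Z X)"
proof (rule linear_if_ent_linear[OF D_module[OF XYZ(1,2)] XYZ(1,3) D_Cmp_closed[OF XYZ g]])
  fix k i assume ki: "k \<in> J Z" "i \<in> J X"
  have "(\<lambda>f. \<Oplus>\<^bsub>Mor C (ob Z k) (ob X i)\<^esub>j\<in>J Y. Cmp C (ob Z k) (ob Y j) (ob X i) (ent Z Y k j g)
      (ent Y X j i f))
      \<in> linear_maps K (Mor D Y X) (Mor C (ob Z k) (ob X i))"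
    using XYZ g ki by (intro linear_maps_pointwise_finsum Mor_module finite_J
        linear_maps_comp[OF ent_linear Cmp_linear_right]) (simp_all add: ob_closed ent_closed)
  then show "(\<lambda>f. ent Z X k i (Cmp D Z Y X g f))
      \<in> linear_maps K (Mor D Y X) (Mor C (ob Z k) (ob X i))"
    by (rule linear_maps_cong[OF _ D_module[OF XYZ(1,2)]]) (use XYZ g ki in \<open>simp add: ent_Cmp\<close>)
qed

lemma D_Cmp_linear_left:
  assumes f: "f \<in> carrier (Mor D Y X)"
  shows "(\<lambda>g. Cmp D Z Y X g f) \<in> linear_maps K (Mor D Z Y) (Mor D Z X)"
proof (rule linear_if_ent_linear[OF D_module[OF XYZ(2,3)] XYZ(1,3) D_Cmp_closed[OF XYZ _ f]])
  fix k i assume ki: "k \<in> J Z" "i \<in> J X"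
  have "(\<lambda>g. \<Oplus>\<^bsub>Mor C (ob Z k) (ob X i)\<^esub>j\<in>J Y. Cmp C (ob Z k) (ob Y j) (ob X i) (ent Z Y k j g)
      (ent Y X j i f))
      \<in> linear_maps K (Mor D Z Y) (Mor C (ob Z k) (ob X i))"
    using XYZ f ki by (intro linear_maps_pointwise_finsum Mor_module finite_J
        linear_maps_comp[OF ent_linear Cmp_linear_left]) (simp_all add: ob_closed ent_closed)
  then show "(\<lambda>g. ent Z X k i (Cmp D Z Y X g f))
      \<in> linear_maps K (Mor D Z Y) (Mor C (ob Z k) (ob X i))"
    by (rule linear_maps_cong[OF _ D_module[OF XYZ(2,3)]]) (use XYZ f ki in \<open>simp add: ent_Cmp\<close>)
qed

lemma D_Cmp_assoc:
  assumes W: "W \<in> Obj D" and h: "h \<in> carrier (Mor D Z Y)" and g: "g \<in> carrier (Mor D Y X)"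
    and f: "f \<in> carrier (Mor D X W)"
  shows "Cmp D Z X W (Cmp D Z Y X h g) f = Cmp D Z Y W h (Cmp D Y X W g f)"
proof (rule ent_inj[OF W XYZ(3)])
  note [simp] = W XYZ h g f D_Cmp_closed ent_closed ob_closed Cmp_closed finite_J
  show "Cmp D Z X W (Cmp D Z Y X h g) f \<in> carrier (Mor D Z W)"
    and "Cmp D Z Y W h (Cmp D Y X W g f) \<in> carrier (Mor D Z W)" by simp_all
  fix k i assume ki[simp]: "k \<in> J Z" "i \<in> J W"
  interpret M: abelian_monoid "Mor C (ob Z k) (ob W i)" by (rule Mor_abelian_monoid) simp_all
  let ?t = "\<lambda>j l. Cmp C (ob Z k) (ob Y l) (ob W i) (ent Z Y k l h)
      (Cmp C (ob Y l) (ob X j) (ob W i) (ent Y X l j g) (ent X W j i f))"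
  have "ent Z W k i (Cmp D Z X W (Cmp D Z Y X h g) f) =
      (\<Oplus>\<^bsub>Mor C (ob Z k) (ob W i)\<^esub>j\<in>J X. \<Oplus>\<^bsub>Mor C (ob Z k) (ob W i)\<^esub>l\<in>J Y. ?t j l)"
    by (simp add: ent_Cmp Cmp_finsum_left Cmp_assoc Pi_def cong: M.finsum_cong)
  also have "\<dots> = (\<Oplus>\<^bsub>Mor C (ob Z k) (ob W i)\<^esub>l\<in>J Y. \<Oplus>\<^bsub>Mor C (ob Z k) (ob W i)\<^esub>j\<in>J X. ?t j l)"
    by (rule M.finsum_swap) simp_all
  also have "\<dots> = ent Z W k i (Cmp D Z Y W h (Cmp D Y X W g f))"
    by (simp add: ent_Cmp Cmp_finsum_right Pi_def cong: M.finsum_cong)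
  finally show "ent Z W k i (Cmp D Z X W (Cmp D Z Y X h g) f) =
      ent Z W k i (Cmp D Z Y W h (Cmp D Y X W g f))" .
qed

end

context
  fixes X Y f
  assumes X: "X \<in> Obj D" and Y: "Y \<in> Obj D" and f: "f \<in> carrier (Mor D Y X)"
begin

lemma D_Idt_left: "Cmp D Y Y X (Idt D Y) f = f"
proof (rule ent_inj[OF X Y _ f])
  note [simp] = X Y f D_Idt_closed ent_closed ob_closed Cmp_closed Idt_closed finite_J
  fix j i assume [simp]: "j \<in> J Y" "i \<in> J X"
  have "ent Y X j i (Cmp D Y Y X (Idt D Y) f) =
      Cmp C (ob Y j) (ob Y j) (ob X i) (ent Y Y j j (Idt D Y)) (ent Y X j i f)"
    by (subst ent_Cmp, simp_all, rule abelian_monoid.finsum_eq_single[OF Mor_abelian_monoid])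
      (simp_all add: ent_Idt Cmp_zero_left)
  then show "ent Y X j i (Cmp D Y Y X (Idt D Y) f) = ent Y X j i f"
    by (simp add: ent_Idt Idt_left)
qed (simp add: X Y f D_Cmp_closed D_Idt_closed)

lemma D_Idt_right: "Cmp D Y X X f (Idt D X) = f"
proof (rule ent_inj[OF X Y _ f])
  note [simp] = X Y f D_Idt_closed ent_closed ob_closed Cmp_closed Idt_closed finite_J
  fix j i assume [simp]: "j \<in> J Y" "i \<in> J X"
  have "ent Y X j i (Cmp D Y X X f (Idt D X)) =
      Cmp C (ob Y j) (ob X i) (ob X i) (ent Y X j i f) (ent X X i i (Idt D X))"
    by (subst ent_Cmp, simp_all, rule abelian_monoid.finsum_eq_single[OF Mor_abelian_monoid])
      (simp_all add: ent_Idt Cmp_zero_right)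
  then show "ent Y X j i (Cmp D Y X X f (Idt D X)) = ent Y X j i f"
    by (simp add: ent_Idt Idt_right)
qed (simp add: X Y f D_Cmp_closed D_Idt_closed)

end

theorem k_category_presented: "k_category K D"
  by (intro k_category.intro field_axioms k_category_axioms.intro)
    (simp_all add: D_module D_Cmp_linear_right D_Cmp_linear_left D_Cmp_assoc D_Idt_closed D_Idt_left
      D_Idt_right)

end

locale full_matrix_presentation = matrix_presentation K C D J ob ent
  for K :: "('k, 'r) ring_scheme" and C :: "('k, 'o, 'm) kcat" and D :: "('k, 'p, 'n) kcat"
    and J :: "'p \<Rightarrow> 'j set" and ob :: "'p \<Rightarrow> 'j \<Rightarrow> 'o" and ent :: "'p \<Rightarrow> 'p \<Rightarrow> 'j \<Rightarrow> 'j \<Rightarrow> 'n \<Rightarrow> 'm" +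
  assumes ent_surj: "\<lbrakk>X \<in> Obj D; Y \<in> Obj D;
      \<And>j i. \<lbrakk>j \<in> J Y; i \<in> J X\<rbrakk> \<Longrightarrow> m j i \<in> carrier (Mor C (ob Y j) (ob X i))\<rbrakk>
      \<Longrightarrow> \<exists>f\<in>carrier (Mor D Y X). \<forall>j\<in>J Y. \<forall>i\<in>J X. ent Y X j i f = m j i"
    and ob_surj: "c \<in> Obj C \<Longrightarrow> \<exists>X\<in>Obj D. \<exists>i\<in>J X. ob X i = c"
begin

definition matrix_unit :: "'p \<Rightarrow> 'j \<Rightarrow> 'p \<Rightarrow> 'j \<Rightarrow> 'm \<Rightarrow> 'n" where
  "matrix_unit Y j X i f = (SOME u. u \<in> carrier (Mor D Y X) \<and>
     (\<forall>j'\<in>J Y. \<forall>i'\<in>J X. ent Y X j' i' u =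
       (if j' = j \<and> i' = i then f else \<zero>\<^bsub>Mor C (ob Y j') (ob X i')\<^esub>)))"

context
  fixes X Y i j f
  assumes X: "X \<in> Obj D" and Y: "Y \<in> Obj D" and i: "i \<in> J X" and j: "j \<in> J Y"
    and f: "f \<in> carrier (Mor C (ob Y j) (ob X i))"
begin

lemma
  shows matrix_unit_closed: "matrix_unit Y j X i f \<in> carrier (Mor D Y X)"
    and ent_matrix_unit: "\<lbrakk>j' \<in> J Y; i' \<in> J X\<rbrakk> \<Longrightarrow> ent Y X j' i' (matrix_unit Y j X i f) =
      (if j' = j \<and> i' = i then f else \<zero>\<^bsub>Mor C (ob Y j') (ob X i')\<^esub>)"
proof -
  let ?m = "\<lambda>j' i'. if j' = j \<and> i' = i then f else \<zero>\<^bsub>Mor C (ob Y j') (ob X i')\<^esub>"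
  have "?m j' i' \<in> carrier (Mor C (ob Y j') (ob X i'))" if "j' \<in> J Y" "i' \<in> J X" for j' i'
    using that X Y f by (simp add: Mor_zero_closed ob_closed)
  then have "\<exists>u\<in>carrier (Mor D Y X). \<forall>j'\<in>J Y. \<forall>i'\<in>J X. ent Y X j' i' u = ?m j' i'"
    by (rule ent_surj[where m = ?m, OF X Y])
  then have "\<exists>u. u \<in> carrier (Mor D Y X) \<and> (\<forall>j'\<in>J Y. \<forall>i'\<in>J X. ent Y X j' i' u = ?m j' i')"
    by (simp only: Bex_def)
  then have unit: "matrix_unit Y j X i f \<in> carrier (Mor D Y X) \<and>
      (\<forall>j'\<in>J Y. \<forall>i'\<in>J X. ent Y X j' i' (matrix_unit Y j X i f) = ?m j' i')"
    unfolding matrix_unit_def by (rule someI_ex)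
  then show "matrix_unit Y j X i f \<in> carrier (Mor D Y X)"
    by (rule conjunct1)
  show "ent Y X j' i' (matrix_unit Y j X i f) = ?m j' i'" if "j' \<in> J Y" "i' \<in> J X"
    using unit that by blast
qed

lemma ent_Cmp_matrix_unit_right:
  assumes Z: "Z \<in> Obj D" and h: "h \<in> carrier (Mor D Z Y)" and ki: "k \<in> J Z" "i' \<in> J X"
  shows "ent Z X k i' (Cmp D Z Y X h (matrix_unit Y j X i f)) =
    (if i' = i then Cmp C (ob Z k) (ob Y j) (ob X i) (ent Z Y k j h) f
     else \<zero>\<^bsub>Mor C (ob Z k) (ob X i')\<^esub>)"
proof -
  note [simp] = X Y Z h ki i j f ob_closed ent_closed matrix_unit_closed Cmp_closed finite_J
  have "ent Z X k i' (Cmp D Z Y X h (matrix_unit Y j X i f)) =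
      (\<Oplus>\<^bsub>Mor C (ob Z k) (ob X i')\<^esub>j'\<in>J Y. Cmp C (ob Z k) (ob Y j') (ob X i')
        (ent Z Y k j' h) (ent Y X j' i' (matrix_unit Y j X i f)))"
    by (simp add: ent_Cmp)
  also have "\<dots> =
      Cmp C (ob Z k) (ob Y j) (ob X i') (ent Z Y k j h) (ent Y X j i' (matrix_unit Y j X i f))"
    by (rule abelian_monoid.finsum_eq_single[OF Mor_abelian_monoid])
      (simp_all add: ent_matrix_unit Cmp_zero_right Mor_zero_closed)
  finally show ?thesis
    by (simp add: ent_matrix_unit Cmp_zero_right)
qed

lemma ent_Cmp_matrix_unit_left:
  assumes W: "W \<in> Obj D" and h: "h \<in> carrier (Mor D X W)" and jl: "j' \<in> J Y" "l \<in> J W"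
  shows "ent Y W j' l (Cmp D Y X W (matrix_unit Y j X i f) h) =
    (if j' = j then Cmp C (ob Y j) (ob X i) (ob W l) f (ent X W i l h)
     else \<zero>\<^bsub>Mor C (ob Y j') (ob W l)\<^esub>)"
proof -
  note [simp] = X Y W h jl i j f ob_closed ent_closed matrix_unit_closed Cmp_closed finite_J
  have "ent Y W j' l (Cmp D Y X W (matrix_unit Y j X i f) h) =
      (\<Oplus>\<^bsub>Mor C (ob Y j') (ob W l)\<^esub>i'\<in>J X. Cmp C (ob Y j') (ob X i') (ob W l)
        (ent Y X j' i' (matrix_unit Y j X i f)) (ent X W i' l h))"
    by (simp add: ent_Cmp)
  also have "\<dots> =
      Cmp C (ob Y j') (ob X i) (ob W l) (ent Y X j' i (matrix_unit Y j X i f)) (ent X W i l h)"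
    by (rule abelian_monoid.finsum_eq_single[OF Mor_abelian_monoid])
      (simp_all add: ent_matrix_unit Cmp_zero_left Mor_zero_closed)
  finally show ?thesis
    by (simp add: ent_matrix_unit Cmp_zero_left)
qed

end

lemma matrix_unit_Cmp:
  assumes XYZ: "X \<in> Obj D" "Y \<in> Obj D" "Z \<in> Obj D" and ijk: "i \<in> J X" "j \<in> J Y" "k \<in> J Z"
    and g: "g \<in> carrier (Mor C (ob Z k) (ob Y j))" and f: "f \<in> carrier (Mor C (ob Y j) (ob X i))"
  shows "Cmp D Z Y X (matrix_unit Z k Y j g) (matrix_unit Y j X i f) =
    matrix_unit Z k X i (Cmp C (ob Z k) (ob Y j) (ob X i) g f)"
proof (rule ent_inj[OF XYZ(1,3)])
  note [simp] = XYZ ijk g f matrix_unit_closed ob_closed Cmp_closed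
  show "Cmp D Z Y X (matrix_unit Z k Y j g) (matrix_unit Y j X i f) \<in> carrier (Mor D Z X)"
    and "matrix_unit Z k X i (Cmp C (ob Z k) (ob Y j) (ob X i) g f) \<in> carrier (Mor D Z X)"
    by (simp_all add: D_Cmp_closed)
  fix k' i' assume "k' \<in> J Z" "i' \<in> J X"
  then show "ent Z X k' i' (Cmp D Z Y X (matrix_unit Z k Y j g) (matrix_unit Y j X i f)) =
      ent Z X k' i' (matrix_unit Z k X i (Cmp C (ob Z k) (ob Y j) (ob X i) g f))"
    by (simp add: ent_Cmp_matrix_unit_right ent_matrix_unit Cmp_zero_left)
qed

lemma eq_matrix_unit:
  assumes XY: "X \<in> Obj D" "Y \<in> Obj D" and ij: "i \<in> J X" "j \<in> J Y" and h: "h \<in> carrier (Mor D Y X)"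
    and left: "Cmp D Y Y X (matrix_unit Y j Y j (Idt C (ob Y j))) h = h"
    and right: "Cmp D Y X X h (matrix_unit X i X i (Idt C (ob X i))) = h"
  shows "h = matrix_unit Y j X i (ent Y X j i h)"
proof (rule ent_inj[OF XY h])
  note [simp] = XY ij h ob_closed ent_closed Idt_closed
  show "matrix_unit Y j X i (ent Y X j i h) \<in> carrier (Mor D Y X)"
    by (simp add: matrix_unit_closed)
  fix j' i' assume ji: "j' \<in> J Y" "i' \<in> J X"
  have "ent Y X j' i' h = \<zero>\<^bsub>Mor C (ob Y j') (ob X i')\<^esub>" if "j' \<noteq> j"
    using that ji by (subst left[symmetric]) (simp add: ent_Cmp_matrix_unit_left)
  moreover have "ent Y X j' i' h = \<zero>\<^bsub>Mor C (ob Y j') (ob X i')\<^esub>" if "i' \<noteq> i"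
    using that ji by (subst right[symmetric]) (simp add: ent_Cmp_matrix_unit_right)
  ultimately show "ent Y X j' i' h = ent Y X j' i' (matrix_unit Y j X i (ent Y X j i h))"
    using ji by (auto simp: ent_matrix_unit)
qed

lemma matrix_unit_linear:
  assumes "X \<in> Obj D" "Y \<in> Obj D" "i \<in> J X" "j \<in> J Y"
  shows "matrix_unit Y j X i \<in> linear_maps K (Mor C (ob Y j) (ob X i)) (Mor D Y X)"
proof (rule linear_if_ent_linear)
  fix j' i' assume ji: "j' \<in> J Y" "i' \<in> J X"
  have "(\<lambda>f. if j' = j \<and> i' = i then f else \<zero>\<^bsub>Mor C (ob Y j') (ob X i')\<^esub>)
      \<in> linear_maps K (Mor C (ob Y j) (ob X i)) (Mor C (ob Y j') (ob X i'))"
    using assms ji by (cases "j' = j \<and> i' = i")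
      (auto simp: linear_maps_id ob_closed intro!: linear_maps_const_zero Mor_module)
  then show "(\<lambda>f. ent Y X j' i' (matrix_unit Y j X i f))
      \<in> linear_maps K (Mor C (ob Y j) (ob X i)) (Mor C (ob Y j') (ob X i'))"
    by (rule linear_maps_cong) (use assms ji in
        \<open>simp_all add: Mor_module ob_closed ent_matrix_unit\<close>)
qed (use assms in \<open>simp_all add: Mor_module ob_closed matrix_unit_closed\<close>)

lemma sum_matrix_units:
  assumes X: "X \<in> Obj D"
  shows "(\<Oplus>\<^bsub>Mor D X X\<^esub>i\<in>J X. matrix_unit X i X i (Idt C (ob X i))) = Idt D X"
proof (rule ent_inj[OF X X])
  note [simp] = X matrix_unit_closed Idt_closed ob_closed ent_closed finite_J
  show "(\<Oplus>\<^bsub>Mor D X X\<^esub>i\<in>J X. matrix_unit X i X i (Idt C (ob X i))) \<in> carrier (Mor D X X)"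
    by (rule module_finsum_closed[OF D_module]) simp_all
  fix j i assume [simp]: "j \<in> J X" "i \<in> J X"
  have "ent X X j i (\<Oplus>\<^bsub>Mor D X X\<^esub>l\<in>J X. matrix_unit X l X l (Idt C (ob X l))) =
      ent X X j i (matrix_unit X i X i (Idt C (ob X i)))"
    by (subst ent_finsum, simp_all, rule abelian_monoid.finsum_eq_single[OF Mor_abelian_monoid])
      (auto simp: ent_matrix_unit Mor_zero_closed)
  then show "ent X X j i (\<Oplus>\<^bsub>Mor D X X\<^esub>l\<in>J X. matrix_unit X l X l (Idt C (ob X l))) =
      ent X X j i (Idt D X)"
    by (auto simp: ent_matrix_unit ent_Idt)
qed (simp add: X D_Idt_closed)

definition img :: "'o \<Rightarrow> 'p" where
  "img c = (SOME X. X \<in> Obj D \<and> (\<exists>i\<in>J X. ob X i = c))"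

definition pos :: "'o \<Rightarrow> 'j" where
  "pos c = (SOME i. i \<in> J (img c) \<and> ob (img c) i = c)"

lemma
  assumes "c \<in> Obj C"
  shows img_closed: "img c \<in> Obj D" and pos_closed: "pos c \<in> J (img c)"
    and ob_img_pos: "ob (img c) (pos c) = c"
proof -
  have img: "img c \<in> Obj D \<and> (\<exists>i\<in>J (img c). ob (img c) i = c)"
    unfolding img_def by (rule someI_ex) (use ob_surj[OF assms] in blast)
  then have "\<exists>i. i \<in> J (img c) \<and> ob (img c) i = c" by blast
  then have "pos c \<in> J (img c) \<and> ob (img c) (pos c) = c"
    unfolding pos_def by (rule someI_ex)
  with img show "img c \<in> Obj D" "pos c \<in> J (img c)" "ob (img c) (pos c) = c" by auto
qed

theorem full_corner_matrix_units:
  "full_corner K C D img (\<lambda>c' c. matrix_unit (img c') (pos c') (img c) (pos c)) J ob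
    (\<lambda>X i. matrix_unit (img (ob X i)) (pos (ob X i)) X i (Idt C (ob X i)))
    (\<lambda>X i. matrix_unit X i (img (ob X i)) (pos (ob X i)) (Idt C (ob X i)))"
proof (intro full_corner.intro full_corner_axioms.intro k_category_axioms k_category_presented)
  note [simp] = img_closed pos_closed ob_img_pos
  fix c c' assume c[simp]: "c \<in> Obj C" "c' \<in> Obj C"
  show "matrix_unit (img c') (pos c') (img c) (pos c)
      \<in> linear_maps K (Mor C c' c) (Mor D (img c') (img c))"
    using matrix_unit_linear[of "img c" "img c'" "pos c" "pos c'"] by simp
  show "inj_on (matrix_unit (img c') (pos c') (img c) (pos c)) (carrier (Mor C c' c))"
    by (rule inj_on_inverseI[where g = "ent (img c') (img c) (pos c') (pos c)"])
      (simp add: ent_matrix_unit)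
  show "h \<in> matrix_unit (img c') (pos c') (img c) (pos c) ` carrier (Mor C c' c)"
    if "h \<in> carrier (Mor D (img c') (img c))"
      "Cmp D (img c') (img c') (img c) (matrix_unit (img c') (pos c') (img c') (pos c') (Idt C c'))
          h = h"
      "Cmp D (img c') (img c) (img c) h (matrix_unit (img c) (pos c) (img c) (pos c) (Idt C c)) = h"
          for h
    using that eq_matrix_unit[of "img c" "img c'" "pos c" "pos c'" h]
      ent_closed[of "img c" "img c'" "pos c" "pos c'" h]
    by (intro image_eqI[where x = "ent (img c') (img c) (pos c') (pos c) h"]) simp_all
next
  fix X assume X: "X \<in> Obj D"
  have "(\<Oplus>\<^bsub>Mor D X X\<^esub>i\<in>J X. Cmp D X (img (ob X i)) X
      (matrix_unit X i (img (ob X i)) (pos (ob X i)) (Idt C (ob X i)))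
      (matrix_unit (img (ob X i)) (pos (ob X i)) X i (Idt C (ob X i)))) =
    (\<Oplus>\<^bsub>Mor D X X\<^esub>i\<in>J X. matrix_unit X i X i (Idt C (ob X i)))"
    by (rule module_finsum_cong[OF D_module[OF X X]])
      (simp_all add: X img_closed pos_closed ob_img_pos ob_closed matrix_unit_closed Idt_closed
        matrix_unit_Cmp Idt_left)
  then show "(\<Oplus>\<^bsub>Mor D X X\<^esub>i\<in>J X. Cmp D X (img (ob X i)) X
      (matrix_unit X i (img (ob X i)) (pos (ob X i)) (Idt C (ob X i)))
      (matrix_unit (img (ob X i)) (pos (ob X i)) X i (Idt C (ob X i)))) = Idt D X"
    by (simp only: sum_matrix_units[OF X])
qed (simp_all add: img_closed pos_closed ob_img_pos finite_J ob_closed matrix_unit_closed Idt_closed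
    matrix_unit_Cmp Idt_left)

corollary morita_equivalent_presented:
  assumes "infinite (UNIV :: 'v set)"
  shows "morita_equivalent TYPE('v) K D C"
  by (rule full_corner.morita_equivalent_corner[OF full_corner_matrix_units assms])

end

section \<open>Smash categories of graded categories\<close>

lemma
  shows Obj_smash_category: "Obj (smash_category K H act D) = Obj D"
    and Mor_smash_category: "Mor (smash_category K H act D) y x =
        direct_sum (hbasis H) (\<lambda>_. Mor D y x)"
    and Idt_smash_category:
      "Idt (smash_category K H act D) x = (\<lambda>b\<in>hbasis H. hunit H b \<odot>\<^bsub>Mor D x x\<^esub> Idt D x)"
    and Cmp_smash_category_extensional:
      "Cmp (smash_category K H act D) z y x F E \<in> extensional (hbasis H)"
  by (simp_all add: smash_category_def pure_tensor_def)

lemma Cmp_smash_category_collapse: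
  assumes V: "module K (Mor D z x)" and fin: "finite (hbasis H)" and d: "d \<in> hbasis H"
    and closed: "\<And>b c a. \<lbrakk>b \<in> hbasis H; c \<in> hbasis H; a \<in> hbasis H\<rbrakk>
      \<Longrightarrow> Cmp D z y x (F b) (act a y x (E c)) \<in> carrier (Mor D z x)"
    and index: "\<And>b. b \<in> hbasis H \<Longrightarrow> \<gamma> b \<in> hbasis H" "\<And>b. b \<in> hbasis H \<Longrightarrow> \<alpha> b \<in> hbasis H"
      "\<And>b. b \<in> hbasis H \<Longrightarrow> \<alpha>' b \<in> hbasis H"
    and coefficient: "\<And>b c a a'. \<lbrakk>b \<in> hbasis H; c \<in> hbasis H; a \<in> hbasis H; a' \<in> hbasis H\<rbrakk>
      \<Longrightarrow> hcomult H b a a' \<otimes>\<^bsub>K\<^esub> hmult H a' c d =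
          (if c = \<gamma> b \<and> a = \<alpha> b \<and> a' = \<alpha>' b then \<one>\<^bsub>K\<^esub> else \<zero>\<^bsub>K\<^esub>)"
  shows "Cmp (smash_category K H act D) z y x F E d =
    (\<Oplus>\<^bsub>Mor D z x\<^esub>b\<in>hbasis H. Cmp D z y x (F b) (act (\<alpha> b) y x (E (\<gamma> b))))"
proof -
  interpret V: module K "Mor D z x" by (rule V)
  have collapse: "(\<Oplus>\<^bsub>Mor D z x\<^esub>c\<in>hbasis H. \<Oplus>\<^bsub>Mor D z x\<^esub>a\<in>hbasis H. \<Oplus>\<^bsub>Mor D z x\<^esub>a'\<in>hbasis H.
      (hcomult H b a a' \<otimes>\<^bsub>K\<^esub> hmult H a' c d) \<odot>\<^bsub>Mor D z x\<^esub> Cmp D z y x (F b) (act a y x (E c))) =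
    Cmp D z y x (F b) (act (\<alpha> b) y x (E (\<gamma> b)))" (is "?sum = _") if b: "b \<in> hbasis H" for b
  proof -
    have "?sum = (hcomult H b (\<alpha> b) (\<alpha>' b) \<otimes>\<^bsub>K\<^esub> hmult H (\<alpha>' b) (\<gamma> b) d) \<odot>\<^bsub>Mor D z x\<^esub>
        Cmp D z y x (F b) (act (\<alpha> b) y x (E (\<gamma> b)))"
      by (rule V.finsum_eq_single3[where p = "\<gamma> b" and q = "\<alpha> b" and r = "\<alpha>' b"])
        (use b fin in \<open>auto simp: coefficient closed index\<close>)
    then show ?thesis
      using b by (simp add: coefficient closed index)
  qed
  show ?thesis
    using d by (simp add: smash_category_def collapse closed index Pi_def cong: V.finsum_cong)
qed

lemma
  shows hbasis_group_algebra: "hbasis (group_algebra K G) = carrier G"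
    and hmult_group_algebra:
      "hmult (group_algebra K G) s t d = (if s \<otimes>\<^bsub>G\<^esub> t = d then \<one>\<^bsub>K\<^esub> else \<zero>\<^bsub>K\<^esub>)"
    and hunit_group_algebra: "hunit (group_algebra K G) d = (if d = \<one>\<^bsub>G\<^esub> then \<one>\<^bsub>K\<^esub> else \<zero>\<^bsub>K\<^esub>)"
    and hcomult_group_algebra:
      "hcomult (group_algebra K G) s u v = (if u = s \<and> v = s then \<one>\<^bsub>K\<^esub> else \<zero>\<^bsub>K\<^esub>)"
  by (simp_all add: group_algebra_def)

lemma
  shows hbasis_dual_group_algebra: "hbasis (dual_group_algebra K G) = carrier G"
    and hmult_dual_group_algebra:
      "hmult (dual_group_algebra K G) s t d = (if s = t \<and> d = s then \<one>\<^bsub>K\<^esub> else \<zero>\<^bsub>K\<^esub>)"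
    and hunit_dual_group_algebra: "hunit (dual_group_algebra K G) d = \<one>\<^bsub>K\<^esub>"
    and hcomult_dual_group_algebra:
      "hcomult (dual_group_algebra K G) s u v = (if u \<otimes>\<^bsub>G\<^esub> v = s then \<one>\<^bsub>K\<^esub> else \<zero>\<^bsub>K\<^esub>)"
  by (simp_all add: dual_group_algebra_def)

locale graded_k_category = k_category K B + G: group G
  for K :: "('k, 'r) ring_scheme" and G :: "('g, 'q) monoid_scheme" (structure)
    and B :: "('k, 'o, 'm) kcat" +
  fixes part :: "'g \<Rightarrow> 'o \<Rightarrow> 'o \<Rightarrow> 'm \<Rightarrow> 'm"
  assumes finite_group: "finite (carrier G)"
    and part_linear: "\<lbrakk>u \<in> carrier G; X \<in> Obj B; Y \<in> Obj B\<rbrakk>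
      \<Longrightarrow> part u Y X \<in> linear_maps K (Mor B Y X) (Mor B Y X)"
    and part_part: "\<lbrakk>u \<in> carrier G; v \<in> carrier G; X \<in> Obj B; Y \<in> Obj B; f \<in> carrier (Mor B Y X)\<rbrakk>
      \<Longrightarrow> part u Y X (part v Y X f) = (if u = v then part v Y X f else \<zero>\<^bsub>Mor B Y X\<^esub>)"
    and sum_parts: "\<lbrakk>X \<in> Obj B; Y \<in> Obj B; f \<in> carrier (Mor B Y X)\<rbrakk>
      \<Longrightarrow> (\<Oplus>\<^bsub>Mor B Y X\<^esub>u\<in>carrier G. part u Y X f) = f"
        and part_Cmp_parts: "\<lbrakk>u \<in> carrier G; v \<in> carrier G; w \<in> carrier G; X \<in> Obj B; Y \<in> Obj B;
        Z \<in> Obj B;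
        g \<in> carrier (Mor B Z Y); f \<in> carrier (Mor B Y X)\<rbrakk>
      \<Longrightarrow> part w Z X (Cmp B Z Y X (part u Z Y g) (part v Y X f)) =
          (if w = u \<otimes> v then Cmp B Z Y X (part u Z Y g) (part v Y X f) else \<zero>\<^bsub>Mor B Z X\<^esub>)"
    and part_Idt: "\<lbrakk>u \<in> carrier G; X \<in> Obj B\<rbrakk>
      \<Longrightarrow> part u X X (Idt B X) = (if u = \<one> then Idt B X else \<zero>\<^bsub>Mor B X X\<^esub>)"
begin

lemma part_closed:
  "\<lbrakk>u \<in> carrier G; X \<in> Obj B; Y \<in> Obj B; f \<in> carrier (Mor B Y X)\<rbrakk>
    \<Longrightarrow> part u Y X f \<in> carrier (Mor B Y X)"
  by (rule linear_maps_closed[OF part_linear])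

lemma part_zero:
  "\<lbrakk>u \<in> carrier G; X \<in> Obj B; Y \<in> Obj B\<rbrakk> \<Longrightarrow> part u Y X \<zero>\<^bsub>Mor B Y X\<^esub> = \<zero>\<^bsub>Mor B Y X\<^esub>"
  by (rule linear_maps_zero[OF part_linear Mor_module Mor_module])

lemma part_finsum:
  "\<lbrakk>u \<in> carrier G; X \<in> Obj B; Y \<in> Obj B; finite A; \<And>i. i \<in> A \<Longrightarrow> f i \<in> carrier (Mor B Y X)\<rbrakk>
    \<Longrightarrow> part u Y X (\<Oplus>\<^bsub>Mor B Y X\<^esub>i\<in>A. f i) = (\<Oplus>\<^bsub>Mor B Y X\<^esub>i\<in>A. part u Y X (f i))"
  by (rule linear_maps_finsum[OF part_linear Mor_module Mor_module])

lemma part_Cmp_part: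
  assumes [simp]: "u \<in> carrier G" "w \<in> carrier G" "X \<in> Obj B" "Y \<in> Obj B" "Z \<in> Obj B"
    "g \<in> carrier (Mor B Z Y)" "f \<in> carrier (Mor B Y X)"
  shows "part w Z X (Cmp B Z Y X g (part u Y X f)) =
    Cmp B Z Y X (part (w \<otimes> inv u) Z Y g) (part u Y X f)"
proof -
  note [simp] = part_closed Cmp_closed finite_group
  have "part w Z X (Cmp B Z Y X (\<Oplus>\<^bsub>Mor B Z Y\<^esub>s\<in>carrier G. part s Z Y g) (part u Y X f)) =
    (\<Oplus>\<^bsub>Mor B Z X\<^esub>s\<in>carrier G. part w Z X (Cmp B Z Y X (part s Z Y g) (part u Y X f)))"
    by (simp add: Cmp_finsum_left part_finsum)
  also have "\<dots> = part w Z X (Cmp B Z Y X (part (w \<otimes> inv u) Z Y g) (part u Y X f))"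
    by (rule abelian_monoid.finsum_eq_single[OF Mor_abelian_monoid])
      (auto simp: part_Cmp_parts G.word_simps)
  finally show ?thesis
    by (simp add: sum_parts part_Cmp_parts G.word_simps)
qed

lemma eq_if_parts_eq:
  assumes "X \<in> Obj B" "Y \<in> Obj B" "f \<in> carrier (Mor B Y X)" "g \<in> carrier (Mor B Y X)"
    and "\<And>u. u \<in> carrier G \<Longrightarrow> part u Y X f = part u Y X g"
  shows "f = g"
proof -
  have "(\<Oplus>\<^bsub>Mor B Y X\<^esub>u\<in>carrier G. part u Y X f) = (\<Oplus>\<^bsub>Mor B Y X\<^esub>u\<in>carrier G. part u Y X g)"
    by (rule Mor_finsum_cong) (use assms in \<open>simp_all add: part_closed\<close>)
  then show ?thesis
    using assms(1-4) by (simp add: sum_parts)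
qed

abbreviation dual_smash :: "('k, 'o, 'g \<Rightarrow> 'm) kcat" where
  "dual_smash \<equiv> smash_category K (dual_group_algebra K G) part B"

lemma
  shows Obj_dual_smash: "Obj dual_smash = Obj B"
    and carrier_Mor_dual_smash:
      "carrier (Mor dual_smash Y X) = (\<Pi>\<^sub>E u\<in>carrier G. carrier (Mor B Y X))"
    and dual_smash_zero: "\<zero>\<^bsub>Mor dual_smash Y X\<^esub> = (\<lambda>u\<in>carrier G. \<zero>\<^bsub>Mor B Y X\<^esub>)"
    and dual_smash_component_linear:
      "u \<in> carrier G \<Longrightarrow> (\<lambda>F. F u) \<in> linear_maps K (Mor dual_smash Y X) (Mor B Y X)"
  by (simp_all add: Obj_smash_category Mor_smash_category hbasis_dual_group_algebra
      carrier_direct_sum_finite finite_group direct_sum_zero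
      direct_sum_proj_linear[where V = "\<lambda>_. Mor B Y X"])

lemma dual_smash_component_closed:
  "\<lbrakk>F \<in> carrier (Mor dual_smash Y X); u \<in> carrier G\<rbrakk> \<Longrightarrow> F u \<in> carrier (Mor B Y X)"
  by (rule linear_maps_closed[OF dual_smash_component_linear])

lemma module_Mor_dual_smash:
  "\<lbrakk>X \<in> Obj B; Y \<in> Obj B\<rbrakk> \<Longrightarrow> module K (Mor dual_smash Y X)"
  unfolding Mor_smash_category hbasis_dual_group_algebra
  by (rule module_direct_sum) (simp_all add: is_cring finite_group Mor_module)

lemma Idt_dual_smash: "X \<in> Obj B \<Longrightarrow> Idt dual_smash X = (\<lambda>u\<in>carrier G. Idt B X)"
  by (simp add: Idt_smash_category hbasis_dual_group_algebra hunit_dual_group_algebra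
      module.smult_one[OF Mor_module] Idt_closed cong: restrict_cong)

lemma Idt_dual_smash_closed: "X \<in> Obj B \<Longrightarrow> Idt dual_smash X \<in> carrier (Mor dual_smash X X)"
  by (simp add: Idt_dual_smash carrier_Mor_dual_smash Idt_closed)

context
  fixes X Y Z F E
  assumes XYZ [simp]: "X \<in> Obj B" "Y \<in> Obj B" "Z \<in> Obj B"
    and F: "F \<in> carrier (Mor dual_smash Z Y)" and E: "E \<in> carrier (Mor dual_smash Y X)"
begin

lemma Cmp_dual_smash:
  assumes d [simp]: "d \<in> carrier G"
  shows "Cmp dual_smash Z Y X F E d =
    (\<Oplus>\<^bsub>Mor B Z X\<^esub>b\<in>carrier G. Cmp B Z Y X (F b) (part (b \<otimes> inv d) Y X (E d)))"
proof (subst Cmp_smash_category_collapse[where \<gamma> = "\<lambda>b. d" and \<alpha> = "\<lambda>b. b \<otimes> inv d"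
      and \<alpha>' = "\<lambda>b. d"])
  show "hcomult (dual_group_algebra K G) b a a' \<otimes>\<^bsub>K\<^esub> hmult (dual_group_algebra K G) a' c d =
      (if c = d \<and> a = b \<otimes> inv d \<and> a' = d then \<one>\<^bsub>K\<^esub> else \<zero>\<^bsub>K\<^esub>)"
    if "b \<in> hbasis (dual_group_algebra K G)" "c \<in> hbasis (dual_group_algebra K G)"
      "a \<in> hbasis (dual_group_algebra K G)" "a' \<in> hbasis (dual_group_algebra K G)" for b c a a'
    using that by (auto simp: hbasis_dual_group_algebra hmult_dual_group_algebra
        hcomult_dual_group_algebra G.word_simps)
qed (simp_all add: hbasis_dual_group_algebra finite_group Mor_module Cmp_closed part_closed
    dual_smash_component_closed[OF F] dual_smash_component_closed[OF E])

lemma Cmp_dual_smash_closed: "Cmp dual_smash Z Y X F E \<in> carrier (Mor dual_smash Z X)"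
proof -
  have "Cmp dual_smash Z Y X F E d \<in> carrier (Mor B Z X)" if "d \<in> carrier G" for d
    using that by (simp add: Cmp_dual_smash, intro Mor_finsum_closed)
      (simp_all add: Cmp_closed part_closed dual_smash_component_closed[OF F]
        dual_smash_component_closed[OF E])
  then show ?thesis
    using Cmp_smash_category_extensional[of K "dual_group_algebra K G" part B Z Y X F E]
    by (auto simp: carrier_Mor_dual_smash PiE_iff hbasis_dual_group_algebra)
qed

end

abbreviation double_smash :: "('k, 'o, 'g \<Rightarrow> 'g \<Rightarrow> 'm) kcat" where
  "double_smash \<equiv> smash_category K (group_algebra K G) (translation_act G) dual_smash"

lemma
  shows Obj_double_smash: "Obj double_smash = Obj B"
    and carrier_Mor_double_smash:
      "carrier (Mor double_smash Y X) = (\<Pi>\<^sub>E v\<in>carrier G. \<Pi>\<^sub>E a\<in>carrier G. carrier (Mor B Y X))"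
  by (simp_all add: Obj_smash_category Mor_smash_category[of K "group_algebra K G"]
      hbasis_group_algebra carrier_direct_sum_finite finite_group carrier_Mor_dual_smash)

lemma double_smash_closed:
  "\<lbrakk>F \<in> carrier (Mor double_smash Y X); v \<in> carrier G\<rbrakk> \<Longrightarrow> F v \<in> carrier (Mor dual_smash Y X)"
  by (auto simp: carrier_Mor_double_smash carrier_Mor_dual_smash)

lemma double_smash_component_closed:
  "\<lbrakk>F \<in> carrier (Mor double_smash Y X); v \<in> carrier G; a \<in> carrier G\<rbrakk> \<Longrightarrow> F v a \<in> carrier (Mor B Y X)"
  by (rule dual_smash_component_closed[OF double_smash_closed])

lemma double_smash_component_linear:
  assumes "v \<in> carrier G" "a \<in> carrier G"
  shows "(\<lambda>F. F v a) \<in> linear_maps K (Mor double_smash Y X) (Mor B Y X)"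
  unfolding Mor_smash_category[of K "group_algebra K G"] hbasis_group_algebra
  by (rule linear_maps_comp[OF direct_sum_proj_linear[where V = "\<lambda>_. Mor dual_smash Y X"]
        dual_smash_component_linear]) (use assms in simp_all)

lemma module_Mor_double_smash:
  "\<lbrakk>X \<in> Obj B; Y \<in> Obj B\<rbrakk> \<Longrightarrow> module K (Mor double_smash Y X)"
  unfolding Mor_smash_category[of K "group_algebra K G"] hbasis_group_algebra
  by (rule module_direct_sum) (simp_all add: is_cring finite_group module_Mor_dual_smash)

lemma Idt_double_smash:
  assumes X: "X \<in> Obj B"
  shows "Idt double_smash X =
    (\<lambda>v\<in>carrier G. \<lambda>a\<in>carrier G. if v = \<one> then Idt B X else \<zero>\<^bsub>Mor B X X\<^esub>)"
  using module.smult_l_null[OF module_Mor_dual_smash[OF X X] Idt_dual_smash_closed[OF X]]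
    module.smult_one[OF module_Mor_dual_smash[OF X X] Idt_dual_smash_closed[OF X]]
  by (auto simp: Idt_smash_category[of K "group_algebra K G"] hbasis_group_algebra
      hunit_group_algebra dual_smash_zero Idt_dual_smash[OF X] restrict_def fun_eq_iff)

lemma translation_act_apply: "u \<in> carrier G \<Longrightarrow> translation_act G t Y X F u = F (u \<otimes> t)"
  by (simp add: translation_act_def)

lemma translation_act_closed:
  "\<lbrakk>F \<in> carrier (Mor dual_smash Y X); t \<in> carrier G\<rbrakk>
    \<Longrightarrow> translation_act G t Y X F \<in> carrier (Mor dual_smash Y X)"
  by (auto simp: translation_act_def carrier_Mor_dual_smash)

context
  fixes X Y Z F E
  assumes XYZ [simp]: "X \<in> Obj B" "Y \<in> Obj B" "Z \<in> Obj B"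
    and F: "F \<in> carrier (Mor double_smash Z Y)" and E: "E \<in> carrier (Mor double_smash Y X)"
begin

lemma Cmp_double_smash:
  assumes d [simp]: "d \<in> carrier G"
  shows "Cmp double_smash Z Y X F E d = (\<Oplus>\<^bsub>Mor dual_smash Z X\<^esub>b\<in>carrier G.
    Cmp dual_smash Z Y X (F b) (translation_act G b Y X (E (inv b \<otimes> d))))"
proof (subst Cmp_smash_category_collapse[where \<gamma> = "\<lambda>b. inv b \<otimes> d" and \<alpha> = "\<lambda>b. b"
      and \<alpha>' = "\<lambda>b. b"])
  show "hcomult (group_algebra K G) b a a' \<otimes>\<^bsub>K\<^esub> hmult (group_algebra K G) a' c d =
      (if c = inv b \<otimes> d \<and> a = b \<and> a' = b then \<one>\<^bsub>K\<^esub> else \<zero>\<^bsub>K\<^esub>)"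
    if "b \<in> hbasis (group_algebra K G)" "c \<in> hbasis (group_algebra K G)"
      "a \<in> hbasis (group_algebra K G)" "a' \<in> hbasis (group_algebra K G)" for b c a a'
    using that by (auto simp: hbasis_group_algebra hmult_group_algebra hcomult_group_algebra
        G.word_simps)
qed (simp_all add: hbasis_group_algebra finite_group module_Mor_dual_smash Cmp_dual_smash_closed
    translation_act_closed double_smash_closed[OF F] double_smash_closed[OF E])

lemma Cmp_double_smash_closed: "Cmp double_smash Z Y X F E \<in> carrier (Mor double_smash Z X)"
proof -
  have "Cmp double_smash Z Y X F E d \<in> carrier (Mor dual_smash Z X)" if "d \<in> carrier G" for d
    using that by (simp add: Cmp_double_smash, intro module_finsum_closed[OF module_Mor_dual_smash])
      (simp_all add: Cmp_dual_smash_closed translation_act_closed double_smash_closed[OF F]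
        double_smash_closed[OF E])
  then show ?thesis
    using Cmp_smash_category_extensional[of K "group_algebra K G"
        "translation_act G" dual_smash Z Y X F E]
    by (auto simp: carrier_Mor_double_smash carrier_Mor_dual_smash PiE_iff hbasis_group_algebra)
qed

lemma Cmp_double_smash_component:
  assumes d [simp]: "d \<in> carrier G" and w [simp]: "w \<in> carrier G"
  shows "Cmp double_smash Z Y X F E d w = (\<Oplus>\<^bsub>Mor B Z X\<^esub>c\<in>carrier G. \<Oplus>\<^bsub>Mor B Z X\<^esub>b\<in>carrier G.
    Cmp B Z Y X (F b c) (part (c \<otimes> inv w) Y X (E (inv b \<otimes> d) (w \<otimes> b))))"
proof -
  note [simp] = Cmp_dual_smash_closed translation_act_closed double_smash_closed[OF F]
    double_smash_closed[OF E]
  have "Cmp double_smash Z Y X F E d w = (\<Oplus>\<^bsub>Mor B Z X\<^esub>b\<in>carrier G.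
      Cmp dual_smash Z Y X (F b) (translation_act G b Y X (E (inv b \<otimes> d))) w)"
    unfolding Cmp_double_smash[OF d]
    by (rule linear_maps_finsum[OF dual_smash_component_linear[OF w]])
      (simp_all add: module_Mor_dual_smash Mor_module finite_group)
  also have "\<dots> = (\<Oplus>\<^bsub>Mor B Z X\<^esub>b\<in>carrier G. \<Oplus>\<^bsub>Mor B Z X\<^esub>c\<in>carrier G.
    Cmp B Z Y X (F b c) (part (c \<otimes> inv w) Y X (E (inv b \<otimes> d) (w \<otimes> b))))"
    by (rule Mor_finsum_cong)
      (auto simp: Cmp_dual_smash translation_act_apply part_closed Cmp_closed
        double_smash_component_closed[OF F] double_smash_component_closed[OF E]
        intro!: Mor_finsum_closed)
  also have "\<dots> = (\<Oplus>\<^bsub>Mor B Z X\<^esub>c\<in>carrier G. \<Oplus>\<^bsub>Mor B Z X\<^esub>b\<in>carrier G.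
    Cmp B Z Y X (F b c) (part (c \<otimes> inv w) Y X (E (inv b \<otimes> d) (w \<otimes> b))))"
    by (rule abelian_monoid.finsum_swap[OF Mor_abelian_monoid])
      (simp_all add: finite_group part_closed Cmp_closed double_smash_component_closed[OF F]
        double_smash_component_closed[OF E])
  finally show ?thesis .
qed

end

text \<open>The element \<open>f \<otimes> \<delta> a \<otimes> v\<close> with \<open>f\<close> of degree \<open>u\<close> corresponds to the matrix unit with entry
  \<open>f\<close> in row \<open>u a\<close> and column \<open>a v\<close>.\<close>

definition duality_entry :: "'o \<Rightarrow> 'o \<Rightarrow> 'g \<Rightarrow> 'g \<Rightarrow> ('g \<Rightarrow> 'g \<Rightarrow> 'm) \<Rightarrow> 'm" where
  "duality_entry Y X j i F =
     (\<Oplus>\<^bsub>Mor B Y X\<^esub>a\<in>carrier G. part (j \<otimes> inv a) Y X (F (inv a \<otimes> i) a))"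

lemma duality_entry_linear:
  assumes "X \<in> Obj B" "Y \<in> Obj B" "i \<in> carrier G" "j \<in> carrier G"
  shows "duality_entry Y X j i \<in> linear_maps K (Mor double_smash Y X) (Mor B Y X)"
proof -
  have "(\<lambda>F. \<Oplus>\<^bsub>Mor B Y X\<^esub>a\<in>carrier G. part (j \<otimes> inv a) Y X (F (inv a \<otimes> i) a))
      \<in> linear_maps K (Mor double_smash Y X) (Mor B Y X)"
    using assms by (intro linear_maps_pointwise_finsum Mor_module finite_group
        linear_maps_comp[OF double_smash_component_linear part_linear]) simp_all
  then show ?thesis
    by (simp add: duality_entry_def[abs_def])
qed

lemma part_duality_entry:
  assumes [simp]: "X \<in> Obj B" "Y \<in> Obj B" "i \<in> carrier G" "j \<in> carrier G" "a \<in> carrier G"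
    and F: "F \<in> carrier (Mor double_smash Y X)"
  shows "part (j \<otimes> inv a) Y X (duality_entry Y X j i F) = part (j \<otimes> inv a) Y X (F (inv a \<otimes> i) a)"
proof -
  note [simp] = double_smash_component_closed[OF F] part_closed finite_group
  have "part (j \<otimes> inv a) Y X (duality_entry Y X j i F) = (\<Oplus>\<^bsub>Mor B Y X\<^esub>b\<in>carrier G.
      part (j \<otimes> inv a) Y X (part (j \<otimes> inv b) Y X (F (inv b \<otimes> i) b)))"
    unfolding duality_entry_def by (rule part_finsum) simp_all
  also have "\<dots> = part (j \<otimes> inv a) Y X (part (j \<otimes> inv a) Y X (F (inv a \<otimes> i) a))"
    by (rule abelian_monoid.finsum_eq_single[OF Mor_abelian_monoid]) (auto simp: part_part)
  finally show ?thesis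
    by (simp add: part_part)
qed

lemma duality_entry_Idt:
  assumes [simp]: "X \<in> Obj B" "i \<in> carrier G" "j \<in> carrier G"
  shows "duality_entry X X j i (Idt double_smash X) = (if j = i then Idt B X else \<zero>\<^bsub>Mor B X X\<^esub>)"
proof -
  have "duality_entry X X j i (Idt double_smash X) =
      part (j \<otimes> inv i) X X (Idt double_smash X (inv i \<otimes> i) i)"
    unfolding duality_entry_def
    by (rule abelian_monoid.finsum_eq_single[OF Mor_abelian_monoid])
      (auto simp: finite_group part_closed Idt_double_smash Idt_closed G.inv_mult_eq_one_iff
          part_zero)
  then show ?thesis
    using G.inv_mult_eq_one_iff[of "inv j" "inv i"]
    by (auto simp: Idt_double_smash part_Idt)
qed

lemma duality_entry_inj:
  assumes XY [simp]: "X \<in> Obj B" "Y \<in> Obj B" and F: "F \<in> carrier (Mor double_smash Y X)"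
    and E: "E \<in> carrier (Mor double_smash Y X)"
    and eq: "\<And>j i. \<lbrakk>j \<in> carrier G; i \<in> carrier G\<rbrakk> \<Longrightarrow> duality_entry Y X j i F =
        duality_entry Y X j i E"
  shows "F = E"
proof (rule PiE_ext[OF F[unfolded carrier_Mor_double_smash] E[unfolded carrier_Mor_double_smash]],
    rule PiE_ext[OF double_smash_closed[OF F, unfolded carrier_Mor_dual_smash]
      double_smash_closed[OF E, unfolded carrier_Mor_dual_smash]])
  fix v a assume [simp]: "v \<in> carrier G" "a \<in> carrier G"
  show "F v a = E v a"
  proof (rule eq_if_parts_eq[OF XY double_smash_component_closed[OF F]
        double_smash_component_closed[OF E]])
    show "part u Y X (F v a) = part u Y X (E v a)" if [simp]: "u \<in> carrier G" for u
      using part_duality_entry[OF XY, of "a \<otimes> v" "u \<otimes> a" a F] eq[of "u \<otimes> a" "a \<otimes> v"]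
        part_duality_entry[OF XY, of "a \<otimes> v" "u \<otimes> a" a E] F E by (simp add: G.word_simps)
  qed simp_all
qed simp_all

lemma duality_entry_surj:
  assumes XY [simp]: "X \<in> Obj B" "Y \<in> Obj B"
    and m: "\<And>j i. \<lbrakk>j \<in> carrier G; i \<in> carrier G\<rbrakk> \<Longrightarrow> m j i \<in> carrier (Mor B Y X)"
  shows "\<exists>F\<in>carrier (Mor double_smash Y X). \<forall>j\<in>carrier G. \<forall>i\<in>carrier G. duality_entry Y X j i F =
      m j i"
proof -
  note [simp] = part_closed m finite_group
  define F where "F = (\<lambda>v\<in>carrier G. \<lambda>a\<in>carrier G.
    \<Oplus>\<^bsub>Mor B Y X\<^esub>j\<in>carrier G. part (j \<otimes> inv a) Y X (m j (a \<otimes> v)))"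
  have F: "F \<in> carrier (Mor double_smash Y X)"
    by (auto simp: F_def carrier_Mor_double_smash intro!: Mor_finsum_closed)
  have part_F: "part (j \<otimes> inv a) Y X (F (inv a \<otimes> i) a) = part (j \<otimes> inv a) Y X (m j i)"
    if [simp]: "i \<in> carrier G" "j \<in> carrier G" "a \<in> carrier G" for i j a
  proof -
    have "part (j \<otimes> inv a) Y X (F (inv a \<otimes> i) a) = (\<Oplus>\<^bsub>Mor B Y X\<^esub>l\<in>carrier G.
        part (j \<otimes> inv a) Y X (part (l \<otimes> inv a) Y X (m l i)))"
      by (simp add: F_def G.word_simps part_finsum)
    also have "\<dots> = part (j \<otimes> inv a) Y X (part (j \<otimes> inv a) Y X (m j i))"
      by (rule abelian_monoid.finsum_eq_single[OF Mor_abelian_monoid]) (auto simp: part_part)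
    finally show ?thesis
      by (simp add: part_part)
  qed
  have "duality_entry Y X j i F = m j i" if [simp]: "j \<in> carrier G" "i \<in> carrier G" for j i
  proof (rule eq_if_parts_eq[OF XY])
    show "part u Y X (duality_entry Y X j i F) = part u Y X (m j i)" if [simp]: "u \<in> carrier G"
        for u
      using part_duality_entry[OF XY, of i j "inv u \<otimes> j" F] part_F[of i j "inv u \<otimes> j"] F
      by (simp add: G.word_simps)
  qed (use F in \<open>simp_all add: linear_maps_closed[OF duality_entry_linear]\<close>)
  then show ?thesis
    using F by blast
qed

lemma duality_entry_Cmp:
  assumes XYZ [simp]: "X \<in> Obj B" "Y \<in> Obj B" "Z \<in> Obj B"
    and F: "F \<in> carrier (Mor double_smash Z Y)" and E: "E \<in> carrier (Mor double_smash Y X)"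
    and [simp]: "i \<in> carrier G" "k \<in> carrier G"
  shows "duality_entry Z X k i (Cmp double_smash Z Y X F E) =
    (\<Oplus>\<^bsub>Mor B Z X\<^esub>j\<in>carrier G. Cmp B Z Y X (duality_entry Z Y k j F) (duality_entry Y X j i E))"
proof -
  interpret M: abelian_monoid "Mor B Z X" by (rule Mor_abelian_monoid) simp_all
  note [simp] = double_smash_component_closed[OF F] double_smash_component_closed[OF E] part_closed
    Cmp_closed finite_group
  let ?g = "\<lambda>c j. part (k \<otimes> inv c) Z Y (F (inv c \<otimes> j) c)"
  let ?f = "\<lambda>j z. part (j \<otimes> inv z) Y X (E (inv z \<otimes> i) z)"
  let ?t = "\<lambda>w b c. Cmp B Z Y X (part (k \<otimes> inv c) Z Y (F b c))
    (part (c \<otimes> inv w) Y X (E (inv b \<otimes> (inv w \<otimes> i)) (w \<otimes> b)))"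
  have "duality_entry Z X k i (Cmp double_smash Z Y X F E) =
      (\<Oplus>\<^bsub>Mor B Z X\<^esub>w\<in>carrier G. \<Oplus>\<^bsub>Mor B Z X\<^esub>c\<in>carrier G. \<Oplus>\<^bsub>Mor B Z X\<^esub>b\<in>carrier G. ?t w b c)"
    unfolding duality_entry_def
    by (simp add: Cmp_double_smash_component[OF XYZ F E] part_finsum part_Cmp_part G.word_simps
        Pi_def Mor_finsum_closed cong: M.finsum_cong)
  also have "\<dots> = (\<Oplus>\<^bsub>Mor B Z X\<^esub>c\<in>carrier G. \<Oplus>\<^bsub>Mor B Z X\<^esub>w\<in>carrier G. \<Oplus>\<^bsub>Mor B Z X\<^esub>b\<in>carrier G. ?t w b c)"
    by (rule M.finsum_swap) (simp_all add: Mor_finsum_closed)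
  also have "\<dots> = (\<Oplus>\<^bsub>Mor B Z X\<^esub>c\<in>carrier G. \<Oplus>\<^bsub>Mor B Z X\<^esub>j\<in>carrier G. \<Oplus>\<^bsub>Mor B Z X\<^esub>z\<in>carrier G.
      Cmp B Z Y X (?g c j) (?f j z))"
  proof (rule M.finsum_cong'[OF refl])
    fix c assume [simp]: "c \<in> carrier G"
    have "(\<Oplus>\<^bsub>Mor B Z X\<^esub>w\<in>carrier G. \<Oplus>\<^bsub>Mor B Z X\<^esub>b\<in>carrier G. ?t w b c) =
        (\<Oplus>\<^bsub>Mor B Z X\<^esub>j\<in>carrier G. \<Oplus>\<^bsub>Mor B Z X\<^esub>z\<in>carrier G. ?t (z \<otimes> inv (inv c \<otimes> j)) (inv c \<otimes> j) c)"
      by (rule G.finsum_shear) (simp_all add: M.abelian_monoid_axioms)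
    also have "\<dots> = (\<Oplus>\<^bsub>Mor B Z X\<^esub>j\<in>carrier G. \<Oplus>\<^bsub>Mor B Z X\<^esub>z\<in>carrier G. Cmp B Z Y X (?g c j) (?f j z))"
      by (simp add: G.word_simps Pi_def Mor_finsum_closed cong: M.finsum_cong)
    finally show "(\<Oplus>\<^bsub>Mor B Z X\<^esub>w\<in>carrier G. \<Oplus>\<^bsub>Mor B Z X\<^esub>b\<in>carrier G. ?t w b c) =
        (\<Oplus>\<^bsub>Mor B Z X\<^esub>j\<in>carrier G. \<Oplus>\<^bsub>Mor B Z X\<^esub>z\<in>carrier G. Cmp B Z Y X (?g c j) (?f j z))" .
  qed (auto intro!: Mor_finsum_closed)
  also have "\<dots> = (\<Oplus>\<^bsub>Mor B Z X\<^esub>j\<in>carrier G. \<Oplus>\<^bsub>Mor B Z X\<^esub>c\<in>carrier G. \<Oplus>\<^bsub>Mor B Z X\<^esub>z\<in>carrier G.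
      Cmp B Z Y X (?g c j) (?f j z))"
    by (rule M.finsum_swap) (simp_all add: Mor_finsum_closed)
  also have "\<dots> = (\<Oplus>\<^bsub>Mor B Z X\<^esub>j\<in>carrier G. \<Oplus>\<^bsub>Mor B Z X\<^esub>c\<in>carrier G. Cmp B Z Y X (?g c j)
      (duality_entry Y X j i E))"
    by (simp add: duality_entry_def Cmp_finsum_right Pi_def cong: M.finsum_cong)
  also have "\<dots> = (\<Oplus>\<^bsub>Mor B Z X\<^esub>j\<in>carrier G.
      Cmp B Z Y X (duality_entry Z Y k j F) (duality_entry Y X j i E))"
    using E by (simp add: duality_entry_def[of Z Y] Cmp_finsum_left Pi_def
        linear_maps_closed[OF duality_entry_linear] cong: M.finsum_cong)
  finally show ?thesis .
qed

theorem double_smash_presented: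
  "full_matrix_presentation K B double_smash (\<lambda>_. carrier G) (\<lambda>X _. X) duality_entry"
proof (intro full_matrix_presentation.intro matrix_presentation.intro k_category_axioms
    matrix_presentation_axioms.intro full_matrix_presentation_axioms.intro, unfold Obj_double_smash)
  show "Idt double_smash X \<in> carrier (Mor double_smash X X)" if "X \<in> Obj B" for X
    using that by (auto simp: Idt_double_smash carrier_Mor_double_smash Idt_closed Mor_zero_closed)
  show "F = E"
    if "X \<in> Obj B" "Y \<in> Obj B" "F \<in> carrier (Mor double_smash Y X)"
        "E \<in> carrier (Mor double_smash Y X)"
      "\<And>j i. \<lbrakk>j \<in> carrier G; i \<in> carrier G\<rbrakk> \<Longrightarrow> duality_entry Y X j i F = duality_entry Y X j i E"
    for X Y F E
    using that by (rule duality_entry_inj)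
  show "\<exists>Y\<in>Obj B. \<exists>i\<in>carrier G. Y = X" if "X \<in> Obj B" for X
    using that G.one_closed by blast
qed (simp_all add: finite_group module_Mor_double_smash Cmp_double_smash_closed duality_entry_linear
    duality_entry_Cmp duality_entry_Idt duality_entry_surj)

end

section \<open>Quotients by free actions of finite groups\<close>

locale finite_free_G_k_category = free_G_k_category K G C \<phi> \<psi>
  for K :: "('k, 'r) ring_scheme" and G :: "('g, 'q) monoid_scheme" (structure)
    and C :: "('k, 'o, 'm) kcat" and \<phi> :: "'g \<Rightarrow> 'o \<Rightarrow> 'o"
    and \<psi> :: "'g \<Rightarrow> 'o \<Rightarrow> 'o \<Rightarrow> 'm \<Rightarrow> 'm" +
  assumes finite_group: "finite (carrier G)"
begin

sublocale G: group G
  using group_hom by (simp add: group_hom_def)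

lemma \<phi>_closed: "\<lbrakk>s \<in> carrier G; a \<in> Obj C\<rbrakk> \<Longrightarrow> \<phi> s a \<in> Obj C"
  by (rule element_image) simp_all

lemma \<phi>_\<phi>: "\<lbrakk>s \<in> carrier G; t \<in> carrier G; a \<in> Obj C\<rbrakk> \<Longrightarrow> \<phi> s (\<phi> t a) = \<phi> (s \<otimes> t) a"
  by (simp add: composition_rule)

lemma \<phi>_one: "a \<in> Obj C \<Longrightarrow> \<phi> \<one> a = a"
  using fun_cong[OF id_eq_one, of a] by simp

lemma \<phi>_eq_iff:
  assumes "s \<in> carrier G" "t \<in> carrier G" "a \<in> Obj C"
  shows "\<phi> s a = \<phi> t a \<longleftrightarrow> s = t"
proof
  assume eq: "\<phi> s a = \<phi> t a"
  have "\<phi> (inv t \<otimes> s) a = \<phi> (inv t) (\<phi> t a)"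
    using assms by (simp add: eq flip: \<phi>_\<phi>)
  then have "inv t \<otimes> s = \<one>"
    using free assms by (simp add: \<phi>_\<phi> \<phi>_one)
  then show "s = t"
    using assms by (simp add: G.inv_mult_eq_one_iff)
qed simp

context
  fixes s a b
  assumes s: "s \<in> carrier G" and ab: "a \<in> Obj C" "b \<in> Obj C"
begin

lemma \<psi>_closed: "f \<in> carrier (Mor C b a) \<Longrightarrow> \<psi> s b a f \<in> carrier (Mor C (\<phi> s b) (\<phi> s a))"
  by (rule linear_maps_closed[OF act_linear[OF s ab]])

lemma \<psi>_zero: "\<psi> s b a \<zero>\<^bsub>Mor C b a\<^esub> = \<zero>\<^bsub>Mor C (\<phi> s b) (\<phi> s a)\<^esub>"
  using s ab by (intro linear_maps_zero[OF act_linear Mor_module Mor_module] \<phi>_closed)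

lemma \<psi>_finsum:
  "\<lbrakk>finite A; \<And>i. i \<in> A \<Longrightarrow> f i \<in> carrier (Mor C b a)\<rbrakk>
    \<Longrightarrow> \<psi> s b a (\<Oplus>\<^bsub>Mor C b a\<^esub>i\<in>A. f i) = (\<Oplus>\<^bsub>Mor C (\<phi> s b) (\<phi> s a)\<^esub>i\<in>A. \<psi> s b a (f i))"
  using s ab by (intro linear_maps_finsum[OF act_linear Mor_module Mor_module] \<phi>_closed)

end

lemma \<psi>_Idt:
  assumes s [simp]: "s \<in> carrier G" and a [simp]: "a \<in> Obj C"
  shows "\<psi> s a a (Idt C a) = Idt C (\<phi> s a)"
proof -
  note [simp] = \<phi>_closed Idt_closed
  let ?preimage = "\<psi> (inv s) (\<phi> s a) (\<phi> s a) (Idt C (\<phi> s a))"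
  have preimage: "?preimage \<in> carrier (Mor C a a)"
    using \<psi>_closed[of "inv s" "\<phi> s a" "\<phi> s a" "Idt C (\<phi> s a)"] by (simp add: \<phi>_\<phi> \<phi>_one)
  have \<psi>_preimage: "\<psi> s a a ?preimage = Idt C (\<phi> s a)"
    using act_mult[of "inv s" s "\<phi> s a" "\<phi> s a" "Idt C (\<phi> s a)"] by (simp add: \<phi>_\<phi> \<phi>_one act_one)
  have "\<psi> s a a (Idt C a) = Cmp C (\<phi> s a) (\<phi> s a) (\<phi> s a) (\<psi> s a a (Idt C a)) (\<psi> s a a ?preimage)"
    by (simp add: \<psi>_preimage Idt_right \<psi>_closed)
  also have "\<dots> = \<psi> s a a (Cmp C a a a (Idt C a) ?preimage)"
    by (simp add: act_Cmp preimage)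
  finally show ?thesis
    by (simp add: Idt_left preimage \<psi>_preimage)
qed

abbreviation orbs :: "'o set set" where
  "orbs \<equiv> orbits G (Obj C) \<phi>"

lemma orbit_in_orbs: "a \<in> Obj C \<Longrightarrow> orbit G \<phi> a \<in> orbs"
  by (auto simp: orbits_def)

lemma orbs_not_empty: "X \<in> orbs \<Longrightarrow> X \<noteq> {}"
  using orbit_refl by (auto simp: orbits_def)

lemma orbs_subset: "\<lbrakk>X \<in> orbs; a \<in> X\<rbrakk> \<Longrightarrow> a \<in> Obj C"
  by (auto simp: orbits_def orbit_def \<phi>_closed)

lemma bij_betw_orbit:
  assumes X: "X \<in> orbs" and a: "a \<in> X"
  shows "bij_betw (\<lambda>s. \<phi> s a) (carrier G) X"
proof -
  obtain b t where b: "b \<in> Obj C" "X = (\<lambda>s. \<phi> s b) ` carrier G" "t \<in> carrier G" "a = \<phi> t b"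
    using X a by (auto simp: orbits_def orbit_def)
  have "bij_betw (\<lambda>s. \<phi> s b) (carrier G) X"
    using b(1,2) by (simp add: bij_betw_def inj_on_def \<phi>_eq_iff)
  from bij_betw_trans[OF G.bij_betw_mult_right[OF b(3)] this] show ?thesis
    by (rule bij_betw_cong[THEN iffD1, rotated]) (simp add: b \<phi>_\<phi>)
qed

context
  fixes X
  assumes X: "X \<in> orbs"
begin

lemma finite_orbit: "finite X"
  using orbs_not_empty[OF X] bij_betw_finite[OF bij_betw_orbit[OF X]] finite_group by blast

lemma orbit_closed: "\<lbrakk>a \<in> X; s \<in> carrier G\<rbrakk> \<Longrightarrow> \<phi> s a \<in> X"
  using bij_betw_apply[OF bij_betw_orbit[OF X]] by blast

lemma orbit_cases:
  assumes "a \<in> X" "b \<in> X"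
  obtains s where "s \<in> carrier G" "b = \<phi> s a"
  using assms bij_betw_imp_surj_on[OF bij_betw_orbit[OF X assms(1)]] by blast

lemma bij_betw_\<phi>: "s \<in> carrier G \<Longrightarrow> bij_betw (\<phi> s) X X"
  by (rule bij_betwI[where g = "\<phi> (inv s)"])
    (auto simp: orbit_closed \<phi>_\<phi> \<phi>_one orbs_subset[OF X])

end

abbreviation action :: "'o set \<Rightarrow> 'o set \<Rightarrow> 'g \<Rightarrow> ('o \<times> 'o \<Rightarrow> 'm) \<Rightarrow> 'o \<times> 'o \<Rightarrow> 'm" where
  "action Y X \<equiv> orbit_sum_act G \<phi> \<psi> Y X"

abbreviation norm :: "'o set \<Rightarrow> 'o set \<Rightarrow> ('o \<times> 'o \<Rightarrow> 'm) \<Rightarrow> 'o \<times> 'o \<Rightarrow> 'm" where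
  "norm Y X \<equiv> group_norm G (orbit_sum C Y X) (action Y X)"

context
  fixes X Y
  assumes X [simp]: "X \<in> orbs" and Y [simp]: "Y \<in> orbs"
begin

lemma carrier_orbit_sum:
  "carrier (orbit_sum C Y X) = (\<Pi>\<^sub>E (b, a)\<in>Y \<times> X. carrier (Mor C b a))"
  by (simp add: orbit_sum_def carrier_direct_sum_finite finite_orbit case_prod_beta')

lemma orbit_sum_closed:
  "\<lbrakk>F \<in> carrier (orbit_sum C Y X); b \<in> Y; a \<in> X\<rbrakk> \<Longrightarrow> F (b, a) \<in> carrier (Mor C b a)"
  using PiE_mem[of F "Y \<times> X" "\<lambda>(b, a). carrier (Mor C b a)" "(b, a)"]
  by (simp add: carrier_orbit_sum)

lemma orbit_sum_eqI:
  assumes "F \<in> carrier (orbit_sum C Y X)" "F' \<in> carrier (orbit_sum C Y X)"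
    and "\<And>b a. \<lbrakk>b \<in> Y; a \<in> X\<rbrakk> \<Longrightarrow> F (b, a) = F' (b, a)"
  shows "F = F'"
  by (rule PiE_ext[OF assms(1,2)[unfolded carrier_orbit_sum]]) (use assms(3) in auto)

lemma module_orbit_sum: "module K (orbit_sum C Y X)"
  unfolding orbit_sum_def
  by (rule module_direct_sum)
    (auto simp: is_cring finite_orbit Mor_module orbs_subset[OF X] orbs_subset[OF Y])

lemma orbit_sum_component_linear:
  "\<lbrakk>b \<in> Y; a \<in> X\<rbrakk> \<Longrightarrow> (\<lambda>F. F (b, a)) \<in> linear_maps K (orbit_sum C Y X) (Mor C b a)"
  using direct_sum_proj_linear[of "(b, a)" "Y \<times> X" K "\<lambda>(b, a). Mor C b a"]
  by (simp add: orbit_sum_def)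

lemma finsum_orbit_sum_apply:
  "\<lbrakk>b \<in> Y; a \<in> X; finite I; \<And>i. i \<in> I \<Longrightarrow> F i \<in> carrier (orbit_sum C Y X)\<rbrakk>
    \<Longrightarrow> (\<Oplus>\<^bsub>orbit_sum C Y X\<^esub>i\<in>I. F i) (b, a) = (\<Oplus>\<^bsub>Mor C b a\<^esub>i\<in>I. F i (b, a))"
  using orbs_subset[OF X] orbs_subset[OF Y]
  by (intro linear_maps_finsum[OF orbit_sum_component_linear module_orbit_sum Mor_module])

lemma linear_maps_orbit_sumI:
  assumes "\<And>b a. \<lbrakk>b \<in> Y; a \<in> X\<rbrakk> \<Longrightarrow> (\<lambda>v. h v (b, a)) \<in> linear_maps K V (Mor C b a)"
    and "\<And>v. h v \<in> extensional (Y \<times> X)"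
  shows "h \<in> linear_maps K V (orbit_sum C Y X)"
proof -
  have "(\<lambda>v. \<lambda>p\<in>Y \<times> X. h v p) \<in> linear_maps K V (orbit_sum C Y X)"
    unfolding orbit_sum_def
    by (rule direct_sum_tuple_linear) (auto simp: finite_orbit assms(1))
  then show ?thesis
    by (simp add: extensional_restrict assms(2))
qed

lemma action_apply:
  assumes "s \<in> carrier G" "b \<in> Y" "a \<in> X"
  shows "action Y X s F (\<phi> s b, \<phi> s a) = \<psi> s b a (F (b, a))"
  using assms by (simp add: orbit_sum_act_def orbit_closed \<phi>_\<phi> \<phi>_one orbs_subset[OF X]
      orbs_subset[OF Y])

lemma action_cases:
  assumes s: "s \<in> carrier G" and "b \<in> Y" "a \<in> X"
  obtains b' a' where "b' \<in> Y" "a' \<in> X" "b = \<phi> s b'" "a = \<phi> s a'"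
  using assms bij_betw_imp_surj_on[OF bij_betw_\<phi>[OF X s]]
      bij_betw_imp_surj_on[OF bij_betw_\<phi>[OF Y s]]
  by blast

lemma action_linear:
  assumes s: "s \<in> carrier G"
  shows "action Y X s \<in> linear_maps K (orbit_sum C Y X) (orbit_sum C Y X)"
proof (rule linear_maps_orbit_sumI)
  fix b a assume "b \<in> Y" "a \<in> X"
  then obtain b' a' where ba: "b' \<in> Y" "a' \<in> X" "b = \<phi> s b'" "a = \<phi> s a'"
    by (rule action_cases[OF s])
  then show "(\<lambda>F. action Y X s F (b, a)) \<in> linear_maps K (orbit_sum C Y X) (Mor C b a)"
    using linear_maps_comp[OF orbit_sum_component_linear[OF ba(1,2)] act_linear[OF s]]
      orbs_subset[OF X] orbs_subset[OF Y] by (simp add: action_apply[OF s])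
qed (simp add: orbit_sum_act_def)

lemma action_one:
  assumes F: "F \<in> carrier (orbit_sum C Y X)"
  shows "action Y X \<one> F = F"
proof (rule orbit_sum_eqI)
  fix b a assume "b \<in> Y" "a \<in> X"
  then show "action Y X \<one> F (b, a) = F (b, a)"
    using action_apply[OF G.one_closed, of b a F] orbs_subset[OF X, of a] orbs_subset[OF Y, of b]
    by (simp add: \<phi>_one act_one orbit_sum_closed[OF F])
qed (use F in \<open>simp_all add: linear_maps_closed[OF action_linear]\<close>)

lemma finite_linear_action_orbit_sum:
  "finite_linear_action K G (orbit_sum C Y X) (action Y X)"
proof (intro finite_linear_action.intro finite_linear_action_axioms.intro)
  fix s t F assume st: "s \<in> carrier G" "t \<in> carrier G" and F: "F \<in> carrier (orbit_sum C Y X)"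
  note closed = linear_maps_closed[OF action_linear]
  show "action Y X s (action Y X t F) = action Y X (s \<otimes> t) F"
  proof (rule orbit_sum_eqI)
    fix b a assume "b \<in> Y" "a \<in> X"
    then obtain b' a' where ba: "b' \<in> Y" "a' \<in> X" "b = \<phi> (s \<otimes> t) b'" "a = \<phi> (s \<otimes> t) a'"
      using st by (metis action_cases G.m_closed)
    note [simp] = orbs_subset[OF X ba(2)] orbs_subset[OF Y ba(1)]
    have "action Y X s (action Y X t F) (\<phi> s (\<phi> t b'), \<phi> s (\<phi> t a')) =
        \<psi> s (\<phi> t b') (\<phi> t a') (\<psi> t b' a' (F (b', a')))"
      using st ba(1,2) by (simp add: action_apply orbit_closed)
    then show "action Y X s (action Y X t F) (b, a) = action Y X (s \<otimes> t) F (b, a)"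
      using st ba(1,2) by (simp add: ba(3,4) action_apply act_mult orbit_sum_closed[OF F] \<phi>_\<phi>)
  qed (use st F closed in simp_all)
qed (simp_all add: G.group_axioms module_orbit_sum finite_group action_linear)

lemma norm_apply:
  assumes F: "F \<in> carrier (orbit_sum C Y X)" and ba: "b \<in> Y" "a \<in> X"
  shows "norm Y X F (b, a) = (\<Oplus>\<^bsub>Mor C b a\<^esub>s\<in>carrier G. action Y X s F (b, a))"
  unfolding group_norm_def using F ba
  by (intro finsum_orbit_sum_apply) (simp_all add: finite_group
      linear_maps_closed[OF action_linear])

end

definition row_projection ::
    "'o set \<Rightarrow> 'o set \<Rightarrow> 'o \<Rightarrow> ('o \<times> 'o \<Rightarrow> 'm) \<Rightarrow> 'o \<times> 'o \<Rightarrow> 'm" where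
  "row_projection Y X b0 F = (\<lambda>(b, a)\<in>Y \<times> X. if b = b0 then F (b, a) else \<zero>\<^bsub>Mor C b a\<^esub>)"

context
  fixes X Y b0
  assumes X [simp]: "X \<in> orbs" and Y [simp]: "Y \<in> orbs" and b0: "b0 \<in> Y"
begin

lemma row_projection_linear:
  "row_projection Y X b0 \<in> linear_maps K (orbit_sum C Y X) (orbit_sum C Y X)"
proof (rule linear_maps_orbit_sumI[OF X Y])
  show "(\<lambda>F. row_projection Y X b0 F (b, a)) \<in> linear_maps K (orbit_sum C Y X) (Mor C b a)"
    if "b \<in> Y" "a \<in> X" for b a
    using that by (cases "b = b0") (simp_all add: row_projection_def orbit_sum_component_linear
        linear_maps_const_zero Mor_module orbs_subset[OF X] orbs_subset[OF Y])
qed (simp add: row_projection_def)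

lemma action_row_projection:
  assumes s: "s \<in> carrier G" and t: "t \<in> carrier G" and a: "a \<in> X"
    and F: "F \<in> carrier (orbit_sum C Y X)"
  shows "action Y X s (row_projection Y X b0 (action Y X (inv s) F)) (\<phi> t b0, a) =
    (if s = t then F (\<phi> t b0, a) else \<zero>\<^bsub>Mor C (\<phi> t b0) a\<^esub>)"
proof -
  have tb0: "\<phi> t b0 \<in> Y"
    by (rule orbit_closed[OF Y b0 t])
  obtain b' a' where ba': "b' \<in> Y" "a' \<in> X" "\<phi> t b0 = \<phi> s b'" "a = \<phi> s a'"
    using action_cases[OF X Y s tb0 a] .
  have row: "b' = b0 \<longleftrightarrow> s = t"
    using inj_on_eq_iff[OF bij_betw_imp_inj_on[OF bij_betw_\<phi>[OF Y s]] ba'(1) b0] ba'(3)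
      \<phi>_eq_iff[OF t s orbs_subset[OF Y b0]] by auto
  have "\<psi> s b' a' (action Y X (inv s) F (b', a')) =
      action Y X s (action Y X (inv s) F) (\<phi> s b', \<phi> s a')"
    by (rule action_apply[OF X Y s ba'(1,2), symmetric])
  also have "\<dots> = F (\<phi> t b0, a)"
    using s F by (simp add: ba'(3,4) action_one
        finite_linear_action.act_act[OF finite_linear_action_orbit_sum])
  finally show ?thesis
    using s ba' row orbs_subset[OF X ba'(2)] orbs_subset[OF Y ba'(1)]
    by (auto simp: row_projection_def action_apply \<psi>_zero)
qed

text \<open>The translates of a row are disjoint by freeness, and they exhaust all rows.\<close>

lemma relatively_projective_action_orbit_sum:
  "relatively_projective_action K G (orbit_sum C Y X) (action Y X) (row_projection Y X b0)"
proof (intro relatively_projective_action.intro finite_linear_action_orbit_sum X Y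
    relatively_projective_action_axioms.intro row_projection_linear)
  fix F assume F: "F \<in> carrier (orbit_sum C Y X)"
  let ?t = "\<lambda>s. action Y X s (row_projection Y X b0 (action Y X (inv s) F))"
  have closed: "?t s \<in> carrier (orbit_sum C Y X)" if "s \<in> carrier G" for s
    using that F
    by (simp add: linear_maps_closed[OF action_linear] linear_maps_closed[OF row_projection_linear])
  show "(\<Oplus>\<^bsub>orbit_sum C Y X\<^esub>s\<in>carrier G. ?t s) = F"
  proof (rule orbit_sum_eqI[OF X Y])
    fix b a assume ba: "b \<in> Y" "a \<in> X"
    obtain t where t: "t \<in> carrier G" "b = \<phi> t b0"
      using orbit_cases[OF Y b0 ba(1)] .
    note translate = action_row_projection[OF _ t(1) ba(2) F, folded t(2)]
    have "(\<Oplus>\<^bsub>orbit_sum C Y X\<^esub>s\<in>carrier G. ?t s) (b, a) = (\<Oplus>\<^bsub>Mor C b a\<^esub>s\<in>carrier G. ?t s (b, a))"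
      by (rule finsum_orbit_sum_apply[OF X Y ba finite_group closed])
    also have "\<dots> = ?t t (b, a)"
      by (rule abelian_monoid.finsum_eq_single[OF Mor_abelian_monoid])
        (use ba t(1) in \<open>simp_all add: finite_group translate orbit_sum_closed[OF X Y F]
          orbs_subset[OF X] orbs_subset[OF Y]\<close>)
    finally show "(\<Oplus>\<^bsub>orbit_sum C Y X\<^esub>s\<in>carrier G. ?t s) (b, a) = F (b, a)"
      using t(1) by (simp add: translate)
  qed (use F closed in \<open>simp_all add: module_finsum_closed[OF module_orbit_sum]\<close>)
qed

end

definition matrix :: "'o set \<Rightarrow> 'o set \<Rightarrow> ('o \<times> 'o \<Rightarrow> 'm) set \<Rightarrow> 'o \<times> 'o \<Rightarrow> 'm" where
  "matrix Y X = coinvariant_norm G (orbit_sum C Y X) (action Y X)"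

abbreviation invariant_matrices :: "'o set \<Rightarrow> 'o set \<Rightarrow> ('o \<times> 'o \<Rightarrow> 'm) set" where
  "invariant_matrices Y X \<equiv> invariant_vectors G (orbit_sum C Y X) (action Y X)"

abbreviation coset :: "'o set \<Rightarrow> 'o set \<Rightarrow> ('o \<times> 'o \<Rightarrow> 'm) \<Rightarrow> ('o \<times> 'o \<Rightarrow> 'm) set" where
  "coset \<equiv> orbit_class K G C \<phi> \<psi>"

abbreviation orbit_category :: "('k, 'o set, ('o \<times> 'o \<Rightarrow> 'm) set) kcat" where
  "orbit_category \<equiv> quotient_category K G C \<phi> \<psi>"

lemma
  shows Obj_orbit_category: "Obj orbit_category = orbs"
    and Cmp_orbit_category: "Cmp orbit_category Z Y X P Q =
      (\<Union>F\<in>P. \<Union>E\<in>Q. coset Z X (orbit_sum_Cmp G C \<phi> \<psi> Z Y X F E))"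
        and Idt_orbit_category: "Idt orbit_category X =
        (\<Union>a\<in>X. coset X X (orbit_incl C X X a a (Idt C a)))"
  by (simp_all add: quotient_category_def)

context
  fixes X Y
  assumes X: "X \<in> orbs" and Y: "Y \<in> orbs"
begin

lemma
  shows carrier_Mor_orbit_category: "carrier (Mor orbit_category Y X) =
      coset Y X ` carrier (orbit_sum C Y X)"
    and module_Mor_orbit_category: "module K (Mor orbit_category Y X)"
    and matrix_linear: "matrix Y X \<in> linear_maps K (Mor orbit_category Y X) (orbit_sum C Y X)"
    and bij_betw_matrix:
      "bij_betw (matrix Y X) (carrier (Mor orbit_category Y X)) (invariant_matrices Y X)"
    and matrix_coset: "F \<in> carrier (orbit_sum C Y X) \<Longrightarrow> matrix Y X (coset Y X F) = norm Y X F"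
    and coset_eq: "F \<in> carrier (orbit_sum C Y X) \<Longrightarrow>
      coset Y X F = {E \<in> carrier (orbit_sum C Y X). norm Y X E = norm Y X F}"
proof -
  obtain b0 where b0: "b0 \<in> Y"
    using orbs_not_empty[OF Y] by blast
  interpret relatively_projective_action K G "orbit_sum C Y X" "action Y X"
      "row_projection Y X b0"
    by (rule relatively_projective_action_orbit_sum[OF X Y b0])
  note defs = quotient_category_def orbit_class_def matrix_def
  show "carrier (Mor orbit_category Y X) = coset Y X ` carrier (orbit_sum C Y X)"
    by (simp add: defs carrier_coinvariants)
  show "module K (Mor orbit_category Y X)"
    by (simp add: defs module_coinvariants)
  show "matrix Y X \<in> linear_maps K (Mor orbit_category Y X) (orbit_sum C Y X)"
    by (simp add: defs coinvariant_norm_linear)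
  show "bij_betw (matrix Y X) (carrier (Mor orbit_category Y X)) (invariant_matrices Y X)"
    by (simp add: defs bij_betw_coinvariant_norm)
  show "F \<in> carrier (orbit_sum C Y X) \<Longrightarrow> matrix Y X (coset Y X F) = norm Y X F"
    by (simp add: defs coinvariant_norm_coset)
  show "F \<in> carrier (orbit_sum C Y X) \<Longrightarrow>
      coset Y X F = {E \<in> carrier (orbit_sum C Y X). norm Y X E = norm Y X F}"
    by (simp add: defs coset_eq)
qed

lemma norm_closed: "F \<in> carrier (orbit_sum C Y X) \<Longrightarrow> norm Y X F \<in> carrier (orbit_sum C Y X)"
  by (rule linear_maps_closed[OF finite_linear_action.group_norm_linear
        [OF finite_linear_action_orbit_sum[OF X Y]]])

lemma coset_closed: "F \<in> carrier (orbit_sum C Y X) \<Longrightarrow> coset Y X F \<in> carrier (Mor orbit_category Y X)"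
  by (simp add: carrier_Mor_orbit_category)

lemma matrix_closed: "P \<in> carrier (Mor orbit_category Y X)
    \<Longrightarrow> matrix Y X P \<in> carrier (orbit_sum C Y X)"
  by (rule linear_maps_closed[OF matrix_linear])

lemma matrix_invariant: "P \<in> carrier (Mor orbit_category Y X)
    \<Longrightarrow> matrix Y X P \<in> invariant_matrices Y X"
  by (rule bij_betw_apply[OF bij_betw_matrix])

lemma matrix_eqI:
  assumes "P \<in> carrier (Mor orbit_category Y X)" "Q \<in> carrier (Mor orbit_category Y X)"
    and "\<And>b a. \<lbrakk>b \<in> Y; a \<in> X\<rbrakk> \<Longrightarrow> matrix Y X P (b, a) = matrix Y X Q (b, a)"
  shows "P = Q"
  using inj_onD[OF bij_betw_imp_inj_on[OF bij_betw_matrix] orbit_sum_eqI[OF X Y]]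
      assms matrix_closed
  by blast

lemma matrix_entry_linear:
  "\<lbrakk>b \<in> Y; a \<in> X\<rbrakk> \<Longrightarrow> (\<lambda>P. matrix Y X P (b, a)) \<in> linear_maps K (Mor orbit_category Y X) (Mor C b a)"
  by (rule linear_maps_comp[OF matrix_linear orbit_sum_component_linear[OF X Y]])

lemma matrix_entry_closed:
  "\<lbrakk>P \<in> carrier (Mor orbit_category Y X); b \<in> Y; a \<in> X\<rbrakk> \<Longrightarrow> matrix Y X P (b, a) \<in> carrier (Mor C b a)"
  by (rule orbit_sum_closed[OF X Y matrix_closed])

lemma matrix_zero:
  "\<lbrakk>b \<in> Y; a \<in> X\<rbrakk> \<Longrightarrow> matrix Y X \<zero>\<^bsub>Mor orbit_category Y X\<^esub> (b, a) = \<zero>\<^bsub>Mor C b a\<^esub>"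
  using orbs_subset[OF X] orbs_subset[OF Y]
  by (intro linear_maps_zero[OF matrix_entry_linear module_Mor_orbit_category Mor_module])

lemma matrix_finsum:
  "\<lbrakk>b \<in> Y; a \<in> X; finite I; \<And>i. i \<in> I \<Longrightarrow> P i \<in> carrier (Mor orbit_category Y X)\<rbrakk>
    \<Longrightarrow> matrix Y X (\<Oplus>\<^bsub>Mor orbit_category Y X\<^esub>i\<in>I. P i) (b, a) =
      (\<Oplus>\<^bsub>Mor C b a\<^esub>i\<in>I. matrix Y X (P i) (b, a))"
  using orbs_subset[OF X] orbs_subset[OF Y]
  by (intro linear_maps_finsum[OF matrix_entry_linear module_Mor_orbit_category Mor_module])

lemma representative:
  assumes "P \<in> carrier (Mor orbit_category Y X)" "F \<in> P"
  shows "F \<in> carrier (orbit_sum C Y X)" and "norm Y X F = matrix Y X P"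
  using assms by (auto simp: carrier_Mor_orbit_category matrix_coset) (auto simp: coset_eq)

lemma morphism_not_empty: "P \<in> carrier (Mor orbit_category Y X) \<Longrightarrow> P \<noteq> {}"
  using coset_eq by (auto simp: carrier_Mor_orbit_category)

lemma invariant_matrices_closed:
  "M \<in> invariant_matrices Y X \<Longrightarrow> M \<in> carrier (orbit_sum C Y X)"
  by (simp add: invariant_vectors_def)

lemma invariant_matrices_apply:
  assumes "M \<in> invariant_matrices Y X" "s \<in> carrier G" "b \<in> Y" "a \<in> X"
  shows "M (\<phi> s b, \<phi> s a) = \<psi> s b a (M (b, a))"
  using assms action_apply[OF X Y assms(2-4), of M] by (simp add: invariant_vectors_def)

lemma invariant_matricesI:
  assumes M: "M \<in> carrier (orbit_sum C Y X)"
    and \<psi>_M: "\<And>s b a. \<lbrakk>s \<in> carrier G; b \<in> Y; a \<in> X\<rbrakk> \<Longrightarrow> \<psi> s b a (M (b, a)) = M (\<phi> s b, \<phi> s a)"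
  shows "M \<in> invariant_matrices Y X"
proof -
  have "action Y X s M = M" if s: "s \<in> carrier G" for s
  proof (rule orbit_sum_eqI[OF X Y])
    fix b a assume "b \<in> Y" "a \<in> X"
    then show "action Y X s M (b, a) = M (b, a)"
      by (rule action_cases[OF X Y s]) (simp add: action_apply[OF X Y s] \<psi>_M[OF s])
  qed (use M s in \<open>simp_all add: linear_maps_closed[OF action_linear[OF X Y]]\<close>)
  then show ?thesis
    using M by (simp add: invariant_vectors_def)
qed

end

definition matmul ::
    "'o set \<Rightarrow> 'o set \<Rightarrow> 'o set \<Rightarrow> ('o \<times> 'o \<Rightarrow> 'm) \<Rightarrow> ('o \<times> 'o \<Rightarrow> 'm) \<Rightarrow> 'o \<times> 'o \<Rightarrow> 'm" where
  "matmul Z Y X M N = (\<lambda>(d, a)\<in>Z \<times> X. \<Oplus>\<^bsub>Mor C d a\<^esub>c\<in>Y. Cmp C d c a (M (d, c)) (N (c, a)))"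

context
  fixes X Y Z
  assumes XYZ [simp]: "X \<in> orbs" "Y \<in> orbs" "Z \<in> orbs"
begin

lemmas orbs_subset_XYZ = XYZ[THEN orbs_subset]

lemma matmul_linear_left:
  assumes N: "N \<in> carrier (orbit_sum C Y X)"
  shows "(\<lambda>M. matmul Z Y X M N) \<in> linear_maps K (orbit_sum C Z Y) (orbit_sum C Z X)"
proof (rule linear_maps_orbit_sumI)
  fix d a assume da: "d \<in> Z" "a \<in> X"
  then have "(\<lambda>M. \<Oplus>\<^bsub>Mor C d a\<^esub>c\<in>Y. Cmp C d c a (M (d, c)) (N (c, a)))
      \<in> linear_maps K (orbit_sum C Z Y) (Mor C d a)"
    by (intro linear_maps_pointwise_finsum finite_orbit Mor_module
        linear_maps_comp[OF orbit_sum_component_linear Cmp_linear_left])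
      (simp_all add: orbs_subset_XYZ orbit_sum_closed[OF XYZ(1,2) N])
  then show "(\<lambda>M. matmul Z Y X M N (d, a)) \<in> linear_maps K (orbit_sum C Z Y) (Mor C d a)"
    using da by (simp add: matmul_def)
qed (simp_all add: matmul_def)

lemma matmul_closed:
  "\<lbrakk>M \<in> carrier (orbit_sum C Z Y); N \<in> carrier (orbit_sum C Y X)\<rbrakk>
    \<Longrightarrow> matmul Z Y X M N \<in> carrier (orbit_sum C Z X)"
  by (rule linear_maps_closed[OF matmul_linear_left])

lemma action_matmul:
  assumes s [simp]: "s \<in> carrier G" and M: "M \<in> carrier (orbit_sum C Z Y)"
    and N: "N \<in> carrier (orbit_sum C Y X)"
  shows "action Z X s (matmul Z Y X M N) = matmul Z Y X (action Z Y s M) (action Y X s N)"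
proof (rule orbit_sum_eqI)
  note closed = linear_maps_closed[OF action_linear[OF XYZ(2,3) s] M]
    linear_maps_closed[OF action_linear[OF XYZ(1,2) s] N]
  note [simp] = orbs_subset_XYZ closed[THEN orbit_sum_closed[rotated 2]]
      orbit_sum_closed[OF XYZ(2,3) M] orbit_sum_closed[OF XYZ(1,2) N] Cmp_closed \<psi>_closed \<phi>_closed
    orbit_closed finite_orbit
  fix d a assume "d \<in> Z" "a \<in> X"
  then obtain d' a' where da [simp]: "d' \<in> Z" "a' \<in> X" "d = \<phi> s d'" "a = \<phi> s a'"
    by (rule action_cases[OF XYZ(1,3) s])
  have "action Z X s (matmul Z Y X M N) (d, a) =
      \<psi> s d' a' (\<Oplus>\<^bsub>Mor C d' a'\<^esub>c\<in>Y. Cmp C d' c a' (M (d', c)) (N (c, a')))"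
    by (simp add: action_apply matmul_def)
  also have "\<dots> = (\<Oplus>\<^bsub>Mor C d a\<^esub>c\<in>Y. \<psi> s d' a' (Cmp C d' c a' (M (d', c)) (N (c, a'))))"
    by (simp add: \<psi>_finsum)
  also have "\<dots> = (\<Oplus>\<^bsub>Mor C d a\<^esub>c\<in>Y.
      Cmp C d (\<phi> s c) a (action Z Y s M (d, \<phi> s c)) (action Y X s N (\<phi> s c, a)))"
    by (rule Mor_finsum_cong) (simp_all add: action_apply act_Cmp)
  also have "\<dots> = (\<Oplus>\<^bsub>Mor C d a\<^esub>c\<in>Y. Cmp C d c a (action Z Y s M (d, c)) (action Y X s N (c, a)))"
    by (rule abelian_monoid.finsum_bij_betw[OF Mor_abelian_monoid bij_betw_\<phi>])
      simp_all
  finally show "action Z X s (matmul Z Y X M N) (d, a) =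
      matmul Z Y X (action Z Y s M) (action Y X s N) (d, a)"
    by (simp add: matmul_def)
qed (simp_all add: assms linear_maps_closed[OF action_linear] matmul_closed)

lemma norm_matmul:
  assumes M: "M \<in> carrier (orbit_sum C Z Y)" and N: "N \<in> invariant_matrices Y X"
  shows "norm Z X (matmul Z Y X M N) = matmul Z Y X (norm Z Y M) N"
proof -
  have N': "N \<in> carrier (orbit_sum C Y X)" "\<And>s. s \<in> carrier G \<Longrightarrow> action Y X s N = N"
    using N by (simp_all add: invariant_vectors_def)
  note closed = linear_maps_closed[OF action_linear] matmul_closed M N'(1)
  have "norm Z X (matmul Z Y X M N) =
      (\<Oplus>\<^bsub>orbit_sum C Z X\<^esub>s\<in>carrier G. matmul Z Y X (action Z Y s M) N)"
    unfolding group_norm_def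
    by (rule module_finsum_cong[OF module_orbit_sum]) (simp_all add: action_matmul N' closed)
  also have "\<dots> = matmul Z Y X (norm Z Y M) N"
    unfolding group_norm_def
    by (rule linear_maps_finsum[OF matmul_linear_left[OF N'(1)], symmetric])
      (simp_all add: module_orbit_sum finite_group closed)
  finally show ?thesis .
qed

lemma orbit_sum_Cmp_eq_matmul:
  assumes M: "M \<in> carrier (orbit_sum C Z Y)" and N: "N \<in> carrier (orbit_sum C Y X)"
  shows "orbit_sum_Cmp G C \<phi> \<psi> Z Y X M N = matmul Z Y X M (norm Y X N)"
proof -
  note [simp] = orbs_subset_XYZ orbit_sum_closed[OF XYZ(2,3) M]
  have \<psi>_N: "\<psi> s (\<phi> (inv s) c) (\<phi> (inv s) a) (N (\<phi> (inv s) c, \<phi> (inv s) a)) = action Y X s N (c, a)"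
    if "c \<in> Y" "a \<in> X" for s c a
    using that by (simp add: orbit_sum_act_def)
  have inner: "(\<Oplus>\<^bsub>Mor C d a\<^esub>s\<in>carrier G.
      Cmp C d c a (M (d, c)) (\<psi> s (\<phi> (inv s) c) (\<phi> (inv s) a) (N (\<phi> (inv s) c, \<phi> (inv s) a)))) =
    Cmp C d c a (M (d, c)) (norm Y X N (c, a))" if "d \<in> Z" "c \<in> Y" "a \<in> X" for d c a
    using that N by (simp add: \<psi>_N norm_apply Cmp_finsum_right finite_group
        orbit_sum_closed[OF XYZ(1,2) linear_maps_closed[OF action_linear[OF XYZ(1,2)] N]])
  show ?thesis
    unfolding orbit_sum_Cmp_def matmul_def
    by (rule restrict_ext, clarify, rule Mor_finsum_cong)
      (simp_all add: inner Cmp_closed orbit_sum_closed[OF XYZ(1,2) norm_closed] N)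
qed

lemma
  assumes P: "P \<in> carrier (Mor orbit_category Z Y)" and Q: "Q \<in> carrier (Mor orbit_category Y X)"
  shows Cmp_orbit_category_closed: "Cmp orbit_category Z Y X P Q \<in> carrier (Mor orbit_category Z X)"
    and matrix_Cmp: "matrix Z X (Cmp orbit_category Z Y X P Q) =
        matmul Z Y X (matrix Z Y P) (matrix Y X Q)"
proof -
  have product: "orbit_sum_Cmp G C \<phi> \<psi> Z Y X F E \<in> carrier (orbit_sum C Z X)"
    "norm Z X (orbit_sum_Cmp G C \<phi> \<psi> Z Y X F E) = matmul Z Y X (matrix Z Y P) (matrix Y X Q)"
    if "F \<in> P" "E \<in> Q" for F E
    using that P Q by (simp_all add: orbit_sum_Cmp_eq_matmul representative norm_matmul
        matrix_invariant matrix_closed matmul_closed)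
  obtain F E where FE: "F \<in> P" "E \<in> Q"
    using morphism_not_empty[OF XYZ(2,3) P] morphism_not_empty[OF XYZ(1,2) Q] by blast
  have "coset Z X (orbit_sum_Cmp G C \<phi> \<psi> Z Y X F' E') =
      coset Z X (orbit_sum_Cmp G C \<phi> \<psi> Z Y X F E)" if "F' \<in> P" "E' \<in> Q" for F' E'
    using product[OF that] product[OF FE] by (simp add: coset_eq)
  then have "Cmp orbit_category Z Y X P Q = coset Z X (orbit_sum_Cmp G C \<phi> \<psi> Z Y X F E)"
    unfolding Cmp_orbit_category using FE by blast
  then show "Cmp orbit_category Z Y X P Q \<in> carrier (Mor orbit_category Z X)"
    and "matrix Z X (Cmp orbit_category Z Y X P Q) = matmul Z Y X (matrix Z Y P) (matrix Y X Q)"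
    using product[OF FE] by (simp_all add: coset_closed matrix_coset)
qed

end

context
  fixes X Y b0 a0 f
  assumes XY: "X \<in> orbs" "Y \<in> orbs" and ba: "b0 \<in> Y" "a0 \<in> X" and f: "f \<in> carrier (Mor C b0 a0)"
begin

lemma orbit_incl_apply:
  "\<lbrakk>b \<in> Y; a \<in> X\<rbrakk> \<Longrightarrow> orbit_incl C Y X b0 a0 f (b, a) = (if b = b0 \<and> a = a0 then f else \<zero>\<^bsub>Mor C b a\<^esub>)"
  by (simp add: orbit_incl_def direct_sum_incl_def)

lemma orbit_incl_closed: "orbit_incl C Y X b0 a0 f \<in> carrier (orbit_sum C Y X)"
  using f by (auto simp: carrier_orbit_sum XY orbit_incl_def direct_sum_incl_def Mor_zero_closed
      orbs_subset[OF XY(1)] orbs_subset[OF XY(2)])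

lemma norm_orbit_incl:
  assumes r: "r \<in> carrier G" and a: "a \<in> X"
  shows "norm Y X (orbit_incl C Y X b0 a0 f) (\<phi> r b0, a) =
    (if a = \<phi> r a0 then \<psi> r b0 a0 f else \<zero>\<^bsub>Mor C (\<phi> r b0) a\<^esub>)"
proof -
  note [simp] = XY ba r a orbs_subset[OF XY(1)] orbs_subset[OF XY(2)] orbit_closed f
  let ?F = "orbit_incl C Y X b0 a0 f"
  have translate: "action Y X s ?F (\<phi> r b0, a) =
      (if s = r \<and> a = \<phi> r a0 then \<psi> r b0 a0 f else \<zero>\<^bsub>Mor C (\<phi> r b0) a\<^esub>)"
    if [simp]: "s \<in> carrier G" for s
  proof -
    obtain b' a' where ba' [simp]: "b' \<in> Y" "a' \<in> X" "\<phi> r b0 = \<phi> s b'" "a = \<phi> s a'"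
      using action_cases[OF XY \<open>s \<in> carrier G\<close>, of "\<phi> r b0" a] by auto
    have "b' = b0 \<longleftrightarrow> s = r"
      using inj_on_eq_iff[OF bij_betw_imp_inj_on[OF bij_betw_\<phi>[OF XY(2) \<open>s \<in> carrier G\<close>]] ba'(1)
          ba(1)]
        ba'(3) \<phi>_eq_iff[of r s b0] by auto
    moreover have "a' = a0 \<longleftrightarrow> a = \<phi> s a0"
      using inj_on_eq_iff[OF bij_betw_imp_inj_on[OF bij_betw_\<phi>[OF XY(1) \<open>s \<in> carrier G\<close>]] ba'(2)
          ba(2)]
      by simp
    ultimately show ?thesis
      using action_apply[OF XY \<open>s \<in> carrier G\<close> ba'(1,2), of ?F]
      by (auto simp: orbit_incl_apply \<psi>_zero)
  qed
  have "norm Y X ?F (\<phi> r b0, a) = (\<Oplus>\<^bsub>Mor C (\<phi> r b0) a\<^esub>s\<in>carrier G. action Y X s ?F (\<phi> r b0, a))"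
    by (simp add: norm_apply orbit_incl_closed)
  also have "\<dots> = action Y X r ?F (\<phi> r b0, a)"
    by (rule abelian_monoid.finsum_eq_single[OF Mor_abelian_monoid])
      (auto simp: translate finite_group Mor_zero_closed \<psi>_closed \<phi>_closed)
  finally show ?thesis
    by (simp add: translate)
qed

end

lemma
  assumes X [simp]: "X \<in> orbs"
  shows Idt_orbit_category_closed: "Idt orbit_category X \<in> carrier (Mor orbit_category X X)"
    and matrix_Idt: "\<lbrakk>b \<in> X; a \<in> X\<rbrakk>
      \<Longrightarrow> matrix X X (Idt orbit_category X) (b, a) = (if b = a then Idt C a else \<zero>\<^bsub>Mor C b a\<^esub>)"
proof -
  let ?F = "\<lambda>c. orbit_incl C X X c c (Idt C c)"
  note [simp] = orbs_subset[OF X] Idt_closed orbit_incl_closed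
  have norm: "norm X X (?F c) (b, a) = (if b = a then Idt C a else \<zero>\<^bsub>Mor C b a\<^esub>)"
    if cb: "c \<in> X" "b \<in> X" and a: "a \<in> X" for a b c
  proof -
    obtain r where "r \<in> carrier G" "b = \<phi> r c"
      using orbit_cases[OF X cb] .
    then show ?thesis
      using cb a by (simp add: norm_orbit_incl \<psi>_Idt)
  qed
  obtain c where c: "c \<in> X"
    using orbs_not_empty[OF X] by blast
  have "coset X X (?F c') = coset X X (?F c)" if "c' \<in> X" for c'
  proof -
    have "norm X X (?F c') = norm X X (?F c)"
      by (rule orbit_sum_eqI[OF X X]) (use that c in \<open>simp_all add: norm norm_closed\<close>)
    then show ?thesis
      using that c by (simp add: coset_eq)
  qed
  then have "Idt orbit_category X = coset X X (?F c)"
    unfolding Idt_orbit_category using c by blast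
  then show "Idt orbit_category X \<in> carrier (Mor orbit_category X X)"
    and "\<lbrakk>b \<in> X; a \<in> X\<rbrakk>
      \<Longrightarrow> matrix X X (Idt orbit_category X) (b, a) = (if b = a then Idt C a else \<zero>\<^bsub>Mor C b a\<^esub>)"
    using c by (simp_all add: coset_closed matrix_coset norm)
qed

lemma matmul_apply:
  "\<lbrakk>d \<in> Z; a \<in> X\<rbrakk> \<Longrightarrow> matmul Z Y X M N (d, a) = (\<Oplus>\<^bsub>Mor C d a\<^esub>c\<in>Y. Cmp C d c a (M (d, c)) (N (c, a)))"
  by (simp add: matmul_def)

theorem orbit_category_presented:
  "matrix_presentation K C orbit_category (\<lambda>X. X) (\<lambda>X a. a) (\<lambda>Y X b a P. matrix Y X P (b, a))"
proof (intro matrix_presentation.intro k_category_axioms matrix_presentation_axioms.intro,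
    unfold Obj_orbit_category)
  show "P = Q"
    if "X \<in> orbs" "Y \<in> orbs" "P \<in> carrier (Mor orbit_category Y X)"
        "Q \<in> carrier (Mor orbit_category Y X)"
      "\<And>b a. \<lbrakk>b \<in> Y; a \<in> X\<rbrakk> \<Longrightarrow> matrix Y X P (b, a) = matrix Y X Q (b, a)" for X Y P Q
    using that by (rule matrix_eqI)
qed (simp_all add: finite_orbit orbs_subset module_Mor_orbit_category Cmp_orbit_category_closed
    Idt_orbit_category_closed matrix_entry_linear matrix_Cmp matmul_apply matrix_Idt)

sublocale orbit_category: k_category K orbit_category
  by (rule matrix_presentation.k_category_presented[OF orbit_category_presented])

end

section \<open>The grading of a Galois covering\<close>

locale finite_galois_covering = finite_free_G_k_category K G C \<phi> \<psi>
  for K :: "('k, 'r) ring_scheme" and G :: "('g, 'q) monoid_scheme" (structure)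
    and C :: "('k, 'o, 'm) kcat" and \<phi> :: "'g \<Rightarrow> 'o \<Rightarrow> 'o"
    and \<psi> :: "'g \<Rightarrow> 'o \<Rightarrow> 'o \<Rightarrow> 'm \<Rightarrow> 'm" +
  fixes x :: "'o set \<Rightarrow> 'o"
  assumes x_mem: "X \<in> orbs \<Longrightarrow> x X \<in> X"
begin

definition coord :: "'o set \<Rightarrow> 'o \<Rightarrow> 'g" where
  "coord X = inv_into (carrier G) (\<lambda>s. \<phi> s (x X))"

definition deg :: "'o set \<Rightarrow> 'o set \<Rightarrow> 'o \<Rightarrow> 'o \<Rightarrow> 'g" where
  "deg Y X b a = inv (coord Y b) \<otimes> coord X a"

context
  fixes X
  assumes X: "X \<in> orbs"
begin

lemma
  assumes "a \<in> X"
  shows coord_closed: "coord X a \<in> carrier G" and \<phi>_coord: "\<phi> (coord X a) (x X) = a"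
  using assms bij_betw_imp_surj_on[OF bij_betw_orbit[OF X x_mem[OF X]]]
  unfolding coord_def by (auto intro: inv_into_into f_inv_into_f)

lemma coord_\<phi>_x: "s \<in> carrier G \<Longrightarrow> coord X (\<phi> s (x X)) = s"
  unfolding coord_def
  by (rule inv_into_f_f[OF bij_betw_imp_inj_on[OF bij_betw_orbit[OF X x_mem[OF X]]]])

lemma coord_\<phi>:
  assumes "s \<in> carrier G" "a \<in> X"
  shows "coord X (\<phi> s a) = s \<otimes> coord X a"
  using assms coord_\<phi>_x[of "s \<otimes> coord X a"] orbs_subset[OF X x_mem[OF X]] coord_closed
  by (simp add: \<phi>_coord flip: \<phi>_\<phi>)

lemma deg_self_eq_one_iff: "\<lbrakk>b \<in> X; a \<in> X\<rbrakk> \<Longrightarrow> deg X X b a = \<one> \<longleftrightarrow> b = a"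
  using \<phi>_coord by (auto simp: deg_def G.inv_mult_eq_one_iff coord_closed) metis

end

context
  fixes X Y
  assumes X [simp]: "X \<in> orbs" and Y [simp]: "Y \<in> orbs"
begin

lemma deg_closed: "\<lbrakk>b \<in> Y; a \<in> X\<rbrakk> \<Longrightarrow> deg Y X b a \<in> carrier G"
  by (simp add: deg_def coord_closed)

lemma deg_\<phi>: "\<lbrakk>s \<in> carrier G; b \<in> Y; a \<in> X\<rbrakk> \<Longrightarrow> deg Y X (\<phi> s b) (\<phi> s a) = deg Y X b a"
  by (simp add: deg_def coord_\<phi> coord_closed G.word_simps)

lemma deg_mult:
  "\<lbrakk>Z \<in> orbs; d \<in> Z; c \<in> Y; a \<in> X\<rbrakk> \<Longrightarrow> deg Z Y d c \<otimes> deg Y X c a = deg Z X d a"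
  by (simp add: deg_def coord_closed G.word_simps)

end

definition truncate :: "'o set \<Rightarrow> 'o set \<Rightarrow> 'g \<Rightarrow> ('o \<times> 'o \<Rightarrow> 'm) \<Rightarrow> 'o \<times> 'o \<Rightarrow> 'm" where
  "truncate Y X u M = (\<lambda>(b, a)\<in>Y \<times> X. if deg Y X b a = u then M (b, a) else \<zero>\<^bsub>Mor C b a\<^esub>)"

definition homogeneous_component ::
    "'o set \<Rightarrow> 'o set \<Rightarrow> 'g \<Rightarrow> ('o \<times> 'o \<Rightarrow> 'm) set \<Rightarrow> ('o \<times> 'o \<Rightarrow> 'm) set" where
  "homogeneous_component Y X u P =
     inv_into (carrier (Mor orbit_category Y X)) (matrix Y X) (truncate Y X u (matrix Y X P))"

context
  fixes X Y
  assumes X [simp]: "X \<in> orbs" and Y [simp]: "Y \<in> orbs"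
begin

lemma truncate_apply:
  "\<lbrakk>b \<in> Y; a \<in> X\<rbrakk>
    \<Longrightarrow> truncate Y X u M (b, a) = (if deg Y X b a = u then M (b, a) else \<zero>\<^bsub>Mor C b a\<^esub>)"
  by (simp add: truncate_def)

lemma truncate_linear: "truncate Y X u \<in> linear_maps K (orbit_sum C Y X) (orbit_sum C Y X)"
proof (rule linear_maps_orbit_sumI[OF X Y])
  fix b a assume "b \<in> Y" "a \<in> X"
  then show "(\<lambda>M. truncate Y X u M (b, a)) \<in> linear_maps K (orbit_sum C Y X) (Mor C b a)"
    using orbs_subset[OF X] orbs_subset[OF Y]
    by (cases "deg Y X b a = u")
      (simp_all add: truncate_apply orbit_sum_component_linear linear_maps_const_zero Mor_module)
qed (simp add: truncate_def)

lemma truncate_invariant: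
  assumes M: "M \<in> invariant_matrices Y X"
  shows "truncate Y X u M \<in> invariant_matrices Y X"
proof (rule invariant_matricesI[OF X Y])
  show "truncate Y X u M \<in> carrier (orbit_sum C Y X)"
    by (rule linear_maps_closed[OF truncate_linear invariant_matrices_closed[OF X Y M]])
  show "\<psi> s b a (truncate Y X u M (b, a)) = truncate Y X u M (\<phi> s b, \<phi> s a)"
    if "s \<in> carrier G" "b \<in> Y" "a \<in> X" for s b a
    using that orbs_subset[OF X] orbs_subset[OF Y] invariant_matrices_apply[OF X Y M that]
    by (simp add: truncate_apply orbit_closed deg_\<phi> \<psi>_zero)
qed

lemma truncate_matrix_mem_image:
  assumes "P \<in> carrier (Mor orbit_category Y X)"
  shows "truncate Y X u (matrix Y X P) \<in> matrix Y X ` carrier (Mor orbit_category Y X)"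
  unfolding bij_betw_imp_surj_on[OF bij_betw_matrix[OF X Y]]
  using assms by (intro truncate_invariant matrix_invariant) simp_all

lemma homogeneous_component_linear:
  "homogeneous_component Y X u
    \<in> linear_maps K (Mor orbit_category Y X) (Mor orbit_category Y X)"
  unfolding homogeneous_component_def[abs_def]
  by (rule linear_maps_lift[OF module_Mor_orbit_category[OF X Y] module_Mor_orbit_category[OF X Y]
        matrix_linear[OF X Y] bij_betw_imp_inj_on[OF bij_betw_matrix[OF X Y]]
        linear_maps_comp[OF matrix_linear[OF X Y] truncate_linear] truncate_matrix_mem_image])

lemma homogeneous_component_closed:
  "P \<in> carrier (Mor orbit_category Y X)
    \<Longrightarrow> homogeneous_component Y X u P \<in> carrier (Mor orbit_category Y X)"
  by (rule linear_maps_closed[OF homogeneous_component_linear])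

lemma matrix_homogeneous_component:
  "P \<in> carrier (Mor orbit_category Y X)
    \<Longrightarrow> matrix Y X (homogeneous_component Y X u P) = truncate Y X u (matrix Y X P)"
  unfolding homogeneous_component_def by (rule f_inv_into_f[OF truncate_matrix_mem_image])

lemma sum_homogeneous_components:
  assumes P: "P \<in> carrier (Mor orbit_category Y X)"
  shows "(\<Oplus>\<^bsub>Mor orbit_category Y X\<^esub>u\<in>carrier G. homogeneous_component Y X u P) = P"
proof (rule matrix_eqI[OF X Y])
  note closed = homogeneous_component_closed[OF P] matrix_entry_closed[OF X Y]
  fix b a assume ba: "b \<in> Y" "a \<in> X"
  note [simp] = orbs_subset[OF X ba(2)] orbs_subset[OF Y ba(1)]
  have "matrix Y X (\<Oplus>\<^bsub>Mor orbit_category Y X\<^esub>u\<in>carrier G. homogeneous_component Y X u P) (b, a) =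
      (\<Oplus>\<^bsub>Mor C b a\<^esub>u\<in>carrier G. matrix Y X (homogeneous_component Y X u P) (b, a))"
    by (rule matrix_finsum[OF X Y ba finite_group closed(1)])
  also have "\<dots> = matrix Y X (homogeneous_component Y X (deg Y X b a) P) (b, a)"
    by (rule abelian_monoid.finsum_eq_single[OF Mor_abelian_monoid])
      (use ba P in \<open>simp_all add: finite_group deg_closed closed matrix_homogeneous_component
          truncate_apply\<close>)
  finally show "matrix Y X (\<Oplus>\<^bsub>Mor orbit_category Y X\<^esub>u\<in>carrier G. homogeneous_component Y X u P)
      (b, a) = matrix Y X P (b, a)"
    using ba P by (simp add: matrix_homogeneous_component truncate_apply)
qed (simp_all add: P homogeneous_component_closed
    module_finsum_closed[OF module_Mor_orbit_category])

lemma deg_eq_iff: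
  assumes "r \<in> carrier G" "u \<in> carrier G" "a \<in> X"
  shows "deg Y X (\<phi> r (x Y)) a = u \<longleftrightarrow> a = \<phi> r (\<phi> u (x X))"
proof -
  have "deg Y X (\<phi> r (x Y)) a = u \<longleftrightarrow> coord X a = r \<otimes> u"
    using assms G.inv_solve_left[of u r "coord X a"] by (auto simp: deg_def coord_\<phi>_x coord_closed)
  also have "\<dots> \<longleftrightarrow> a = \<phi> (r \<otimes> u) (x X)"
    using assms \<phi>_coord[OF X, of a] coord_\<phi>_x[OF X, of "r \<otimes> u"] by auto
  finally show ?thesis
    using assms orbs_subset[OF X x_mem[OF X]] by (simp add: \<phi>_\<phi>)
qed

lemma
  assumes u: "u \<in> carrier G" and f: "f \<in> carrier (Mor C (x Y) (\<phi> u (x X)))"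
  shows homogeneous_coset_closed: "coset Y X (orbit_incl C Y X (x Y) (\<phi> u (x X)) f)
      \<in> carrier (Mor orbit_category Y X)"
    and matrix_homogeneous_coset: "\<lbrakk>r \<in> carrier G; a \<in> X\<rbrakk>
      \<Longrightarrow> matrix Y X (coset Y X (orbit_incl C Y X (x Y) (\<phi> u (x X)) f)) (\<phi> r (x Y), a) =
        (if deg Y X (\<phi> r (x Y)) a = u then \<psi> r (x Y) (\<phi> u (x X)) f else \<zero>\<^bsub>Mor C (\<phi> r (x Y)) a\<^esub>)"
  using u orbit_incl_closed[OF X Y _ _ f] norm_orbit_incl[OF X Y _ _ f]
  by (simp_all add: x_mem orbit_closed coset_closed matrix_coset deg_eq_iff)

lemma eq_homogeneous_coset:
  assumes u: "u \<in> carrier G" and P: "P \<in> carrier (Mor orbit_category Y X)"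
    and supported: "truncate Y X u (matrix Y X P) = matrix Y X P"
  shows "P = coset Y X (orbit_incl C Y X (x Y) (\<phi> u (x X)) (matrix Y X P (x Y, \<phi> u (x X))))"
    (is "_ = coset Y X (orbit_incl C Y X _ _ ?f)")
proof -
  have f: "?f \<in> carrier (Mor C (x Y) (\<phi> u (x X)))"
    using u P by (simp add: matrix_entry_closed x_mem orbit_closed)
  show ?thesis
  proof (rule matrix_eqI[OF X Y P homogeneous_coset_closed[OF u f]])
    fix b a assume ba: "b \<in> Y" "a \<in> X"
    obtain r where r: "r \<in> carrier G" "b = \<phi> r (x Y)"
      using orbit_cases[OF Y x_mem[OF Y] ba(1)] .
    have "matrix Y X P (b, a) = \<zero>\<^bsub>Mor C b a\<^esub>" if "deg Y X b a \<noteq> u"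
      using ba that by (subst supported[symmetric]) (simp add: truncate_apply)
    moreover have "matrix Y X P (b, \<phi> r (\<phi> u (x X))) = \<psi> r (x Y) (\<phi> u (x X)) ?f"
      using u r invariant_matrices_apply[OF X Y matrix_invariant[OF X Y P] r(1)]
      by (simp add: x_mem orbit_closed)
    ultimately show "matrix Y X P (b, a) =
        matrix Y X (coset Y X (orbit_incl C Y X (x Y) (\<phi> u (x X)) ?f)) (b, a)"
      using u ba r matrix_homogeneous_coset[OF u f, of r a] deg_eq_iff[of r u a] by auto
  qed
qed

lemma degree_component_eq:
  assumes u [simp]: "u \<in> carrier G"
  shows "degree_component K G C \<phi> \<psi> x Y X u =
    {P \<in> carrier (Mor orbit_category Y X). truncate Y X u (matrix Y X P) = matrix Y X P}"
    (is "_ = ?supported")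
proof (intro equalityI subsetI)
  let ?P = "\<lambda>f. coset Y X (orbit_incl C Y X (x Y) (\<phi> u (x X)) f)"
  note P_closed = homogeneous_coset_closed[OF u] and matrix_P = matrix_homogeneous_coset[OF u]
  note [simp] = x_mem orbit_closed
  show "P \<in> ?supported" if P_mem: "P \<in> degree_component K G C \<phi> \<psi> x Y X u" for P
  proof -
    obtain f where f: "f \<in> carrier (Mor C (x Y) (\<phi> u (x X)))" and P: "P = ?P f"
      using P_mem by (auto simp: degree_component_def)
    have "truncate Y X u (matrix Y X P) = matrix Y X P"
    proof (rule orbit_sum_eqI[OF X Y])
      fix b a assume "b \<in> Y" "a \<in> X"
      then show "truncate Y X u (matrix Y X P) (b, a) = matrix Y X P (b, a)"
        by (cases rule: orbit_cases[OF Y x_mem[OF Y], of b])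
            (auto simp: truncate_apply P matrix_P[OF f])
    qed (use P_closed[OF f] in \<open>simp_all add: P matrix_closed
        linear_maps_closed[OF truncate_linear]\<close>)
    then show ?thesis
      using P_closed[OF f] by (simp add: P)
  qed
  show "P \<in> degree_component K G C \<phi> \<psi> x Y X u" if "P \<in> ?supported" for P
  proof -
    have P: "P \<in> carrier (Mor orbit_category Y X)"
      and "truncate Y X u (matrix Y X P) = matrix Y X P"
      using that by simp_all
    then have "P = ?P (matrix Y X P (x Y, \<phi> u (x X)))"
      by (rule eq_homogeneous_coset[OF u])
    moreover have "matrix Y X P (x Y, \<phi> u (x X)) \<in> carrier (Mor C (x Y) (\<phi> u (x X)))"
      using P by (simp add: matrix_entry_closed)
    ultimately show ?thesis
      unfolding degree_component_def by (rule image_eqI)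
  qed
qed

lemma grading_act_eq_homogeneous_component:
  assumes u: "u \<in> carrier G" and P: "P \<in> carrier (Mor orbit_category Y X)"
  shows "grading_act K G C \<phi> \<psi> x u Y X P = homogeneous_component Y X u P"
  unfolding grading_act_def
proof (rule homogeneous_part_eqI[OF module_Mor_orbit_category[OF X Y] finite_group _
      homogeneous_component_linear _ _ sum_homogeneous_components u P])
  have truncate_truncate: "truncate Y X s (truncate Y X t M) =
      (if s = t then truncate Y X t M else \<zero>\<^bsub>orbit_sum C Y X\<^esub>)" for s t M
    by (auto simp: truncate_def orbit_sum_def direct_sum_zero)
  show "homogeneous_component Y X t Q \<in> degree_component K G C \<phi> \<psi> x Y X t"
    if "t \<in> carrier G" "Q \<in> carrier (Mor orbit_category Y X)" for t Q
    using that by (simp add: degree_component_eq homogeneous_component_closed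
        matrix_homogeneous_component truncate_truncate)
  show "homogeneous_component Y X s Q = (if s = t then Q else \<zero>\<^bsub>Mor orbit_category Y X\<^esub>)"
    if "s \<in> carrier G" and t: "t \<in> carrier G" and Q: "Q \<in> degree_component K G C \<phi> \<psi> x Y X t"
        for s t Q
  proof -
    have Q': "Q \<in> carrier (Mor orbit_category Y X)" "truncate Y X t (matrix Y X Q) = matrix Y X Q"
      using Q t by (simp_all add: degree_component_eq)
    have zero: "\<zero>\<^bsub>Mor orbit_category Y X\<^esub> \<in> carrier (Mor orbit_category Y X)"
      "matrix Y X \<zero>\<^bsub>Mor orbit_category Y X\<^esub> = \<zero>\<^bsub>orbit_sum C Y X\<^esub>"
      by (simp_all add: orbit_category.Mor_zero_closed Obj_orbit_category
          linear_maps_zero[OF matrix_linear module_Mor_orbit_category module_orbit_sum])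
    have "truncate Y X s (matrix Y X Q) = (if s = t then matrix Y X Q else \<zero>\<^bsub>orbit_sum C Y X\<^esub>)"
      using truncate_truncate[of s t "matrix Y X Q"] by (simp add: Q'(2))
    then show ?thesis
      by (intro matrix_eqI[OF X Y])
        (simp_all add: matrix_homogeneous_component Q'(1) zero homogeneous_component_closed)
  qed
qed (auto simp: degree_component_eq)

lemma
  assumes "u \<in> carrier G" "P \<in> carrier (Mor orbit_category Y X)"
  shows grading_act_closed:
      "grading_act K G C \<phi> \<psi> x u Y X P \<in> carrier (Mor orbit_category Y X)"
    and matrix_grading_act: "\<lbrakk>b \<in> Y; a \<in> X\<rbrakk> \<Longrightarrow>
      matrix Y X (grading_act K G C \<phi> \<psi> x u Y X P) (b, a) =
        (if deg Y X b a = u then matrix Y X P (b, a) else \<zero>\<^bsub>Mor C b a\<^esub>)"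
  using assms by (simp_all add: grading_act_eq_homogeneous_component homogeneous_component_closed
      matrix_homogeneous_component truncate_apply)

end

lemma matrix_Cmp_grading_act_eq_zero:
  assumes [simp]: "u \<in> carrier G" "v \<in> carrier G" "X \<in> orbs" "Y \<in> orbs" "Z \<in> orbs"
    and [simp]: "P \<in> carrier (Mor orbit_category Z Y)" "Q \<in> carrier (Mor orbit_category Y X)"
    and [simp]: "d \<in> Z" "a \<in> X" and deg: "deg Z X d a \<noteq> u \<otimes> v"
  shows "matrix Z X (Cmp orbit_category Z Y X (grading_act K G C \<phi> \<psi> x u Z Y P)
    (grading_act K G C \<phi> \<psi> x v Y X Q)) (d, a) = \<zero>\<^bsub>Mor C d a\<^esub>"
proof -
  note [simp] = assms(3-5)[THEN orbs_subset] matrix_entry_closed grading_act_closed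
      matrix_grading_act
  interpret M: abelian_monoid "Mor C d a"
    by (rule Mor_abelian_monoid) simp_all
  have "Cmp C d c a (matrix Z Y (grading_act K G C \<phi> \<psi> x u Z Y P) (d, c))
      (matrix Y X (grading_act K G C \<phi> \<psi> x v Y X Q) (c, a)) = \<zero>\<^bsub>Mor C d a\<^esub>" if "c \<in> Y" for c
    using that deg deg_mult[of X Y Z d c a]
    by (auto simp: Cmp_zero_left Cmp_zero_right Mor_zero_closed)
  then have "(\<Oplus>\<^bsub>Mor C d a\<^esub>c\<in>Y. Cmp C d c a (matrix Z Y (grading_act K G C \<phi> \<psi> x u Z Y P) (d, c))
      (matrix Y X (grading_act K G C \<phi> \<psi> x v Y X Q) (c, a))) = \<zero>\<^bsub>Mor C d a\<^esub>"
    by (rule M.add.finprod_one_eqI)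
  then show ?thesis
    by (simp add: matrix_Cmp matmul_apply)
qed

sublocale graded: graded_k_category K G orbit_category "grading_act K G C \<phi> \<psi> x"
proof (intro graded_k_category.intro graded_k_category_axioms.intro
    orbit_category.k_category_axioms G.group_axioms finite_group, unfold Obj_orbit_category)
  let ?part = "grading_act K G C \<phi> \<psi> x"
  note [simp] = grading_act_closed matrix_grading_act orbit_category.Mor_zero_closed
    Obj_orbit_category Cmp_orbit_category_closed Idt_orbit_category_closed matrix_zero
  show "?part u Y X \<in> linear_maps K (Mor orbit_category Y X) (Mor orbit_category Y X)"
    if "u \<in> carrier G" "X \<in> orbs" "Y \<in> orbs" for u X Y
    using that
    by (intro linear_maps_cong[OF homogeneous_component_linear module_Mor_orbit_category])
      (simp_all add: grading_act_eq_homogeneous_component)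
  show "?part u Y X (?part v Y X P) = (if u = v then ?part v Y X P else \<zero>\<^bsub>Mor orbit_category Y X\<^esub>)"
    if "u \<in> carrier G" "v \<in> carrier G" "X \<in> orbs" "Y \<in> orbs" "P \<in> carrier (Mor orbit_category Y X)"
        for u v X Y P
    using that by (intro matrix_eqI[OF that(3,4)]) auto
  show "(\<Oplus>\<^bsub>Mor orbit_category Y X\<^esub>u\<in>carrier G. ?part u Y X P) = P"
    if "X \<in> orbs" "Y \<in> orbs" "P \<in> carrier (Mor orbit_category Y X)" for X Y P
    using that sum_homogeneous_components[OF that]
    by (simp add: grading_act_eq_homogeneous_component homogeneous_component_closed
        cong: module_finsum_cong[OF module_Mor_orbit_category])
  show "?part u X X (Idt orbit_category X) =
      (if u = \<one> then Idt orbit_category X else \<zero>\<^bsub>Mor orbit_category X X\<^esub>)"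
    if "u \<in> carrier G" "X \<in> orbs" for u X
    using that deg_self_eq_one_iff[OF that(2)] by (intro matrix_eqI[OF that(2,2)])
        (auto simp: matrix_Idt)
  fix u v w X Y Z P Q
  assume [simp]: "u \<in> carrier G" "v \<in> carrier G" "w \<in> carrier G" "X \<in> orbs" "Y \<in> orbs" "Z \<in> orbs"
    and PQ [simp]: "P \<in> carrier (Mor orbit_category Z Y)" "Q \<in> carrier (Mor orbit_category Y X)"
  let ?PQ = "Cmp orbit_category Z Y X (?part u Z Y P) (?part v Y X Q)"
  have "matrix Z X ?PQ (d, a) = \<zero>\<^bsub>Mor C d a\<^esub>" if "d \<in> Z" "a \<in> X" "deg Z X d a \<noteq> u \<otimes> v" for d a
    using that by (intro matrix_Cmp_grading_act_eq_zero) simp_all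
  then show "?part w Z X ?PQ = (if w = u \<otimes> v then ?PQ else \<zero>\<^bsub>Mor orbit_category Z X\<^esub>)"
    by (intro matrix_eqI[of X Z]) auto
qed

definition column_entry :: "'o set \<Rightarrow> 'o set \<Rightarrow> 'o \<Rightarrow> 'o \<Rightarrow> ('g \<Rightarrow> ('o \<times> 'o \<Rightarrow> 'm) set) \<Rightarrow> 'm" where
  "column_entry Y X b a F = matrix Y X (F (inv (coord X a))) (b, a)"

context
  fixes X Y
  assumes X [simp]: "X \<in> orbs" and Y [simp]: "Y \<in> orbs"
begin

lemma column_entry_linear:
  assumes "b \<in> Y" "a \<in> X"
  shows "column_entry Y X b a \<in> linear_maps K (Mor graded.dual_smash Y X) (Mor C b a)"
  unfolding column_entry_def[abs_def] using assms
  by (intro linear_maps_comp[OF graded.dual_smash_component_linear matrix_entry_linear])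
    (simp_all add: coord_closed)

lemma matrix_column_inj:
  assumes P: "P \<in> carrier (Mor orbit_category Y X)" and Q: "Q \<in> carrier (Mor orbit_category Y X)"
    and a: "a \<in> X" and column: "\<And>b. b \<in> Y \<Longrightarrow> matrix Y X P (b, a) = matrix Y X Q (b, a)"
  shows "P = Q"
proof (rule matrix_eqI[OF X Y P Q])
  fix b' a' assume ba': "b' \<in> Y" "a' \<in> X"
  obtain s where s: "s \<in> carrier G" "a' = \<phi> s a"
    using orbit_cases[OF X a ba'(2)] .
  then obtain b where b: "b \<in> Y" "b' = \<phi> s b"
    using bij_betw_imp_surj_on[OF bij_betw_\<phi>[OF Y s(1)]] ba'(1) by blast
  show "matrix Y X P (b', a') = matrix Y X Q (b', a')"
    using invariant_matrices_apply[OF X Y matrix_invariant[OF X Y P] s(1) b(1) a]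
      invariant_matrices_apply[OF X Y matrix_invariant[OF X Y Q] s(1) b(1) a]
    by (simp add: s b column)
qed

lemma matrix_column_surj:
  assumes a0: "a0 \<in> X" and m: "\<And>b. b \<in> Y \<Longrightarrow> m b \<in> carrier (Mor C b a0)"
  shows "\<exists>P\<in>carrier (Mor orbit_category Y X). \<forall>b\<in>Y. matrix Y X P (b, a0) = m b"
proof -
  note [simp] = a0 m orbs_subset[OF X] orbs_subset[OF Y] orbit_incl_closed coset_closed
  let ?P = "\<lambda>b. coset Y X (orbit_incl C Y X b a0 (m b))"
  have entry: "matrix Y X (?P b') (b, a0) = (if b' = b then m b else \<zero>\<^bsub>Mor C b a0\<^esub>)"
    if b' [simp]: "b' \<in> Y" and b: "b \<in> Y" for b b'
  proof -
    obtain r where r: "r \<in> carrier G" "b = \<phi> r b'"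
      using orbit_cases[OF Y b' b] .
    then show ?thesis
      using \<phi>_eq_iff[of r \<one> a0] \<phi>_eq_iff[of r \<one> b']
      by (auto simp: matrix_coset norm_orbit_incl \<phi>_one act_one)
  qed
  have "matrix Y X (\<Oplus>\<^bsub>Mor orbit_category Y X\<^esub>b\<in>Y. ?P b) (b, a0) = m b" if b: "b \<in> Y" for b
  proof -
    have "matrix Y X (\<Oplus>\<^bsub>Mor orbit_category Y X\<^esub>b\<in>Y. ?P b) (b, a0) =
        (\<Oplus>\<^bsub>Mor C b a0\<^esub>b'\<in>Y. matrix Y X (?P b') (b, a0))"
      using b by (intro matrix_finsum finite_orbit) simp_all
    also have "\<dots> = matrix Y X (?P b) (b, a0)"
      by (rule abelian_monoid.finsum_eq_single[OF Mor_abelian_monoid])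
        (use b in \<open>simp_all add: finite_orbit entry\<close>)
    finally show ?thesis
      using b by (simp add: entry)
  qed
  then show ?thesis
    by (intro bexI[of _ "\<Oplus>\<^bsub>Mor orbit_category Y X\<^esub>b\<in>Y. ?P b"] ballI
        module_finsum_closed[OF module_Mor_orbit_category]) simp_all
qed

lemma column_entry_surj:
  assumes m: "\<And>b a. \<lbrakk>b \<in> Y; a \<in> X\<rbrakk> \<Longrightarrow> m b a \<in> carrier (Mor C b a)"
  shows "\<exists>F\<in>carrier (Mor graded.dual_smash Y X). \<forall>b\<in>Y. \<forall>a\<in>X. column_entry Y X b a F = m b a"
proof -
  have "\<forall>a\<in>X. \<exists>P. P \<in> carrier (Mor orbit_category Y X) \<and> (\<forall>b\<in>Y. matrix Y X P (b, a) = m b a)"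
    using matrix_column_surj[where m = "\<lambda>b. m b a" for a] m by (simp only: Bex_def) blast
  then obtain P where P: "\<And>a. a \<in> X \<Longrightarrow> P a \<in> carrier (Mor orbit_category Y X)"
    "\<And>a b. \<lbrakk>a \<in> X; b \<in> Y\<rbrakk> \<Longrightarrow> matrix Y X (P a) (b, a) = m b a"
    unfolding bchoice_iff by blast
  let ?F = "\<lambda>u\<in>carrier G. P (\<phi> (inv u) (x X))"
  have "?F \<in> carrier (Mor graded.dual_smash Y X)"
    by (auto simp: graded.carrier_Mor_dual_smash x_mem orbit_closed intro!: P)
  moreover have "column_entry Y X b a ?F = m b a" if "b \<in> Y" "a \<in> X" for b a
    using that by (simp add: column_entry_def coord_closed \<phi>_coord P)
  ultimately show ?thesis
    by blast
qed

lemma column_entry_inj: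
  assumes F: "F \<in> carrier (Mor graded.dual_smash Y X)"
    and E: "E \<in> carrier (Mor graded.dual_smash Y X)"
    and eq: "\<And>b a. \<lbrakk>b \<in> Y; a \<in> X\<rbrakk> \<Longrightarrow> column_entry Y X b a F = column_entry Y X b a E"
  shows "F = E"
proof (rule PiE_ext[OF F[unfolded graded.carrier_Mor_dual_smash]
    E[unfolded graded.carrier_Mor_dual_smash]])
  fix u assume u: "u \<in> carrier G"
  show "F u = E u"
  proof (rule matrix_column_inj[where a = "\<phi> (inv u) (x X)"])
    show "matrix Y X (F u) (b, \<phi> (inv u) (x X)) = matrix Y X (E u) (b, \<phi> (inv u) (x X))" if "b \<in> Y"
        for b
      using eq[OF that, of "\<phi> (inv u) (x X)"] u
      by (simp add: column_entry_def coord_\<phi>_x x_mem orbit_closed)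
  qed (use F E u in \<open>simp_all add: graded.dual_smash_component_closed x_mem orbit_closed\<close>)
qed

end

lemma column_entry_Cmp:
  assumes XYZ [simp]: "X \<in> orbs" "Y \<in> orbs" "Z \<in> orbs"
    and F: "F \<in> carrier (Mor graded.dual_smash Z Y)"
    and E: "E \<in> carrier (Mor graded.dual_smash Y X)"
    and a [simp]: "a \<in> X" and d [simp]: "d \<in> Z"
  shows "column_entry Z X d a (Cmp graded.dual_smash Z Y X F E) =
    (\<Oplus>\<^bsub>Mor C d a\<^esub>c\<in>Y. Cmp C d c a (column_entry Z Y d c F) (column_entry Y X c a E))"
proof -
  let ?u = "inv (coord X a)"
  let ?E = "\<lambda>h. grading_act K G C \<phi> \<psi> x (h \<otimes> inv ?u) Y X (E ?u)"
  let ?t = "\<lambda>h c. Cmp C d c a (matrix Z Y (F h) (d, c)) (matrix Y X (?E h) (c, a))"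
  note [simp] = graded.dual_smash_component_closed[OF F] graded.dual_smash_component_closed[OF E]
    XYZ[THEN orbs_subset] coord_closed finite_group finite_orbit matrix_entry_closed
        grading_act_closed
    Cmp_orbit_category_closed Cmp_closed
  interpret M: abelian_monoid "Mor C d a"
    by (rule Mor_abelian_monoid) simp_all
  have "column_entry Z X d a (Cmp graded.dual_smash Z Y X F E) =
      (\<Oplus>\<^bsub>Mor C d a\<^esub>h\<in>carrier G. \<Oplus>\<^bsub>Mor C d a\<^esub>c\<in>Y. ?t h c)"
    by (simp add: column_entry_def graded.Cmp_dual_smash[OF _ _ _ F E] Obj_orbit_category
        matrix_finsum matrix_Cmp matmul_apply Pi_def cong: M.finsum_cong)
  also have "\<dots> = (\<Oplus>\<^bsub>Mor C d a\<^esub>c\<in>Y. \<Oplus>\<^bsub>Mor C d a\<^esub>h\<in>carrier G. ?t h c)"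
    by (rule M.finsum_swap) simp_all
  also have "\<dots> = (\<Oplus>\<^bsub>Mor C d a\<^esub>c\<in>Y. Cmp C d c a (column_entry Z Y d c F) (column_entry Y X c a E))"
  proof (rule M.finsum_cong'[OF refl])
    fix c assume [simp]: "c \<in> Y"
    have "deg Y X c a = h \<otimes> inv ?u \<longleftrightarrow> h = inv (coord Y c)" if "h \<in> carrier G" for h
      using that by (auto simp: deg_def)
    then have "(\<Oplus>\<^bsub>Mor C d a\<^esub>h\<in>carrier G. ?t h c) = ?t (inv (coord Y c)) c"
      by (intro M.finsum_eq_single) (simp_all add: matrix_grading_act Cmp_zero_right)
    then show "(\<Oplus>\<^bsub>Mor C d a\<^esub>h\<in>carrier G. ?t h c) =
        Cmp C d c a (column_entry Z Y d c F) (column_entry Y X c a E)"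
      by (simp add: column_entry_def matrix_grading_act deg_def)
  qed (simp add: column_entry_def)
  finally show ?thesis .
qed

theorem dual_smash_presented:
  "full_matrix_presentation K C graded.dual_smash (\<lambda>X. X) (\<lambda>X a. a) column_entry"
proof (intro full_matrix_presentation.intro matrix_presentation.intro k_category_axioms
    matrix_presentation_axioms.intro full_matrix_presentation_axioms.intro,
    unfold graded.Obj_dual_smash Obj_orbit_category)
  show "column_entry X X b a (Idt graded.dual_smash X) = (if b = a then Idt C a else \<zero>\<^bsub>Mor C b a\<^esub>)"
    if "X \<in> orbs" "a \<in> X" "b \<in> X" for X a b
    using that by (simp add: column_entry_def graded.Idt_dual_smash Obj_orbit_category coord_closed
        matrix_Idt)
  show "F = E"
    if "X \<in> orbs" "Y \<in> orbs" "F \<in> carrier (Mor graded.dual_smash Y X)"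
      "E \<in> carrier (Mor graded.dual_smash Y X)"
      "\<And>b a. \<lbrakk>b \<in> Y; a \<in> X\<rbrakk> \<Longrightarrow> column_entry Y X b a F = column_entry Y X b a E" for X Y F E
    using that by (rule column_entry_inj)
  show "\<exists>X\<in>orbs. \<exists>a\<in>X. a = c" if "c \<in> Obj C" for c
    using orbit_in_orbs[OF that] orbit_refl[OF that] by blast
qed (simp_all add: finite_orbit orbs_subset graded.module_Mor_dual_smash
    graded.Cmp_dual_smash_closed graded.Idt_dual_smash_closed Obj_orbit_category
    column_entry_linear column_entry_Cmp column_entry_surj)

end

theorem theorem4p9:
  fixes K :: "('k, 'r) ring_scheme" and G :: "('g, 'q) monoid_scheme"
    and C :: "('k, 'o, 'm) kcat"
    and \<phi> :: "'g \<Rightarrow> 'o \<Rightarrow> 'o" and \<psi> :: "'g \<Rightarrow> 'o \<Rightarrow> 'o \<Rightarrow> 'm \<Rightarrow> 'm"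
    and B :: "('k, 'o set, ('o \<times> 'o \<Rightarrow> 'm) set) kcat"
    and P :: "('o, 'm, 'o set, ('o \<times> 'o \<Rightarrow> 'm) set) kfun"
    and x :: "'o set \<Rightarrow> 'o"
    and A :: "('k, 'o set, 'g \<Rightarrow> ('o \<times> 'o \<Rightarrow> 'm) set) kcat"
    and S :: "('k, 'o set, 'g \<Rightarrow> 'g \<Rightarrow> ('o \<times> 'o \<Rightarrow> 'm) set) kcat"
    and E :: "('o set, 'g \<Rightarrow> ('o \<times> 'o \<Rightarrow> 'm) set,
               'o set, 'g \<Rightarrow> 'g \<Rightarrow> ('o \<times> 'o \<Rightarrow> 'm) set) kfun"
  assumes "field K"
    and "group G" and "finite (carrier G)"
    and "galois_covering K G C \<phi> \<psi> B P"
    and "\<forall>\<alpha>\<in>Obj B. x \<alpha> \<in> \<alpha>"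
    and "A = smash_category K (dual_group_algebra K G) (grading_act K G C \<phi> \<psi> x) B"
    and "smash_extension K (group_algebra K G) (translation_act G) A S E"
    and "infinite (UNIV :: 'v set)"
  shows "morita_equivalent TYPE('v) K A C \<and> morita_equivalent TYPE('v) K S B"
proof -
  have B: "B = quotient_category K G C \<phi> \<psi>" and free: "free_G_k_category K G C \<phi> \<psi>"
    using assms(4) by (simp_all add: galois_covering_def)
  interpret free_G_k_category K G C \<phi> \<psi>
    by (rule free)
  interpret finite_galois_covering K G C \<phi> \<psi> x
    by unfold_locales (use assms(3,5) in \<open>simp_all add: B quotient_category_def\<close>)
  have A: "A = graded.dual_smash"
    by (simp add: assms(6) B)
  have S: "S = graded.double_smash"
    using assms(7) by (simp add: smash_extension_def A)
  show ?thesis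
    unfolding A S B
    using full_matrix_presentation.morita_equivalent_presented[OF dual_smash_presented assms(8)]
      full_matrix_presentation.morita_equivalent_presented[OF graded.double_smash_presented
          assms(8)]
    by (rule conjI)
qed

end
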